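(* Let $\mathcal{Q}$ be a set of noncommutative polynomials in $\mathbb{C}\langle Z_{i,j}\rangle$ with $\mathcal{N}_{\mathcal{Q}}\neq\{0\}$. Let $\mathbf{T}=(T_1,\ldots,T_k)\in B(\mathcal{H})^{n_1}\times_c\cdots\times_cB(\mathcal{H})^{n_k}$, $T_i=(T_{i,1},\ldots,T_{i,n_i})$, be such that each $\Phi_{f_i,T_i}$ is well-defined. Then $\mathbf{T}$ is in the noncommutative variety $\mathcal{V}_{\mathcal{Q}}(\mathcal{H})$ and is pure if and only if there exists a unitary operator $U:\mathcal{H}\to\mathcal{G}$ such that $$T_{i,j}^*=U^*[(\mathbf{S}_{i,j}^*\otimes I_{\mathcal{D}})|_{\mathcal{G}}]U$$ for all $i\in\{1,\ldots,k\}$ and $j\in\{1,\ldots,n_i\}$, where $\mathcal{D}:=\overline{\mathbf{\Delta}_{\mathbf{f},\mathbf{T}}^{\mathbf{m}}(I)(\mathcal{H})}$ (which equals $\overline{\mathbf{\Delta}_{\mathbf{f},\mathbf{T}}^{\mathbf{m}}(I)^{1/2}(\mathcal{H})}$ when $\mathbf{\Delta}_{\mathbf{f},\mathbf{T}}^{\mathbf{m}}(I)\ge0$), $\mathcal{G}\subseteq\mathcal{N}_{\mathcal{Q}}\otimes\mathcal{D}$ is a closed subspace invariant under each operator $\mathbf{S}_{i,j}^*\otimes I_{\mathcal{D}}$, and $\mathbf{S}=\{\mathbf{S}_{i,j}\}$ is the universal model associated with the abstract noncommutative variety $\mathcal{V}_{\mathcal{Q}}$.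
   Context: Hilbert spaces are complex, $\mathcal{H}$ separable. $\mathbb{N}=\{1,2,\ldots\}$, $\mathbb{Z}_+=\{0,1,\ldots\}$; fix $k\in\mathbb{N}$ and $n_i,m_i\in\mathbb{N}$, $\mathbf{m}=(m_1,\ldots,m_k)$. Order on $\mathbb{Z}_+^k$ is coordinatewise. $\mathbb{F}_{n_i}^+$ is the free monoid on generators $g_1^i,\ldots,g_{n_i}^i$ with identity $g_0^i$; $|\alpha|$ is word length. For an $n_i$-tuple $(X_{i,1},\ldots,X_{i,n_i})$ and $\alpha=g^i_{j_1}\cdots g^i_{j_p}$, $X_{i,\alpha}:=X_{i,j_1}\cdots X_{i,j_p}$, $X_{i,g_0^i}:=I$. For $(\alpha)=(\alpha_1,\ldots,\alpha_k)$, $X_{(\alpha)}:=X_{1,\alpha_1}\cdots X_{k,\alpha_k}$. $\mathbf{f}=(f_1,\ldots,f_k)$, where each $f_i=\sum_{\alpha\in\mathbb{F}_{n_i}^+}a_{i,\alpha}Z_{i,\alpha}$ is a positive regular free holomorphic function: a formal power series in noncommuting $Z_{i,1},\ldots,Z_{i,n_i}$ with $a_{i,\alpha}\ge0$, $a_{i,g_0^i}=0$, $a_{i,g_j^i}>0$ for $j=1,\ldots,n_i$, and $\limsup_{p\to\infty}(\sum_{|\alpha|=p}|a_{i,\alpha}|^2)^{1/2p}<\infty$. $B(\mathcal{H})^{n_1}\times_c\cdots\times_cB(\mathcal{H})^{n_k}$ is the set of tuples $\mathbf{X}=(X_1,\ldots,X_k)$, $X_i=(X_{i,1},\ldots,X_{i,n_i})$,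 such that for $s\ne t$ the entries of $X_s$ commute with those of $X_t$. $\Phi_{f_i,X_i}$ is well-defined if $\sum_\alpha a_{i,\alpha}X_{i,\alpha}X_{i,\alpha}^*$ converges in the weak operator topology (WOT); then $\Phi_{f_i,X_i}(Y):=\sum_\alpha a_{i,\alpha}X_{i,\alpha}YX_{i,\alpha}^*$ (WOT). $\mathbf{\Delta}_{\mathbf{f},\mathbf{X}}^{\mathbf{p}}:=(id-\Phi_{f_1,X_1})^{p_1}\circ\cdots\circ(id-\Phi_{f_k,X_k})^{p_k}$. $\mathbf{D}_{\mathbf{f}}^{\mathbf{m}}(\mathcal{H})$ is the set of $\mathbf{X}\in B(\mathcal{H})^{n_1}\times_c\cdots\times_cB(\mathcal{H})^{n_k}$ with $\Phi_{f_i,X_i}$ well-defined and $\mathbf{\Delta}_{\mathbf{f},\mathbf{X}}^{\mathbf{p}}(I)\ge0$ for $0\le\mathbf{p}\le\mathbf{m}$. $\mathcal{V}_{\mathcal{Q}}(\mathcal{H}):=\{\mathbf{X}\in\mathbf{D}_{\mathbf{f}}^{\mathbf{m}}(\mathcal{H}):g(\mathbf{X})=0\ \forall g\in\mathcal{Q}\}$. $\mathbf{T}$ is pure if, for each $i$, $\Phi_{f_i,T_i}^s(I)\to0$ weakly as $s\to\infty$. Universal model: $F^2(H_{n_i})$ is the full Fock space over an $n_i$-dimensional Hilbert space, with orthonormal basis $\{e^i_\alpha\}_{\alpha\in\mathbb{F}_{n_i}^+}$, $e^i_{g_0^i}=1$. Put $b_{i,g_0^i}^{(m_i)}:=1$ and,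 for $|\alpha|\ge1$, $$b_{i,\alpha}^{(m_i)}:=\sum_{p=1}^{|\alpha|}\ \sum_{\gamma_1\cdots\gamma_p=\alpha,\ |\gamma_1|\ge1,\ldots,|\gamma_p|\ge1}a_{i,\gamma_1}\cdots a_{i,\gamma_p}\binom{p+m_i-1}{m_i-1}.$$ $W_{i,j}e^i_\alpha:=\sqrt{b_{i,\alpha}^{(m_i)}/b_{i,g_j^i\alpha}^{(m_i)}}\,e^i_{g_j^i\alpha}$, and $\mathbf{W}_{i,j}:=I\otimes\cdots\otimes W_{i,j}\otimes\cdots\otimes I$ ($W_{i,j}$ in the $i$-th position) on $\bigotimes_{i=1}^kF^2(H_{n_i})$. $\mathbb{C}\langle Z_{i,j}\rangle$ is the algebra of polynomials in $Z_{i,j}$ where $Z_{s,j}$ and $Z_{t,l}$ commute for $s\neq t$ and are otherwise noncommuting. $\mathcal{M}_{\mathcal{Q}}:=\overline{\mathrm{span}}\{\mathbf{W}_{(\alpha)}q(\mathbf{W})\mathbf{W}_{(\beta)}(\mathbb{C}):(\alpha),(\beta)\in\mathbb{F}_{n_1}^+\times\cdots\times\mathbb{F}_{n_k}^+,\ q\in\mathcal{Q}\}$ (where $\mathbb{C}$ denotes the scalar multiples of the vacuum $1\otimes\cdots\otimes1$), $\mathcal{N}_{\mathcal{Q}}:=[\bigotimes_iF^2(H_{n_i})]\ominus\mathcal{M}_{\mathcal{Q}}$, which is invariant under each $\mathbf{W}_{i,j}^*$; $\mathbf{S}_{i,j}:=P_{\mathcal{N}_{\mathcal{Q}}}\mathbf{W}_{i,j}|_{\mathcal{N}_{\mathcal{Q}}}$.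 *)

theory Defs
  imports "HOL-Analysis.Analysis" "HOL-Library.Poly_Mapping"
begin

section \<open>Complex Hilbert spaces\<close>

text \<open>The inner product is linear in its first argument. The axioms tie the complex structure to
  the real inner product space underneath, whose norm, metric and topology are the ones used.\<close>

class complex_hilbert_space = real_inner + complete_space +
  fixes scaleC :: "complex \<Rightarrow> 'a \<Rightarrow> 'a" (infixr \<open>*\<^sub>C\<close> 75)
    and cinner :: "'a \<Rightarrow> 'a \<Rightarrow> complex"
  assumes scaleC_add_right: "c *\<^sub>C (x + y) = c *\<^sub>C x + c *\<^sub>C y"
    and scaleC_add_left: "(c + d) *\<^sub>C x = c *\<^sub>C x + d *\<^sub>C x"
    and scaleC_scaleC: "c *\<^sub>C d *\<^sub>C x = (c * d) *\<^sub>C x"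
    and scaleC_of_real: "complex_of_real r *\<^sub>C x = r *\<^sub>R x"
    and cinner_commute: "cinner x y = cnj (cinner y x)"
    and cinner_add_left: "cinner (x + y) z = cinner x z + cinner y z"
    and cinner_scaleC_left: "cinner (c *\<^sub>C x) y = c * cinner x y"
    and inner_eq_Re_cinner: "inner x y = Re (cinner x y)"

global_interpretation complex_vector:
  vector_space "scaleC :: complex \<Rightarrow> 'a \<Rightarrow> 'a::complex_hilbert_space"
proof
  show "1 *\<^sub>C x = x" for x :: 'a
    using scaleC_of_real[of 1 x] by simp
qed (simp_all add: scaleC_add_right scaleC_add_left scaleC_scaleC)

abbreviation cspan :: "'a::complex_hilbert_space set \<Rightarrow> 'a set"
  where "cspan \<equiv> module.span scaleC"

abbreviation csubspace :: "'a::complex_hilbert_space set \<Rightarrow> bool"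
  where "csubspace \<equiv> module.subspace scaleC"

lemma cinner_self: "cinner x x = complex_of_real ((norm x)\<^sup>2)"
  for x :: "'a::complex_hilbert_space"
proof -
  have "Im (cinner x x) = 0"
    using arg_cong[OF cinner_commute[of x x], of Im] by simp
  moreover have "Re (cinner x x) = (norm x)\<^sup>2"
    by (simp add: power2_norm_eq_inner inner_eq_Re_cinner)
  ultimately show ?thesis
    by (simp add: complex_eq_iff)
qed

lemma cinner_add_right: "cinner x (y + z) = cinner x y + cinner x z"
  for x :: "'a::complex_hilbert_space"
  using cinner_add_left[of y z x] cinner_commute by (metis complex_cnj_add)

lemma cinner_scaleC_right: "cinner x (c *\<^sub>C y) = cnj c * cinner x y"
  for x :: "'a::complex_hilbert_space"
  using cinner_scaleC_left[of c y x] cinner_commute by (metis complex_cnj_mult)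

lemma norm_scaleC: "norm (c *\<^sub>C x) = cmod c * norm x"
  for x :: "'a::complex_hilbert_space"
proof -
  have "complex_of_real ((norm (c *\<^sub>C x))\<^sup>2) = (c * cnj c) * cinner x x"
    by (simp only: cinner_self[symmetric] cinner_scaleC_left cinner_scaleC_right ac_simps)
  also have "\<dots> = complex_of_real ((cmod c * norm x)\<^sup>2)"
    by (simp add: cinner_self power_mult_distrib complex_norm_square [symmetric])
  finally have "(norm (c *\<^sub>C x))\<^sup>2 = (cmod c * norm x)\<^sup>2"
    using of_real_eq_iff by blast
  then show ?thesis
    by (simp add: power2_eq_iff_nonneg)
qed

lemma cmod_cinner_le: "cmod (cinner x y) \<le> norm x * norm y"
  for x :: "'a::complex_hilbert_space"
proof -
  obtain c where c: "cmod c = 1" "c * cinner x y = complex_of_real (cmod (cinner x y))"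
  proof (cases "cinner x y = 0")
    case True
    then show ?thesis using that[of 1] by simp
  next
    case False
    let ?z = "cinner x y"
    have "cmod (cnj ?z / complex_of_real (cmod ?z)) = 1"
      using False by (simp add: norm_divide)
    moreover have "cnj ?z / complex_of_real (cmod ?z) * ?z = complex_of_real (cmod ?z)"
      using False by (simp add: field_simps complex_norm_square power2_eq_square flip: of_real_mult)
         (metis complex_norm_square mult.commute of_real_mult power2_eq_square)
    ultimately show ?thesis using that by blast
  qed
  have "cmod (cinner x y) = inner (c *\<^sub>C x) y"
    by (simp add: inner_eq_Re_cinner cinner_scaleC_left c)
  also have "\<dots> \<le> norm (c *\<^sub>C x) * norm y"
    by (rule norm_cauchy_schwarz)
  finally show ?thesis
    by (simp add: norm_scaleC c)
qed

instantiation complex :: complex_hilbert_space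
begin
definition scaleC_complex :: "complex \<Rightarrow> complex \<Rightarrow> complex"
  where "scaleC_complex c x = c * x"
definition cinner_complex :: "complex \<Rightarrow> complex \<Rightarrow> complex"
  where "cinner_complex x y = x * cnj y"
instance
  by standard
    (simp_all add: scaleC_complex_def cinner_complex_def algebra_simps scaleR_conv_of_real
      inner_complex_def)
end

section \<open>Hilbert space of square-summable families\<close>

typedef (overloaded) ('i, 'h::complex_hilbert_space) ell2 =
  "{f :: 'i \<Rightarrow> 'h. (\<lambda>i. (norm (f i))\<^sup>2) summable_on UNIV}"
  by (rule exI[of _ "\<lambda>_. 0"]) simp

setup_lifting type_definition_ell2

lemma ell2_add_aux: "(norm (x + y))\<^sup>2 \<le> 2 * (norm x)\<^sup>2 + 2 * (norm y)\<^sup>2"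
  for x y :: "'h::real_normed_vector"
proof -
  have "(norm (x + y))\<^sup>2 \<le> (norm x + norm y)\<^sup>2"
    by (simp add: norm_triangle_ineq power_mono)
  also have "\<dots> \<le> 2 * (norm x)\<^sup>2 + 2 * (norm y)\<^sup>2"
    using zero_le_power2[of "norm x - norm y"] by (simp add: power2_eq_square algebra_simps)
  finally show ?thesis .
qed

lemma ell2_comparison:
  fixes f g :: "'i \<Rightarrow> real"
  assumes "g summable_on A" "\<And>i. i \<in> A \<Longrightarrow> 0 \<le> f i" "\<And>i. i \<in> A \<Longrightarrow> f i \<le> g i"
  shows "f summable_on A"
  using summable_on_comparison_test[OF assms(1), of f] assms(2,3) by auto

lemma ell2_add_summable:
  fixes f g :: "'i \<Rightarrow> 'h::real_normed_vector"
  assumes "(\<lambda>i. (norm (f i))\<^sup>2) summable_on A" "(\<lambda>i. (norm (g i))\<^sup>2) summable_on A"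
  shows "(\<lambda>i. (norm (f i + g i))\<^sup>2) summable_on A"
proof (rule ell2_comparison)
  show "(\<lambda>i. 2 * (norm (f i))\<^sup>2 + 2 * (norm (g i))\<^sup>2) summable_on A"
    by (intro summable_on_add summable_on_cmult_right assms)
qed (simp_all add: ell2_add_aux)

lemma ell2_cinner_summable:
  fixes f g :: "'i \<Rightarrow> 'h::complex_hilbert_space"
  assumes "(\<lambda>i. (norm (f i))\<^sup>2) summable_on A" "(\<lambda>i. (norm (g i))\<^sup>2) summable_on A"
  shows "(\<lambda>i. cinner (f i) (g i)) summable_on A"
proof -
  have "(\<lambda>i. norm (cinner (f i) (g i))) summable_on A"
  proof (rule ell2_comparison)
    show "(\<lambda>i. (norm (f i))\<^sup>2 + (norm (g i))\<^sup>2) summable_on A"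
      by (intro summable_on_add assms)
    fix i
    have "norm (cinner (f i) (g i)) \<le> norm (f i) * norm (g i)"
      by (rule cmod_cinner_le)
    also have "\<dots> \<le> (norm (f i))\<^sup>2 + (norm (g i))\<^sup>2"
      using zero_le_power2[of "norm (f i) - norm (g i)"] zero_le_power2[of "norm (f i)"] zero_le_power2[of "norm (g i)"]
      unfolding power2_diff by linarith
    finally show "norm (cinner (f i) (g i)) \<le> (norm (f i))\<^sup>2 + (norm (g i))\<^sup>2" .
  qed simp
  then show ?thesis
    by (rule abs_summable_summable)
qed

lemma ell2_inner_summable:
  fixes f g :: "'i \<Rightarrow> 'h::complex_hilbert_space"
  assumes "(\<lambda>i. (norm (f i))\<^sup>2) summable_on A" "(\<lambda>i. (norm (g i))\<^sup>2) summable_on A"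
  shows "(\<lambda>i. inner (f i) (g i)) summable_on A"
  unfolding inner_eq_Re_cinner by (rule summable_on_Re[OF ell2_cinner_summable[OF assms]])

lemma ell2_summable: "(\<lambda>i. (norm (Rep_ell2 f i))\<^sup>2) summable_on UNIV"
  using Rep_ell2[of f] by simp

instantiation ell2 :: (type, complex_hilbert_space) real_inner
begin

lift_definition zero_ell2 :: "('a, 'b) ell2" is "\<lambda>_. 0" by simp
lift_definition plus_ell2 :: "('a, 'b) ell2 \<Rightarrow> ('a, 'b) ell2 \<Rightarrow> ('a, 'b) ell2"
  is "\<lambda>f g i. f i + g i" by (rule ell2_add_summable)
lift_definition uminus_ell2 :: "('a, 'b) ell2 \<Rightarrow> ('a, 'b) ell2"
  is "\<lambda>f i. - f i" by simp
lift_definition minus_ell2 :: "('a, 'b) ell2 \<Rightarrow> ('a, 'b) ell2 \<Rightarrow> ('a, 'b) ell2"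
  is "\<lambda>f g i. f i - g i"
  subgoal for f g using ell2_add_summable[of f UNIV "\<lambda>i. - g i"] by simp
  done
lift_definition scaleR_ell2 :: "real \<Rightarrow> ('a, 'b) ell2 \<Rightarrow> ('a, 'b) ell2"
  is "\<lambda>c f i. c *\<^sub>R f i"
  by (simp add: power_mult_distrib summable_on_cmult_right)
lift_definition inner_ell2 :: "('a, 'b) ell2 \<Rightarrow> ('a, 'b) ell2 \<Rightarrow> real"
  is "\<lambda>f g. \<Sum>\<^sub>\<infinity>i. inner (f i) (g i)" .
definition norm_ell2 :: "('a, 'b) ell2 \<Rightarrow> real"
  where "norm_ell2 x = sqrt (inner x x)"
definition dist_ell2 :: "('a, 'b) ell2 \<Rightarrow> ('a, 'b) ell2 \<Rightarrow> real"
  where "dist_ell2 x y = norm (x - y)"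
definition sgn_ell2 :: "('a, 'b) ell2 \<Rightarrow> ('a, 'b) ell2"
  where "sgn_ell2 x = scaleR (inverse (norm x)) x"
definition uniformity_ell2 :: "(('a, 'b) ell2 \<times> ('a, 'b) ell2) filter"
  where "uniformity_ell2 = (INF e\<in>{0<..}. principal {(x, y). dist x y < e})"
definition open_ell2 :: "('a, 'b) ell2 set \<Rightarrow> bool"
  where "open_ell2 U \<longleftrightarrow> (\<forall>x\<in>U. \<forall>\<^sub>F (x', y) in uniformity. x' = x \<longrightarrow> y \<in> U)"

lemma ell2_inner_self: "inner x x = (\<Sum>\<^sub>\<infinity>i. (norm (Rep_ell2 x i))\<^sup>2)"
  for x :: "('a, 'b) ell2"
  by (simp only: inner_ell2.rep_eq power2_norm_eq_inner)

lemma ell2_norm_sq: "(norm x)\<^sup>2 = (\<Sum>\<^sub>\<infinity>i. (norm (Rep_ell2 x i))\<^sup>2)"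
  for x :: "('a, 'b) ell2"
  by (simp add: norm_ell2_def ell2_inner_self infsum_nonneg)

lemma ell2_norm_nonneg: "0 \<le> norm x" for x :: "('a, 'b) ell2"
  by (simp add: norm_ell2_def ell2_inner_self infsum_nonneg)

lemma ell2_finite_le: "finite F \<Longrightarrow> (\<Sum>i\<in>F. (norm (Rep_ell2 x i))\<^sup>2) \<le> (norm x)\<^sup>2"
  for x :: "('a, 'b) ell2"
  unfolding ell2_norm_sq by (rule finite_sum_le_infsum[OF ell2_summable]) simp_all

lemma ell2_component_le: "norm (Rep_ell2 x i) \<le> norm x" for x :: "('a, 'b) ell2"
proof (rule power2_le_imp_le)
  show "(norm (Rep_ell2 x i))\<^sup>2 \<le> (norm x)\<^sup>2"
    using ell2_finite_le[of "{i}" x] by simp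
qed (rule ell2_norm_nonneg)

instance
proof
  fix x y z :: "('a, 'b) ell2" and r s :: real
  show "x + y + z = x + (y + z)" "x + y = y + x" "0 + x = x" "- x + x = 0" "x - y = x + - y"
    by (transfer; simp add: algebra_simps)+
  show "r *\<^sub>R (x + y) = r *\<^sub>R x + r *\<^sub>R y" "(r + s) *\<^sub>R x = r *\<^sub>R x + s *\<^sub>R x"
    "r *\<^sub>R s *\<^sub>R x = (r * s) *\<^sub>R x" "1 *\<^sub>R x = x"
    by (transfer; simp add: algebra_simps)+
  show "dist x y = norm (x - y)" "sgn x = scaleR (inverse (norm x)) x"
    by (simp_all add: dist_ell2_def sgn_ell2_def)
  show "uniformity = (INF e\<in>{0<..}. principal {(x::('a, 'b) ell2, y). dist x y < e})"
    by (fact uniformity_ell2_def)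
  show "open U \<longleftrightarrow> (\<forall>x\<in>U. \<forall>\<^sub>F (x', y) in uniformity. x' = x \<longrightarrow> y \<in> U)"
    for U :: "('a, 'b) ell2 set"
    by (fact open_ell2_def)
  show "inner x y = inner y x"
    by transfer (simp add: inner_commute)
  show "inner (x + y) z = inner x z + inner y z"
    by transfer (simp add: inner_add_left infsum_add ell2_inner_summable)
  show "inner (r *\<^sub>R x) y = r * inner x y"
    by transfer (simp add: infsum_cmult_right')
  show "0 \<le> inner x x"
    by (simp add: ell2_inner_self infsum_nonneg)
  show "norm x = sqrt (inner x x)" by (fact norm_ell2_def)
  show "inner x x = 0 \<longleftrightarrow> x = 0"
  proof
    assume "inner x x = 0"
    then have "norm (Rep_ell2 x i) \<le> 0" for i
      using ell2_component_le[of x i] by (simp add: norm_ell2_def)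
    then have "Rep_ell2 x = Rep_ell2 0"
      by (simp add: fun_eq_iff zero_ell2.rep_eq)
    then show "x = 0"
      by (simp only: Rep_ell2_inject)
  next
    assume "x = 0"
    then show "inner x x = 0"
      by transfer simp
  qed
qed

end

lemma ell2_finite_leI:
  fixes f :: "'i \<Rightarrow> 'h::complex_hilbert_space"
  assumes "\<And>F. finite F \<Longrightarrow> (\<Sum>i\<in>F. (norm (f i))\<^sup>2) \<le> b\<^sup>2" "0 \<le> b"
  obtains x where "Rep_ell2 x = f" "norm x \<le> b"
proof -
  have s: "(\<lambda>i. (norm (f i))\<^sup>2) summable_on UNIV"
    by (rule nonneg_bdd_above_summable_on) (auto intro!: bdd_aboveI[of _ "b\<^sup>2"] assms)
  then have R: "Rep_ell2 (Abs_ell2 f) = f"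
    by (simp add: Abs_ell2_inverse)
  moreover have "(norm (Abs_ell2 f))\<^sup>2 \<le> b\<^sup>2"
    unfolding ell2_norm_sq R by (rule infsum_le_finite_sums[OF s]) (use assms in auto)
  ultimately show ?thesis
    using that assms(2) power2_le_imp_le by blast
qed

instantiation ell2 :: (type, complex_hilbert_space) complex_hilbert_space
begin

lift_definition scaleC_ell2 :: "complex \<Rightarrow> ('a, 'b) ell2 \<Rightarrow> ('a, 'b) ell2"
  is "\<lambda>c f i. c *\<^sub>C f i"
  by (simp add: norm_scaleC power_mult_distrib summable_on_cmult_right)
lift_definition cinner_ell2 :: "('a, 'b) ell2 \<Rightarrow> ('a, 'b) ell2 \<Rightarrow> complex"
  is "\<lambda>f g. \<Sum>\<^sub>\<infinity>i. cinner (f i) (g i)" .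

instance
proof
  fix x y z :: "('a, 'b) ell2" and r :: real and c d :: complex
  show "c *\<^sub>C (x + y) = c *\<^sub>C x + c *\<^sub>C y" "(c + d) *\<^sub>C x = c *\<^sub>C x + d *\<^sub>C x"
    "c *\<^sub>C d *\<^sub>C x = (c * d) *\<^sub>C x"
    by (transfer; simp add: scaleC_add_right scaleC_add_left scaleC_scaleC)+
  show "complex_of_real r *\<^sub>C x = r *\<^sub>R x"
    by transfer (simp add: scaleC_of_real)
  have "cinner x y = (\<Sum>\<^sub>\<infinity>i. cnj (cinner (Rep_ell2 y i) (Rep_ell2 x i)))"
    unfolding cinner_ell2.rep_eq by (rule infsum_cong) (rule cinner_commute)
  then show "cinner x y = cnj (cinner y x)"
    by (simp add: cinner_ell2.rep_eq)
  show "cinner (x + y) z = cinner x z + cinner y z"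
    by transfer (simp add: cinner_add_left infsum_add ell2_cinner_summable)
  show "cinner (c *\<^sub>C x) y = c * cinner x y"
    by transfer (simp add: cinner_scaleC_left infsum_cmult_right')
  show "inner x y = Re (cinner x y)"
    by transfer (simp add: inner_eq_Re_cinner infsum_Re ell2_cinner_summable)
next
  fix X :: "nat \<Rightarrow> ('a, 'b) ell2"
  assume X: "Cauchy X"
  have "convergent (\<lambda>n. Rep_ell2 (X n) i)" for i
  proof -
    have "norm (Rep_ell2 (X m) i - Rep_ell2 (X n) i) \<le> norm (X m - X n)" for m n
      using ell2_component_le[of "X m - X n" i] by (simp add: minus_ell2.rep_eq)
    with X have "Cauchy (\<lambda>n. Rep_ell2 (X n) i)"
      unfolding Cauchy_iff by (metis le_less_trans)
    then show ?thesis
      by (rule Cauchy_convergent)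
  qed
  then obtain l where l: "(\<lambda>n. Rep_ell2 (X n) i) \<longlonglongrightarrow> l i" for i
    unfolding convergent_def by metis
  have near: "\<exists>z. Rep_ell2 z = (\<lambda>i. Rep_ell2 (X m) i - l i) \<and> norm z \<le> e"
    if M: "\<forall>n\<ge>M. norm (X m - X n) \<le> e" and e: "0 < e" for e m M
  proof -
    have "(\<Sum>i\<in>F. (norm (Rep_ell2 (X m) i - l i))\<^sup>2) \<le> e\<^sup>2" if F: "finite F" for F
    proof (rule LIMSEQ_le_const2)
      show "(\<lambda>n. \<Sum>i\<in>F. (norm (Rep_ell2 (X m) i - Rep_ell2 (X n) i))\<^sup>2)
          \<longlonglongrightarrow> (\<Sum>i\<in>F. (norm (Rep_ell2 (X m) i - l i))\<^sup>2)"
        by (intro tendsto_intros l)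
      have "(\<Sum>i\<in>F. (norm (Rep_ell2 (X m) i - Rep_ell2 (X n) i))\<^sup>2) \<le> e\<^sup>2" if "n \<ge> M" for n
      proof -
        have "(\<Sum>i\<in>F. (norm (Rep_ell2 (X m - X n) i))\<^sup>2) \<le> (norm (X m - X n))\<^sup>2"
          by (rule ell2_finite_le[OF F])
        also have "\<dots> \<le> e\<^sup>2"
          using M that by (intro power_mono) auto
        finally show ?thesis by (simp add: minus_ell2.rep_eq)
      qed
      then show "\<exists>N. \<forall>n\<ge>N. (\<Sum>i\<in>F. (norm (Rep_ell2 (X m) i - Rep_ell2 (X n) i))\<^sup>2) \<le> e\<^sup>2"
        by blast
    qed
    from ell2_finite_leI[OF this less_imp_le[OF e]] show ?thesis
      by blast
  qed
  obtain M1 where "\<forall>n\<ge>M1. norm (X M1 - X n) \<le> 1"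
    using CauchyD[OF X, of 1] by (auto intro: less_imp_le)
  from near[OF this] obtain z where "Rep_ell2 z = (\<lambda>i. Rep_ell2 (X M1) i - l i)"
    by auto
  then have L: "Rep_ell2 (X M1 - z) = l"
    by (simp add: minus_ell2.rep_eq)
  have "X \<longlonglongrightarrow> X M1 - z"
  proof (rule LIMSEQ_I)
    fix e :: real assume "0 < e"
    then obtain M where M: "norm (X m - X n) \<le> e / 2" if "m \<ge> M" "n \<ge> M" for m n
      using CauchyD[OF X, of "e / 2"] by (auto intro: less_imp_le)
    have "norm (X m - (X M1 - z)) < e" if m: "m \<ge> M" for m
    proof -
      obtain w where w: "Rep_ell2 w = (\<lambda>i. Rep_ell2 (X m) i - l i)" "norm w \<le> e / 2"
        using near[of M m "e / 2"] M m \<open>0 < e\<close> by auto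
      have "w = X m - (X M1 - z)"
        by (simp add: Rep_ell2_inject[symmetric] minus_ell2.rep_eq[of "X m"] L w)
      with w \<open>0 < e\<close> show ?thesis by simp
    qed
    then show "\<exists>M. \<forall>m\<ge>M. norm (X m - (X M1 - z)) < e" by blast
  qed
  then show "convergent X"
    by (rule convergentI)
qed

end

definition ket :: "'i \<Rightarrow> ('i, complex) ell2"
  where "ket i = Abs_ell2 (\<lambda>j. if j = i then 1 else 0)"

lemma Rep_ket: "Rep_ell2 (ket i) j = (if j = i then 1 else 0)"
proof -
  have "(\<lambda>j. (norm (if j = i then 1 else 0 :: complex))\<^sup>2) summable_on UNIV"
    by (rule finite_nonzero_values_imp_summable_on) (rule finite_subset[of _ "{i}"], auto)
  then show ?thesis
    by (simp add: ket_def Abs_ell2_inverse)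
qed

lemma cinner_ket: "cinner x (ket i) = Rep_ell2 x i"
proof -
  have "cinner x (ket i) = (\<Sum>\<^sub>\<infinity>j\<in>{i}. Rep_ell2 x j)"
    unfolding cinner_ell2.rep_eq
    by (rule infsum_cong_neutral) (auto simp: Rep_ket cinner_complex_def)
  then show ?thesis by simp
qed

section \<open>Operators\<close>

definition bounded_op_on ::
    "'a::complex_hilbert_space set \<Rightarrow> ('a \<Rightarrow> 'b::complex_hilbert_space) \<Rightarrow> bool"
  where "bounded_op_on M A \<longleftrightarrow>
    (\<forall>x\<in>M. \<forall>y\<in>M. A (x + y) = A x + A y) \<and>
    (\<forall>c. \<forall>x\<in>M. A (c *\<^sub>C x) = c *\<^sub>C A x) \<and>
    (\<exists>B. \<forall>x\<in>M. norm (A x) \<le> B * norm x)"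

abbreviation bounded_op :: "('a::complex_hilbert_space \<Rightarrow> 'b::complex_hilbert_space) \<Rightarrow> bool"
  where "bounded_op \<equiv> bounded_op_on UNIV"

lemma bounded_op_iff_bounded_linear:
  "bounded_op A \<longleftrightarrow> bounded_linear A \<and> (\<forall>c x. A (c *\<^sub>C x) = c *\<^sub>C A x)"
proof
  assume A: "bounded_op A"
  then obtain B where "\<forall>x. norm (A x) \<le> B * norm x"
    unfolding bounded_op_on_def by auto
  with A show "bounded_linear A \<and> (\<forall>c x. A (c *\<^sub>C x) = c *\<^sub>C A x)"
    by (auto simp: bounded_op_on_def mult.commute simp flip: scaleC_of_real
        intro!: bounded_linear_intro[of A B])
next
  assume A: "bounded_linear A \<and> (\<forall>c x. A (c *\<^sub>C x) = c *\<^sub>C A x)"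
  then interpret bounded_linear A by blast
  show "bounded_op A"
    using A bounded unfolding bounded_op_on_def by (auto simp: add mult.commute)
qed

definition cproj :: "'a::complex_hilbert_space set \<Rightarrow> 'a \<Rightarrow> 'a"
  where "cproj M x = (THE y. y \<in> M \<and> (\<forall>z\<in>M. cinner (x - y) z = 0))"

text \<open>The adjoint of an operator whose domain is the Hilbert space given by a closed subspace
  \<open>M\<close>; the result takes values in \<open>M\<close>.\<close>

definition cadjoint_on ::
    "'a::complex_hilbert_space set \<Rightarrow> ('a \<Rightarrow> 'b::complex_hilbert_space) \<Rightarrow> 'b \<Rightarrow> 'a"
  where "cadjoint_on M A y = (THE x. x \<in> M \<and> (\<forall>z\<in>M. cinner x z = cinner y (A z)))"

abbreviation cadjoint :: "('a::complex_hilbert_space \<Rightarrow> 'b::complex_hilbert_space) \<Rightarrow> 'b \<Rightarrow> 'a"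
  where "cadjoint \<equiv> cadjoint_on UNIV"

definition positive_op :: "('a::complex_hilbert_space \<Rightarrow> 'a) \<Rightarrow> bool"
  where "positive_op A \<longleftrightarrow>
    bounded_op A \<and> (\<forall>x. cinner (A x) x \<in> \<real> \<and> 0 \<le> Re (cinner (A x) x))"

definition unitary_onto ::
    "'b::complex_hilbert_space set \<Rightarrow> ('a::complex_hilbert_space \<Rightarrow> 'b) \<Rightarrow> bool"
  where "unitary_onto G U \<longleftrightarrow>
    bounded_op U \<and> (\<forall>x y. cinner (U x) (U y) = cinner x y) \<and> range U = G"

definition wot_has_sum ::
    "('i \<Rightarrow> 'a::complex_hilbert_space \<Rightarrow> 'a) \<Rightarrow> 'i set \<Rightarrow> ('a \<Rightarrow> 'a) \<Rightarrow> bool"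
  where "wot_has_sum A I Z \<longleftrightarrow>
    bounded_op Z \<and> (\<forall>x y. ((\<lambda>i. cinner (A i x) y) has_sum cinner (Z x) y) I)"

section \<open>Hilbert space tensor products\<close>

text \<open>\<open>\<ell>\<^sup>2(I) \<otimes> \<H>\<close> is realised as \<open>\<ell>\<^sup>2(I; \<H>)\<close>, with \<open>x \<otimes> d = (x\<^sub>i d)\<^sub>i\<close>.\<close>

lift_definition tens ::
    "('i, complex) ell2 \<Rightarrow> 'h::complex_hilbert_space \<Rightarrow> ('i, 'h) ell2" (infixr \<open>\<otimes>\<^sub>h\<close> 70)
  is "\<lambda>x d i. x i *\<^sub>C d"
  by (simp add: norm_scaleC power_mult_distrib summable_on_cmult_left)

lemma cinner_tens: "cinner (x \<otimes>\<^sub>h d) (y \<otimes>\<^sub>h e) = cinner x y * cinner d e"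
proof -
  have "cinner (x \<otimes>\<^sub>h d) (y \<otimes>\<^sub>h e) = (\<Sum>\<^sub>\<infinity>i. cinner (Rep_ell2 x i) (Rep_ell2 y i) * cinner d e)"
    by (simp add: cinner_ell2.rep_eq tens.rep_eq cinner_scaleC_left cinner_scaleC_right
        cinner_complex_def ac_simps)
  also have "\<dots> = cinner x y * cinner d e"
    by (simp add: cinner_ell2.rep_eq infsum_cmult_left')
  finally show ?thesis .
qed

definition tensor_space ::
    "('i, complex) ell2 set \<Rightarrow> 'h::complex_hilbert_space set \<Rightarrow> ('i, 'h) ell2 set"
  where "tensor_space N D = closure (cspan {x \<otimes>\<^sub>h d | x d. x \<in> N \<and> d \<in> D})"

text \<open>\<open>A \<otimes> I\<^sub>D\<close> for a bounded operator \<open>A\<close> on \<open>N\<close>: the bounded operator on \<open>N \<otimes> D\<close> determined by its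
  values on elementary tensors, set to \<open>0\<close> outside \<open>N \<otimes> D\<close> to make the description unique.\<close>

definition tensor_id ::
    "('i, complex) ell2 set \<Rightarrow> 'h::complex_hilbert_space set \<Rightarrow>
      (('i, complex) ell2 \<Rightarrow> ('i, complex) ell2) \<Rightarrow> ('i, 'h) ell2 \<Rightarrow> ('i, 'h) ell2"
  where "tensor_id N D A = (THE R.
    bounded_op_on (tensor_space N D) R \<and>
    (\<forall>x\<in>N. \<forall>d\<in>D. R (x \<otimes>\<^sub>h d) = A x \<otimes>\<^sub>h d) \<and>
    (\<forall>\<xi>. \<xi> \<notin> tensor_space N D \<longrightarrow> R \<xi> = 0))"

section \<open>Noncommutative words, series and polynomials\<close>

text \<open>The free monoid on \<open>g\<^sub>1, \<dots>, g\<^sub>n\<close> is \<^term>\<open>lists {1..n}\<close>, and a formal power series \<open>f\<^sub>i\<close> is its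
  coefficient function \<open>a i\<close>. The families \<open>n\<close>, \<open>m\<close>, \<open>a\<close>, \<open>X\<close> below are indexed by \<open>i \<in> {1..k}\<close> and
  generators by \<open>j \<in> {1..n i}\<close>; values elsewhere are irrelevant.\<close>

definition positive_regular :: "nat \<Rightarrow> (nat list \<Rightarrow> real) \<Rightarrow> bool"
  where "positive_regular n a \<longleftrightarrow>
    (\<forall>\<alpha>\<in>lists {1..n}. 0 \<le> a \<alpha>) \<and> a [] = 0 \<and> (\<forall>j\<in>{1..n}. 0 < a [j]) \<and>
    limsup (\<lambda>p. ereal ((\<Sum>\<alpha>\<in>{\<alpha> \<in> lists {1..n}. length \<alpha> = p}. \<bar>a \<alpha>\<bar>\<^sup>2) powr (1 / (2 * real p)))) < \<infinity>"

definition multi_words :: "nat \<Rightarrow> (nat \<Rightarrow> nat) \<Rightarrow> (nat \<Rightarrow> nat list) set"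
  where "multi_words k n = (\<Pi>\<^sub>E i\<in>{1..k}. lists {1..n i})"

definition word_op :: "(nat \<Rightarrow> 'a \<Rightarrow> 'a) \<Rightarrow> nat list \<Rightarrow> 'a \<Rightarrow> 'a"
  where "word_op X \<alpha> = foldr (\<lambda>j. (\<circ>) (X j)) \<alpha> id"

definition multi_word_op :: "nat \<Rightarrow> (nat \<Rightarrow> nat \<Rightarrow> 'a \<Rightarrow> 'a) \<Rightarrow> (nat \<Rightarrow> nat list) \<Rightarrow> 'a \<Rightarrow> 'a"
  where "multi_word_op k X \<alpha> = foldr (\<lambda>i. (\<circ>) (word_op (X i) (\<alpha> i))) [1..<Suc k] id"

text \<open>Since \<open>Z\<^sub>s\<^sub>,\<^sub>j\<close> and \<open>Z\<^sub>t\<^sub>,\<^sub>l\<close> commute for \<open>s \<noteq> t\<close>, the monomials of the polynomial algebra are the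
  \<open>Z\<^sub>(\<^sub>\<alpha>\<^sub>)\<close> for \<open>(\<alpha>)\<close> a tuple of words, and a polynomial is a finitely supported
  family of coefficients.\<close>

type_synonym nc_poly = "(nat \<Rightarrow> nat list) \<Rightarrow>\<^sub>0 complex"

definition nc_polys :: "nat \<Rightarrow> (nat \<Rightarrow> nat) \<Rightarrow> nc_poly set"
  where "nc_polys k n = {q. Poly_Mapping.keys q \<subseteq> multi_words k n}"

definition poly_op ::
    "nat \<Rightarrow> (nat \<Rightarrow> nat \<Rightarrow> 'a \<Rightarrow> 'a) \<Rightarrow> nc_poly \<Rightarrow> 'a \<Rightarrow> 'a::complex_hilbert_space"
  where "poly_op k X q x =
    (\<Sum>\<alpha>\<in>Poly_Mapping.keys q. Poly_Mapping.lookup q \<alpha> *\<^sub>C multi_word_op k X \<alpha> x)"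

section \<open>Polydomains and varieties\<close>

definition cross_commuting ::
    "nat \<Rightarrow> (nat \<Rightarrow> nat) \<Rightarrow> (nat \<Rightarrow> nat \<Rightarrow> 'h \<Rightarrow> 'h::complex_hilbert_space) set"
  where "cross_commuting k n = {X.
    (\<forall>i\<in>{1..k}. \<forall>j\<in>{1..n i}. bounded_op (X i j)) \<and>
    (\<forall>s\<in>{1..k}. \<forall>t\<in>{1..k}. s \<noteq> t \<longrightarrow>
      (\<forall>j\<in>{1..n s}. \<forall>l\<in>{1..n t}. X s j \<circ> X t l = X t l \<circ> X s j))}"

definition phi_term ::
    "(nat list \<Rightarrow> real) \<Rightarrow> (nat \<Rightarrow> 'h \<Rightarrow> 'h) \<Rightarrow> ('h \<Rightarrow> 'h) \<Rightarrow> nat list \<Rightarrow> 'h \<Rightarrow> 'h::complex_hilbert_space"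
  where "phi_term a X Y \<alpha> = (\<lambda>x. a \<alpha> *\<^sub>R word_op X \<alpha> (Y (cadjoint (word_op X \<alpha>) x)))"

definition phi_well_defined ::
    "nat \<Rightarrow> (nat list \<Rightarrow> real) \<Rightarrow> (nat \<Rightarrow> 'h \<Rightarrow> 'h::complex_hilbert_space) \<Rightarrow> bool"
  where "phi_well_defined n a X \<longleftrightarrow> (\<exists>Z. wot_has_sum (phi_term a X id) (lists {1..n}) Z)"

definition phi ::
    "nat \<Rightarrow> (nat list \<Rightarrow> real) \<Rightarrow> (nat \<Rightarrow> 'h \<Rightarrow> 'h) \<Rightarrow> ('h \<Rightarrow> 'h) \<Rightarrow> 'h \<Rightarrow> 'h::complex_hilbert_space"
  where "phi n a X Y = (THE Z. wot_has_sum (phi_term a X Y) (lists {1..n}) Z)"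

definition defect ::
    "nat \<Rightarrow> (nat \<Rightarrow> nat) \<Rightarrow> (nat \<Rightarrow> nat list \<Rightarrow> real) \<Rightarrow> (nat \<Rightarrow> nat \<Rightarrow> 'h \<Rightarrow> 'h) \<Rightarrow> (nat \<Rightarrow> nat) \<Rightarrow>
      ('h \<Rightarrow> 'h) \<Rightarrow> 'h \<Rightarrow> 'h::complex_hilbert_space"
  where "defect k n a X p =
    foldr (\<lambda>i. (\<circ>) ((\<lambda>Y x. Y x - phi (n i) (a i) (X i) Y x) ^^ p i)) [1..<Suc k] id"

definition polydomain ::
    "nat \<Rightarrow> (nat \<Rightarrow> nat) \<Rightarrow> (nat \<Rightarrow> nat list \<Rightarrow> real) \<Rightarrow> (nat \<Rightarrow> nat) \<Rightarrow>
      (nat \<Rightarrow> nat \<Rightarrow> 'h \<Rightarrow> 'h::complex_hilbert_space) set"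
  where "polydomain k n a m = {X \<in> cross_commuting k n.
    (\<forall>i\<in>{1..k}. phi_well_defined (n i) (a i) (X i)) \<and>
    (\<forall>p. (\<forall>i\<in>{1..k}. p i \<le> m i) \<longrightarrow> positive_op (defect k n a X p id))}"

definition variety ::
    "nat \<Rightarrow> (nat \<Rightarrow> nat) \<Rightarrow> (nat \<Rightarrow> nat list \<Rightarrow> real) \<Rightarrow> (nat \<Rightarrow> nat) \<Rightarrow> nc_poly set \<Rightarrow>
      (nat \<Rightarrow> nat \<Rightarrow> 'h \<Rightarrow> 'h::complex_hilbert_space) set"
  where "variety k n a m Q = {X \<in> polydomain k n a m. \<forall>q\<in>Q. \<forall>x. poly_op k X q x = 0}"

definition pure_tuple ::
    "nat \<Rightarrow> (nat \<Rightarrow> nat) \<Rightarrow> (nat \<Rightarrow> nat list \<Rightarrow> real) \<Rightarrow>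
      (nat \<Rightarrow> nat \<Rightarrow> 'h \<Rightarrow> 'h::complex_hilbert_space) \<Rightarrow> bool"
  where "pure_tuple k n a X \<longleftrightarrow> (\<forall>i\<in>{1..k}. \<forall>x y.
    (\<lambda>s. cinner ((phi (n i) (a i) (X i) ^^ s) id x) y) \<longlonglongrightarrow> 0)"

definition defect_space ::
    "nat \<Rightarrow> (nat \<Rightarrow> nat) \<Rightarrow> (nat \<Rightarrow> nat list \<Rightarrow> real) \<Rightarrow> (nat \<Rightarrow> nat) \<Rightarrow>
      (nat \<Rightarrow> nat \<Rightarrow> 'h \<Rightarrow> 'h::complex_hilbert_space) \<Rightarrow> 'h set"
  where "defect_space k n a m X = closure (range (defect k n a X m id))"

section \<open>The universal model\<close>

text \<open>The compositions of \<open>\<alpha>\<close> into \<open>p\<close> nonempty words are the lists \<open>\<gamma>s\<close> below.\<close>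

definition fock_weight :: "(nat list \<Rightarrow> real) \<Rightarrow> nat \<Rightarrow> nat list \<Rightarrow> real"
  where "fock_weight a m \<alpha> = (if \<alpha> = [] then 1 else
    (\<Sum>p = 1..length \<alpha>. \<Sum>\<gamma>s\<in>{\<gamma>s. length \<gamma>s = p \<and> concat \<gamma>s = \<alpha> \<and> [] \<notin> set \<gamma>s}.
      prod_list (map a \<gamma>s) * real ((p + m - 1) choose (m - 1))))"

text \<open>The full Fock space over \<open>\<complex>\<^sup>n\<close>, the direct sum over \<open>p\<close> of the \<open>p\<close>-fold tensor powers of \<open>\<complex>\<^sup>n\<close>,
  is the space of square-summable families over the words in \<open>n\<close> letters, with \<open>e\<^sub>\<alpha> = ket \<alpha>\<close>. The
  tensor product of the \<open>k\<close> Fock spaces is likewise indexed by tuples of words, with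
  \<open>e\<^sub>\<alpha>\<^sub>1 \<otimes> \<dots> \<otimes> e\<^sub>\<alpha>\<^sub>k = ket \<alpha>\<close>. Both sit in an \<open>ell2\<close> type as the families supported on proper
  (tuples of) words.\<close>

definition fock :: "nat \<Rightarrow> (nat list, complex) ell2 set"
  where "fock n = {\<xi>. \<forall>\<alpha>. \<alpha> \<notin> lists {1..n} \<longrightarrow> Rep_ell2 \<xi> \<alpha> = 0}"

definition fock_tensor :: "nat \<Rightarrow> (nat \<Rightarrow> nat) \<Rightarrow> (nat \<Rightarrow> nat list, complex) ell2 set"
  where "fock_tensor k n = {\<xi>. \<forall>\<alpha>. \<alpha> \<notin> multi_words k n \<longrightarrow> Rep_ell2 \<xi> \<alpha> = 0}"

text \<open>The linear extension of \<open>e\<^sub>\<gamma> \<mapsto> \<surd>(b\<^sub>\<gamma> / b\<^sub>j\<^sub>\<gamma>) e\<^sub>j\<^sub>\<gamma>\<close>, written in coordinates. For \<open>a\<close> positive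
  regular and \<open>m \<ge> 1\<close> it is bounded on \<open>fock n\<close>, because \<open>b\<^sub>j\<^sub>\<gamma> \<ge> a\<^sub>j b\<^sub>\<gamma>\<close>.\<close>

definition weighted_creation ::
    "(nat list \<Rightarrow> real) \<Rightarrow> nat \<Rightarrow> nat \<Rightarrow> (nat list, complex) ell2 \<Rightarrow> (nat list, complex) ell2"
  where "weighted_creation a m j \<xi> = Abs_ell2 (\<lambda>\<beta>. case \<beta> of [] \<Rightarrow> 0 | l # \<gamma> \<Rightarrow>
    if l = j then complex_of_real (sqrt (fock_weight a m \<gamma> / fock_weight a m (j # \<gamma>))) * Rep_ell2 \<xi> \<gamma>
    else 0)"

lemma weighted_creation_ket:
  "weighted_creation a m j (ket \<alpha>) =
    complex_of_real (sqrt (fock_weight a m \<alpha> / fock_weight a m (j # \<alpha>))) *\<^sub>C ket (j # \<alpha>)"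
  (is "_ = ?c *\<^sub>C _")
proof -
  have "(\<lambda>\<beta>. case \<beta> of [] \<Rightarrow> 0 | l # \<gamma> \<Rightarrow>
      if l = j then complex_of_real (sqrt (fock_weight a m \<gamma> / fock_weight a m (j # \<gamma>))) *
        Rep_ell2 (ket \<alpha>) \<gamma> else 0) = Rep_ell2 (?c *\<^sub>C ket (j # \<alpha>))"
    by (rule ext) (auto simp: scaleC_ell2.rep_eq Rep_ket scaleC_complex_def split: list.split)
  then show ?thesis
    by (simp add: weighted_creation_def Rep_ell2_inverse)
qed

text \<open>\<open>on_factor i A\<close> is \<open>I \<otimes> \<dots> \<otimes> A \<otimes> \<dots> \<otimes> I\<close> with \<open>A\<close> in position \<open>i\<close>: it applies \<open>A\<close> to every
  slice of \<open>\<xi>\<close> in the \<open>i\<close>-th coordinate, the other coordinates being held fixed.\<close>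

lift_definition slice ::
    "nat \<Rightarrow> (nat \<Rightarrow> 'w) \<Rightarrow> (nat \<Rightarrow> 'w, complex) ell2 \<Rightarrow> ('w, complex) ell2"
  is "\<lambda>i \<beta> \<xi> \<gamma>. \<xi> (\<beta>(i := \<gamma>))"
proof -
  fix i :: nat and \<beta> :: "nat \<Rightarrow> 'w" and \<xi> :: "(nat \<Rightarrow> 'w) \<Rightarrow> complex"
  assume "(\<lambda>\<alpha>. (norm (\<xi> \<alpha>))\<^sup>2) summable_on UNIV"
  then have "(\<lambda>\<alpha>. (norm (\<xi> \<alpha>))\<^sup>2) summable_on range (\<lambda>\<gamma>. \<beta>(i := \<gamma>))"
    by (rule summable_on_subset_banach) simp
  moreover have "inj (\<lambda>\<gamma>. \<beta>(i := \<gamma>))"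
    by (rule injI) (metis fun_upd_same)
  ultimately show "(\<lambda>\<gamma>. (norm (\<xi> (\<beta>(i := \<gamma>))))\<^sup>2) summable_on UNIV"
    by (simp add: summable_on_reindex o_def)
qed

definition on_factor ::
    "nat \<Rightarrow> (('w, complex) ell2 \<Rightarrow> ('w, complex) ell2) \<Rightarrow>
      (nat \<Rightarrow> 'w, complex) ell2 \<Rightarrow> (nat \<Rightarrow> 'w, complex) ell2"
  where "on_factor i A \<xi> = Abs_ell2 (\<lambda>\<beta>. Rep_ell2 (A (slice i \<beta> \<xi>)) (\<beta> i))"

definition model_W ::
    "(nat \<Rightarrow> nat list \<Rightarrow> real) \<Rightarrow> (nat \<Rightarrow> nat) \<Rightarrow> nat \<Rightarrow> nat \<Rightarrow>
      (nat \<Rightarrow> nat list, complex) ell2 \<Rightarrow> (nat \<Rightarrow> nat list, complex) ell2"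
  where "model_W a m i j = on_factor i (weighted_creation (a i) (m i) j)"

lemma model_W_ket:
  "model_W a m i j (ket \<alpha>) =
    complex_of_real (sqrt (fock_weight (a i) (m i) (\<alpha> i) / fock_weight (a i) (m i) (j # \<alpha> i))) *\<^sub>C
      ket (\<alpha>(i := j # \<alpha> i))"
  (is "_ = ?c *\<^sub>C _")
proof -
  have wz: "weighted_creation (a i) (m i) j 0 = 0"
  proof -
    have "(\<lambda>\<beta>. case \<beta> of [] \<Rightarrow> 0 | l # \<gamma> \<Rightarrow> if l = j then
        complex_of_real (sqrt (fock_weight (a i) (m i) \<gamma> / fock_weight (a i) (m i) (j # \<gamma>))) *
        Rep_ell2 0 \<gamma> else 0) = Rep_ell2 0"
      by (rule ext) (auto simp: zero_ell2.rep_eq split: list.split)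
    then show ?thesis
      by (simp add: weighted_creation_def Rep_ell2_inverse)
  qed
  have "Rep_ell2 (weighted_creation (a i) (m i) j (slice i \<beta> (ket \<alpha>))) (\<beta> i) =
      Rep_ell2 (?c *\<^sub>C ket (\<alpha>(i := j # \<alpha> i))) \<beta>" for \<beta>
  proof (cases "\<beta>(i := \<alpha> i) = \<alpha>")
    case True
    then have up: "\<beta>(i := \<gamma>) = \<alpha>(i := \<gamma>)" for \<gamma>
      by (metis fun_upd_upd)
    have "Rep_ell2 (slice i \<beta> (ket \<alpha>)) = Rep_ell2 (ket (\<alpha> i))"
      by (rule ext) (auto simp: slice.rep_eq Rep_ket up fun_eq_iff)
    then have sl: "slice i \<beta> (ket \<alpha>) = ket (\<alpha> i)"
      by (simp only: Rep_ell2_inject)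
    have "\<beta> = \<alpha>(i := j # \<alpha> i) \<longleftrightarrow> \<beta> i = j # \<alpha> i"
      using up[of "j # \<alpha> i"] by (metis fun_upd_same fun_upd_triv)
    then show ?thesis
      by (simp add: sl weighted_creation_ket scaleC_ell2.rep_eq Rep_ket)
  next
    case False
    then have "\<beta>(i := \<gamma>) \<noteq> \<alpha>" for \<gamma>
      by (metis fun_upd_same fun_upd_upd)
    then have "Rep_ell2 (slice i \<beta> (ket \<alpha>)) = Rep_ell2 0"
      by (auto simp: fun_eq_iff slice.rep_eq Rep_ket zero_ell2.rep_eq)
    then have sl: "slice i \<beta> (ket \<alpha>) = 0"
      by (simp only: Rep_ell2_inject)
    have "\<beta> \<noteq> \<alpha>(i := j # \<alpha> i)"
      using False by auto
    then show ?thesis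
      by (simp add: sl wz scaleC_ell2.rep_eq Rep_ket zero_ell2.rep_eq scaleC_complex_def)
  qed
  then show ?thesis
    by (simp add: model_W_def on_factor_def Rep_ell2_inverse)
qed

definition vacuum :: "nat \<Rightarrow> (nat \<Rightarrow> nat list, complex) ell2"
  where "vacuum k = ket (\<lambda>i\<in>{1..k}. [])"

definition space_M ::
    "nat \<Rightarrow> (nat \<Rightarrow> nat) \<Rightarrow> (nat \<Rightarrow> nat list \<Rightarrow> real) \<Rightarrow> (nat \<Rightarrow> nat) \<Rightarrow> nc_poly set \<Rightarrow>
      (nat \<Rightarrow> nat list, complex) ell2 set"
  where "space_M k n a m Q = closure (cspan
    {multi_word_op k (model_W a m) \<alpha> (poly_op k (model_W a m) q
        (multi_word_op k (model_W a m) \<beta> (c *\<^sub>C vacuum k))) | \<alpha> q \<beta> c.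
      \<alpha> \<in> multi_words k n \<and> \<beta> \<in> multi_words k n \<and> q \<in> Q})"

definition space_N ::
    "nat \<Rightarrow> (nat \<Rightarrow> nat) \<Rightarrow> (nat \<Rightarrow> nat list \<Rightarrow> real) \<Rightarrow> (nat \<Rightarrow> nat) \<Rightarrow> nc_poly set \<Rightarrow>
      (nat \<Rightarrow> nat list, complex) ell2 set"
  where "space_N k n a m Q = {\<xi> \<in> fock_tensor k n. \<forall>\<eta>\<in>space_M k n a m Q. cinner \<xi> \<eta> = 0}"

definition model_S ::
    "nat \<Rightarrow> (nat \<Rightarrow> nat) \<Rightarrow> (nat \<Rightarrow> nat list \<Rightarrow> real) \<Rightarrow> (nat \<Rightarrow> nat) \<Rightarrow> nc_poly set \<Rightarrow> nat \<Rightarrow> nat \<Rightarrow>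
      (nat \<Rightarrow> nat list, complex) ell2 \<Rightarrow> (nat \<Rightarrow> nat list, complex) ell2"
  where "model_S k n a m Q i j \<xi> = cproj (space_N k n a m Q) (model_W a m i j \<xi>)"

text \<open>\<open>S\<^sub>i\<^sub>,\<^sub>j\<^sup>* \<otimes> I\<^sub>D\<close> on \<open>N\<^sub>Q \<otimes> D\<close>, the adjoint being that of an operator on \<open>N\<^sub>Q\<close>.\<close>

definition model_S_adj_tensor ::
    "nat \<Rightarrow> (nat \<Rightarrow> nat) \<Rightarrow> (nat \<Rightarrow> nat list \<Rightarrow> real) \<Rightarrow> (nat \<Rightarrow> nat) \<Rightarrow> nc_poly set \<Rightarrow>
      'h::complex_hilbert_space set \<Rightarrow> nat \<Rightarrow> nat \<Rightarrow>
      (nat \<Rightarrow> nat list, 'h) ell2 \<Rightarrow> (nat \<Rightarrow> nat list, 'h) ell2"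
  where "model_S_adj_tensor k n a m Q D i j =
    tensor_id (space_N k n a m Q) D (cadjoint_on (space_N k n a m Q) (model_S k n a m Q i j))"

end

theory Submission
  imports Defs
begin

text \<open>
  In the coordinates \<open>\<xi>\<^sub>\<beta> / \<surd>b\<^sub>\<beta>\<close> the operators \<open>W\<^sub>i\<^sub>,\<^sub>j\<close> are unweighted shifts, so \<open>N\<^sub>Q \<otimes> D\<close> is cut out
  of the families with values in \<open>D\<close> by linear equations between their coordinates.

  A pure \<open>T\<close> in the variety is modelled by the Berezin kernel
  \<open>K x = (\<surd>b\<^sub>\<beta> \<Delta>\<^sup>1\<^sup>/\<^sup>2 T\<^sub>\<beta>\<^sup>* x)\<^sub>\<beta>\<close>, where \<open>\<Delta>\<close> is the defect of order \<open>m\<close>. It intertwines \<open>T\<^sub>i\<^sub>,\<^sub>j\<^sup>*\<close> with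
  \<open>W\<^sub>i\<^sub>,\<^sub>j\<^sup>* \<otimes> I\<close>, and it is isometric because the weights of \<open>W\<^sub>i\<close> are the coefficients of \<open>(1 - a\<^sub>i)\<^sup>-\<^sup>m\<close> for
  convolution on the free monoid: summing \<open>b\<^sub>\<alpha> T\<^sub>\<alpha> Y T\<^sub>\<alpha>\<^sup>*\<close> over the words of one factor inverts
  \<open>(id - \<Phi>\<^sub>i)\<^sup>m\<close> by telescoping and purity.

  Conversely, let \<open>U\<close> intertwine \<open>T\<^sup>*\<close> with \<open>S\<^sup>* \<otimes> I\<close>. Then \<open>\<Phi>\<^sub>i\<close> maps the compression of a diagonal
  operator to the compression of the diagonal operator whose entries are convolved with \<open>a\<^sub>i\<close>, and
  the convolution identity \<open>(1 - a\<^sub>i) b\<^sup>(\<^sup>m\<^sup>) = b\<^sup>(\<^sup>m\<^sup>-\<^sup>1\<^sup>)\<close> makes all defects up to order \<open>m\<close> positive.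
\<close>

section \<open>Complex Hilbert spaces\<close>

text \<open>Projections, adjoints, \<open>phi\<close> and \<open>tensor_id\<close> are definite
  descriptions, so existence and uniqueness have to come first; existence rests on the projection
  theorem and the Riesz theorem. The defining series of \<open>phi\<close> is known to converge only
  at the identity, and its Gram series is the majorant for every other operator.

  Series of operators are handled through their quadratic forms. Over the complex numbers the
  diagonal values determine an operator, and for positive operators with nonnegative coefficients
  they are series of nonnegative reals, which can be regrouped freely along splittings of words.
  This is why positivity accompanies the exchanges of sums over words.

  The weights come from exact identities between formal series, not from estimates: Pascal's rule
  gives the recursion in \<open>m\<close>, and a series without constant term gains one degree with
  each convolution. The latter yields uniqueness by induction on length, finiteness of the inverse
  series at each word and, together with domination by the weights themselves, purity of the
  compressed model.\<close>

instance complex_hilbert_space \<subseteq> banach ..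

lemma scaleR_scaleC_commute: "r *\<^sub>R c *\<^sub>C x = c *\<^sub>C r *\<^sub>R x"
  for x :: "'a::complex_hilbert_space"
  by (simp add: scaleC_scaleC mult.commute flip: scaleC_of_real)

lemma cinner_scaleR_left: "cinner (r *\<^sub>R x) y = of_real r * cinner x y"
  for x :: "'a::complex_hilbert_space"
  by (simp add: cinner_scaleC_left flip: scaleC_of_real)

lemma cinner_scaleR_right: "cinner x (r *\<^sub>R y) = of_real r * cinner x y"
  for x :: "'a::complex_hilbert_space"
  by (simp add: cinner_scaleC_right flip: scaleC_of_real)

lemma bounded_bilinear_cinner:
  "bounded_bilinear (cinner :: 'a::complex_hilbert_space \<Rightarrow> _)"
proof
  show "\<exists>K. \<forall>(a::'a) b. norm (cinner a b) \<le> norm a * norm b * K"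
    by (intro exI[of _ 1]) (simp add: cmod_cinner_le)
qed (simp_all add: cinner_add_left cinner_add_right cinner_scaleR_left cinner_scaleR_right
    scaleR_conv_of_real)

interpretation cinner: bounded_bilinear cinner
  by (rule bounded_bilinear_cinner)

lemmas [simp] = cinner.zero_left cinner.zero_right

lemma cinner_eq_zero_iff [simp]: "cinner x x = 0 \<longleftrightarrow> x = 0"
  for x :: "'a::complex_hilbert_space"
  by (simp add: cinner_self)

lemma cinner_ext:
  fixes x y :: "'a::complex_hilbert_space"
  assumes "\<And>z. cinner x z = cinner y z"
  shows "x = y"
  using assms[of "x - y"] cinner_eq_zero_iff[of "x - y"] by (simp add: cinner.diff_left)

lemma cinner_ext_right:
  fixes x y :: "'a::complex_hilbert_space"
  assumes "\<And>z. cinner z x = cinner z y"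
  shows "x = y"
  using assms[of "x - y"] cinner_eq_zero_iff[of "x - y"] by (simp add: cinner.diff_right)

lemma bounded_linear_scaleC: "bounded_linear (\<lambda>x :: 'a::complex_hilbert_space. c *\<^sub>C x)"
  by (rule bounded_linear_intro[of _ "cmod c"])
    (simp_all add: scaleC_add_right scaleR_scaleC_commute norm_scaleC mult.commute)

lemma csubspace_closure:
  fixes S :: "'a::complex_hilbert_space set"
  assumes "csubspace S"
  shows "csubspace (closure S)"
proof (rule complex_vector.subspaceI)
  show "0 \<in> closure S"
    using complex_vector.subspace_0[OF assms] closure_subset by blast
next
  fix x y assume "x \<in> closure S" "y \<in> closure S"
  then obtain f g where "\<And>n. f n \<in> S" "f \<longlonglongrightarrow> x" "\<And>n. g n \<in> S" "g \<longlonglongrightarrow> y"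
    unfolding closure_sequential by blast
  then show "x + y \<in> closure S"
    unfolding closure_sequential using complex_vector.subspace_add[OF assms]
    by (intro exI[of _ "\<lambda>n. f n + g n"]) (auto intro: tendsto_add)
next
  fix c x assume "x \<in> closure S"
  then obtain f where "\<And>n. f n \<in> S" "f \<longlonglongrightarrow> x"
    unfolding closure_sequential by blast
  then show "c *\<^sub>C x \<in> closure S"
    unfolding closure_sequential using complex_vector.subspace_scale[OF assms]
    by (intro exI[of _ "\<lambda>n. c *\<^sub>C f n"])
      (auto intro: bounded_linear.tendsto[OF bounded_linear_scaleC])
qed

lemma closure_cspan_subset:
  fixes S :: "'a::complex_hilbert_space set"
  assumes "S \<subseteq> M" "csubspace M" "closed M"
  shows "closure (cspan S) \<subseteq> M"
  by (rule closure_minimal[OF complex_vector.span_minimal[OF assms(1,2)] assms(3)])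

lemma csubspace_closure_cspan: "csubspace (closure (cspan S))"
  for S :: "'a::complex_hilbert_space set"
  by (intro csubspace_closure complex_vector.subspace_span)

section \<open>Orthogonal projections and the Riesz theorem\<close>

lemma orthogonal_of_minimal:
  fixes w z :: "'a::real_inner"
  assumes "\<And>t. (norm w)\<^sup>2 \<le> (norm (w - t *\<^sub>R z))\<^sup>2"
  shows "inner w z = 0"
proof (cases "z = 0")
  case False
  \<comment> \<open>The minimiser in \<open>t\<close> of the quadratic polynomial computed
    next.\<close>
  define t where "t = inner w z / (norm z)\<^sup>2"
  have "(norm (w - t *\<^sub>R z))\<^sup>2 = (norm w)\<^sup>2 - 2 * t * inner w z + t\<^sup>2 * (norm z)\<^sup>2"
    unfolding power2_norm_eq_inner inner_diff_left inner_diff_right inner_commute[of z w]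
    by (simp add: power2_eq_square inner_commute)
  also have "\<dots> = (norm w)\<^sup>2 - (inner w z)\<^sup>2 / (norm z)\<^sup>2"
    using False by (simp add: t_def field_simps power2_eq_square)
  finally have "(inner w z)\<^sup>2 / (norm z)\<^sup>2 \<le> 0"
    using assms[of t] by simp
  then show ?thesis
    using False by (simp add: divide_le_0_iff)
qed simp

text \<open>A minimising sequence for the distance is Cauchy by the parallelogram law. Minimality
  gives real orthogonality, and testing against \<open>\<i> *\<^sub>C z\<close> as well makes the
  complex inner product vanish.\<close>

lemma orthogonal_projection_exists:
  fixes M :: "'a::complex_hilbert_space set"
  assumes M: "closed M" "csubspace M"
  obtains y where "y \<in> M" "\<And>z. z \<in> M \<Longrightarrow> cinner (x - y) z = 0"
proof -
  note sub = complex_vector.subspace_add[OF M(2)] complex_vector.subspace_scale[OF M(2)]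
  have subR: "r *\<^sub>R z \<in> M" if "z \<in> M" for r z
    using sub(2)[OF that, of "complex_of_real r"] by (simp add: scaleC_of_real)
  define D where "D = (INF y\<in>M. (norm (x - y))\<^sup>2)"
  have bdd: "bdd_below ((\<lambda>y. (norm (x - y))\<^sup>2) ` M)"
    by (rule bdd_belowI[of _ 0]) auto
  have D_le: "D \<le> (norm (x - y))\<^sup>2" if "y \<in> M" for y
    unfolding D_def by (rule cINF_lower[OF bdd that])
  have ne: "M \<noteq> {}"
    using complex_vector.subspace_0[OF M(2)] by auto
  have "\<exists>y\<in>M. (norm (x - y))\<^sup>2 < D + inverse (real (Suc n))" for n
  proof -
    have "D < D + inverse (real (Suc n))" by simp
    then show ?thesis
      unfolding cINF_less_iff[OF ne bdd, folded D_def] .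
  qed
  then obtain y where y: "\<And>n. y n \<in> M" "\<And>n. (norm (x - y n))\<^sup>2 < D + inverse (real (Suc n))"
    by metis
  have close: "(norm (y p - y q))\<^sup>2 \<le> 2 * inverse (real (Suc p)) + 2 * inverse (real (Suc q))" for p q
  proof -
    have "(1/2) *\<^sub>R (y p + y q) \<in> M"
      by (intro subR sub y)
    from D_le[OF this] have "4 * D \<le> 4 * (norm (x - (1/2) *\<^sub>R (y p + y q)))\<^sup>2"
      by simp
    also have "\<dots> = 2 * (norm (x - y p))\<^sup>2 + 2 * (norm (x - y q))\<^sup>2 - (norm (y p - y q))\<^sup>2"
    proof -
      define u v where "u = x - y p" and "v = x - y q"
      have "(1/2) *\<^sub>R (u + v) = (1/2) *\<^sub>R (x + x) - (1/2) *\<^sub>R (y p + y q)"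
        unfolding scaleR_diff_right[symmetric] by (simp add: u_def v_def algebra_simps)
      then have eq: "x - (1/2) *\<^sub>R (y p + y q) = (1/2) *\<^sub>R (u + v)" "y p - y q = v - u"
        by (simp_all add: u_def v_def del: scaleR_right_distrib)
      show ?thesis
        unfolding u_def[symmetric] v_def[symmetric] eq power2_norm_eq_inner
        by (simp add: inner_commute[of v u] inner_diff_left inner_diff_right
            inner_add_left inner_add_right add_divide_distrib)
    qed
    finally show ?thesis
      using y(2)[of p] y(2)[of q] by linarith
  qed
  have "Cauchy y"
  proof (rule metric_CauchyI)
    fix e :: real assume e: "0 < e"
    obtain N where N: "inverse (real (Suc N)) < e\<^sup>2 / 4"
      using reals_Archimedean[of "e\<^sup>2 / 4"] e by auto
    have "dist (y p) (y q) < e" if "p \<ge> N" "q \<ge> N" for p q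
    proof (rule power2_less_imp_less)
      have "inverse (real (Suc p)) \<le> inverse (real (Suc N))"
        "inverse (real (Suc q)) \<le> inverse (real (Suc N))"
        using that by auto
      with close[of p q] N show "(dist (y p) (y q))\<^sup>2 < e\<^sup>2"
        unfolding dist_norm by linarith
    qed (use e in simp)
    then show "\<exists>N. \<forall>p\<ge>N. \<forall>q\<ge>N. dist (y p) (y q) < e" by blast
  qed
  then obtain l where l: "y \<longlonglongrightarrow> l"
    using Cauchy_convergent convergent_def by blast
  have "l \<in> M"
    using closed_sequentially[OF M(1)] y(1) l by blast
  have "(\<lambda>n. (norm (x - y n))\<^sup>2) \<longlonglongrightarrow> (norm (x - l))\<^sup>2"
    by (intro tendsto_intros l)
  moreover have "(\<lambda>n. D + inverse (real (Suc n))) \<longlonglongrightarrow> D + 0"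
    by (intro tendsto_intros LIMSEQ_inverse_real_of_nat)
  ultimately have le: "(norm (x - l))\<^sup>2 \<le> D"
    using y(2) by (intro LIMSEQ_le[of _ "(norm (x - l))\<^sup>2" _ D]) (auto intro: less_imp_le)
  have inner0: "inner (x - l) z = 0" if "z \<in> M" for z
  proof (rule orthogonal_of_minimal)
    fix t
    have "(norm (x - l))\<^sup>2 \<le> (norm (x - (l + t *\<^sub>R z)))\<^sup>2"
      by (rule order_trans[OF le D_le]) (intro sub subR that \<open>l \<in> M\<close>)
    then show "(norm (x - l))\<^sup>2 \<le> (norm (x - l - t *\<^sub>R z))\<^sup>2"
      by (simp add: algebra_simps)
  qed
  have "cinner (x - l) z = 0" if "z \<in> M" for z
    using inner0[OF that] inner0[OF sub(2)[OF that, of \<i>]]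
    by (simp add: inner_eq_Re_cinner cinner_scaleC_right complex_eq_iff)
  with \<open>l \<in> M\<close> show ?thesis
    using that by blast
qed

text \<open>The residual of the projection of \<open>x\<close> is itself orthogonal to
  \<open>M\<close>, so the hypothesis applies to it and forces its norm to vanish.\<close>

lemma mem_closed_csubspaceI:
  fixes M :: "'a::complex_hilbert_space set"
  assumes M: "closed M" "csubspace M" and "\<And>w. (\<And>z. z \<in> M \<Longrightarrow> cinner w z = 0) \<Longrightarrow> cinner w x = 0"
  shows "x \<in> M"
proof -
  obtain y where y: "y \<in> M" "\<And>z. z \<in> M \<Longrightarrow> cinner (x - y) z = 0"
    using orthogonal_projection_exists[OF M] by blast
  have "cinner (x - y) (x - y) = 0"
    using assms(3)[OF y(2)] y by (simp add: cinner.diff_right)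
  with y(1) show ?thesis by simp
qed

lemma cinner_cproj:
  assumes "closed M" "csubspace M" "y \<in> M"
  shows "cinner y (cproj M x) = cinner y x"
proof -
  obtain p where p: "p \<in> M" "\<And>z. z \<in> M \<Longrightarrow> cinner (x - p) z = 0"
    using orthogonal_projection_exists[OF assms(1,2)] by blast
  have "cproj M x = p"
    unfolding cproj_def
  proof (rule the_equality)
    show "p \<in> M \<and> (\<forall>z\<in>M. cinner (x - p) z = 0)" using p by blast
    fix r assume r: "r \<in> M \<and> (\<forall>z\<in>M. cinner (x - r) z = 0)"
    have "r - p \<in> M"
      using r p(1) complex_vector.subspace_diff[OF assms(2)] by blast
    then have "cinner (r - p) (r - p) = 0"
      using r p(2)[of "r - p"] by (auto simp: cinner.diff_left)
    then show "r = p" by simp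
  qed
  moreover have "cinner y (x - p) = 0"
    using p(2)[OF assms(3)] cinner_commute[of y "x - p"] by simp
  ultimately show ?thesis
    by (simp add: cinner.diff_right)
qed

lemma riesz_representation:
  fixes f :: "'a::complex_hilbert_space \<Rightarrow> complex"
  assumes add: "\<And>x y. f (x + y) = f x + f y" and scale: "\<And>c x. f (c *\<^sub>C x) = c * f x"
    and bound: "\<And>x. cmod (f x) \<le> B * norm x"
  obtains y where "\<And>x. f x = cinner x y"
proof (cases "\<forall>x. f x = 0")
  case True
  then show ?thesis using that[of 0] by simp
next
  case False
  then obtain x0 where x0: "f x0 \<noteq> 0" by blast
  have bl: "bounded_linear f"
    by (rule bounded_linear_intro[of f B])
      (use add scale bound in \<open>simp_all add: mult.commute scaleR_conv_of_real flip: scaleC_of_real\<close>)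
  define M where "M = {x. f x = 0}"
  have "closed M"
    unfolding M_def by (intro closed_Collect_eq continuous_intros bounded_linear.continuous_on[OF bl])
  moreover have "csubspace M"
    unfolding M_def using add scale scale[of 0 0] by (intro complex_vector.subspaceI) auto
  ultimately obtain p where p: "p \<in> M" "\<And>z. z \<in> M \<Longrightarrow> cinner (x0 - p) z = 0"
    using orthogonal_projection_exists by blast
  interpret f: bounded_linear f by (rule bl)
  define w where "w = x0 - p"
  have fw: "f w \<noteq> 0"
    using x0 p(1) by (simp add: w_def f.diff M_def)
  then have w: "w \<noteq> 0" using f.zero by auto
  \<comment> \<open>The orthogonal complement of the kernel is spanned by \<open>w\<close>; the
    factor makes \<open>cinner w y = f w\<close>.\<close>
  define y where "y = (cnj (f w) / of_real ((norm w)\<^sup>2)) *\<^sub>C w"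
  have "f x = cinner x y" for x
  proof -
    have "x - (f x / f w) *\<^sub>C w \<in> M"
      using fw by (simp add: M_def f.diff scale)
    then have "cinner w (x - (f x / f w) *\<^sub>C w) = 0"
      using p(2) by (simp add: w_def)
    then have "cinner (x - (f x / f w) *\<^sub>C w) w = 0"
      using cinner_commute by (metis complex_cnj_zero)
    then have "cinner x w = f x / f w * of_real ((norm w)\<^sup>2)"
      by (simp add: cinner.diff_left cinner_scaleC_left cinner_self)
    then show ?thesis
      using fw w by (simp add: y_def cinner_scaleC_right)
  qed
  with that show ?thesis by blast
qed

section \<open>Bounded operators, sesquilinear forms and adjoints\<close>

lemma bounded_opI:
  assumes "\<And>x y. A (x + y) = A x + A y" "\<And>c x. A (c *\<^sub>C x) = c *\<^sub>C A x"
    "\<And>x. norm (A x) \<le> B * norm x"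
  shows "bounded_op A"
  using assms unfolding bounded_op_on_def by blast

lemma bounded_op_bound:
  assumes "bounded_op A"
  obtains B where "0 < B" "\<And>x. norm (A x) \<le> B * norm x"
proof -
  obtain B where B: "\<And>x. norm (A x) \<le> B * norm x"
    using assms unfolding bounded_op_on_def by blast
  have "norm (A x) \<le> (\<bar>B\<bar> + 1) * norm x" for x
    by (rule order_trans[OF B]) (intro mult_right_mono, auto)
  then show ?thesis using that[of "\<bar>B\<bar> + 1"] by auto
qed

lemma bounded_op_linear: "bounded_op A \<Longrightarrow> bounded_linear A"
  by (simp add: bounded_op_iff_bounded_linear)

lemma bounded_op_scaleC: "bounded_op A \<Longrightarrow> A (c *\<^sub>C x) = c *\<^sub>C A x"
  by (simp add: bounded_op_iff_bounded_linear)

lemma bounded_op_add: "bounded_op A \<Longrightarrow> A (x + y) = A x + A y"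
  unfolding bounded_op_on_def by blast

lemma bounded_op_id: "bounded_op id"
  by (rule bounded_opI[of _ 1]) auto

lemma bounded_op_comp: "bounded_op A \<Longrightarrow> bounded_op B \<Longrightarrow> bounded_op (A \<circ> B)"
  unfolding bounded_op_iff_bounded_linear o_def
  using bounded_linear_compose by auto

lemma bounded_op_diff: "bounded_op A \<Longrightarrow> bounded_op B \<Longrightarrow> bounded_op (\<lambda>x. A x - B x)"
  unfolding bounded_op_iff_bounded_linear
  using bounded_linear_sub by (auto simp: complex_vector.scale_right_diff_distrib)

lemma bounded_op_cmult: "bounded_op A \<Longrightarrow> bounded_op (\<lambda>x. c *\<^sub>C A x)"
  unfolding bounded_op_iff_bounded_linear
  using bounded_linear_compose[OF bounded_linear_scaleC] by (auto simp: scaleC_scaleC mult.commute)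

text \<open>The Riesz theorem is applied in the second argument, after a conjugation because
  \<open>cinner\<close> is linear in its first one. This is how \<open>\<Phi> Y\<close> arises from
  the sums of its matrix entries.\<close>

lemma bounded_sesquilinear_form_op:
  fixes F :: "'a::complex_hilbert_space \<Rightarrow> 'a \<Rightarrow> complex"
  assumes add_left: "\<And>x x' y. F (x + x') y = F x y + F x' y"
    and scale_left: "\<And>c x y. F (c *\<^sub>C x) y = c * F x y"
    and add_right: "\<And>x y y'. F x (y + y') = F x y + F x y'"
    and scale_right: "\<And>c x y. F x (c *\<^sub>C y) = cnj c * F x y"
    and bound: "\<And>x y. cmod (F x y) \<le> B * (norm x * norm y)"
  obtains Z where "bounded_op Z" "\<And>x y. cinner (Z x) y = F x y"
proof -
  have "\<exists>z. \<forall>y. cnj (F x y) = cinner y z" for x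
    by (rule riesz_representation[of "\<lambda>y. cnj (F x y)" "B * norm x"])
      (use add_right scale_right bound[of x] in \<open>auto simp: mult.assoc\<close>)
  then obtain Z where Z: "\<And>x y. cnj (F x y) = cinner y (Z x)" by metis
  then have Z: "\<And>x y. cinner (Z x) y = F x y"
    by (metis cinner_commute complex_cnj_cnj)
  have "bounded_op Z"
  proof (rule bounded_opI)
    show "Z (x + y) = Z x + Z y" for x y
      by (rule cinner_ext) (simp add: Z add_left cinner_add_left)
    show "Z (c *\<^sub>C x) = c *\<^sub>C Z x" for c x
      by (rule cinner_ext) (simp add: Z scale_left cinner_scaleC_left)
    show "norm (Z x) \<le> B * norm x" for x
    proof (cases "Z x = 0")
      case True
      \<comment> \<open>\<open>B\<close> might be negative a priori, so the sign of
        \<open>B * norm x\<close> is read off the bound on the diagonal.\<close>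
      have "0 \<le> (B * norm x) * norm x"
        using order_trans[OF norm_ge_zero bound[of x x]] by (simp add: mult.assoc)
      then have "0 \<le> B * norm x"
        by (cases "x = 0") (simp_all add: zero_le_mult_iff)
      with True show ?thesis by simp
    next
      case False
      have "(norm (Z x))\<^sup>2 = cmod (cinner (Z x) (Z x))"
        by (simp add: cinner_self norm_power)
      also have "\<dots> \<le> B * (norm x * norm (Z x))"
        unfolding Z by (rule bound)
      finally have "norm (Z x) * norm (Z x) \<le> (B * norm x) * norm (Z x)"
        by (simp add: power2_eq_square mult.assoc)
      then show ?thesis
        using False by simp
    qed
  qed
  with Z that show ?thesis by blast
qed

lemma cadjoint_eqI:
  assumes "\<And>x y. cinner (A x) y = cinner x (B y)"
  shows "cadjoint A = B"
proof
  fix y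
  have B: "cinner (B y) z = cinner y (A z)" for z
    using assms cinner_commute by metis
  show "cadjoint A y = B y"
    unfolding cadjoint_on_def by (rule the_equality) (auto simp: B intro: cinner_ext)
qed

lemma bounded_op_adjoint_exists:
  assumes "bounded_op A"
  obtains B where "bounded_op B" "\<And>x y. cinner (A x) y = cinner x (B y)"
proof -
  obtain C where C: "0 < C" "\<And>x. norm (A x) \<le> C * norm x"
    using bounded_op_bound[OF assms] by blast
  have bound: "cmod (cinner (A x) y) \<le> C * (norm x * norm y)" for x y
    by (rule order_trans[OF cmod_cinner_le])
      (use mult_right_mono[OF C(2), of "norm y" x] in \<open>simp add: mult.assoc\<close>)
  have "\<exists>z. \<forall>x. cinner (A x) y = cinner x z" for y
    by (rule riesz_representation[of "\<lambda>x. cinner (A x) y" "C * norm y"])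
      (use assms bound[of _ y] in \<open>auto simp: bounded_op_add bounded_op_scaleC cinner_add_left
        cinner_scaleC_left ac_simps\<close>)
  then obtain B where B: "\<And>x y. cinner (A x) y = cinner x (B y)" by metis
  have "bounded_op B"
  proof (rule bounded_opI)
    show "B (x + y) = B x + B y" for x y
      by (rule cinner_ext_right) (simp add: cinner_add_right flip: B)
    show "B (c *\<^sub>C x) = c *\<^sub>C B x" for c x
      by (rule cinner_ext_right) (simp add: cinner_scaleC_right flip: B)
    show "norm (B y) \<le> C * norm y" for y
    proof (cases "B y = 0")
      case False
      have "(norm (B y))\<^sup>2 = cmod (cinner (B y) (B y))"
        by (simp add: cinner_self norm_power)
      also have "\<dots> \<le> C * (norm (B y) * norm y)"
        unfolding B[symmetric] by (rule bound)
      finally have "norm (B y) * norm (B y) \<le> (C * norm y) * norm (B y)"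
        by (simp add: power2_eq_square ac_simps)
      then show ?thesis
        using False by simp
    qed (use C in simp)
  qed
  with B that show ?thesis by blast
qed

lemma
  assumes "bounded_op A"
  shows bounded_op_cadjoint: "bounded_op (cadjoint A)"
    and cinner_cadjoint: "cinner x (cadjoint A y) = cinner (A x) y"
proof -
  obtain B where "bounded_op B" "\<And>x y. cinner (A x) y = cinner x (B y)"
    using bounded_op_adjoint_exists[OF assms] by blast
  moreover from this have "cadjoint A = B" by (intro cadjoint_eqI)
  ultimately show "bounded_op (cadjoint A)" "cinner x (cadjoint A y) = cinner (A x) y" by auto
qed

lemma cinner_cadjoint_left: "bounded_op A \<Longrightarrow> cinner (cadjoint A x) y = cinner x (A y)"
  using cinner_cadjoint cinner_commute by metis

lemma cadjoint_id: "cadjoint id = id"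
  by (rule cadjoint_eqI) simp

lemma cadjoint_comp:
  "bounded_op A \<Longrightarrow> bounded_op B \<Longrightarrow> cadjoint (A \<circ> B) = cadjoint B \<circ> cadjoint A"
  by (rule cadjoint_eqI) (simp add: cinner_cadjoint)

section \<open>Quadratic forms and positive operators\<close>

lemma polarization:
  assumes A: "bounded_op A"
  shows "4 * cinner (A x) y = cinner (A (x + y)) (x + y) - cinner (A (x - y)) (x - y)
    + \<i> * cinner (A (x + \<i> *\<^sub>C y)) (x + \<i> *\<^sub>C y) - \<i> * cinner (A (x - \<i> *\<^sub>C y)) (x - \<i> *\<^sub>C y)"
proof -
  interpret bounded_linear A by (rule bounded_op_linear[OF A])
  note expand = add diff bounded_op_scaleC[OF A] cinner_add_left cinner_add_right
    cinner.diff_left cinner.diff_right cinner_scaleC_left cinner_scaleC_right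
  have 1: "cinner (A (x + y)) (x + y) = cinner (A x) x + cinner (A x) y + (cinner (A y) x + cinner (A y) y)"
    "cinner (A (x - y)) (x - y) = cinner (A x) x - cinner (A x) y - (cinner (A y) x - cinner (A y) y)"
    by (simp_all add: expand)
  have 2: "cinner (A (x + \<i> *\<^sub>C y)) (x + \<i> *\<^sub>C y) =
      cinner (A x) x - \<i> * cinner (A x) y + (\<i> * cinner (A y) x + cinner (A y) y)"
    "cinner (A (x - \<i> *\<^sub>C y)) (x - \<i> *\<^sub>C y) =
      cinner (A x) x + \<i> * cinner (A x) y - (\<i> * cinner (A y) x - cinner (A y) y)"
    by (simp_all add: expand distrib_left right_diff_distrib flip: mult.assoc)
  have "4 * q = (p + q + (r + s)) - (p - q - (r - s)) + \<i> * (p - \<i> * q + (\<i> * r + s))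
      - \<i> * (p + \<i> * q - (\<i> * r - s))" for p q r s :: complex
    using i_squared by algebra
  then show ?thesis
    unfolding 1 2 .
qed

text \<open>Polarization recovers the whole form from its diagonal, which is special to complex
  scalars. Operator identities can thus be checked on quadratic forms.\<close>

lemma quadratic_form_determines_op:
  assumes "bounded_op A" "bounded_op B" "\<And>x. cinner (A x) x = cinner (B x) x"
  shows "A = B"
proof
  fix x
  have "4 * cinner (A x) y = 4 * cinner (B x) y" for y
    unfolding polarization[OF assms(1)] polarization[OF assms(2)] assms(3) ..
  then show "A x = B x"
    by (rule cinner_ext[OF mult_left_cancel[THEN iffD1, rotated]]) simp
qed

lemma isometry_cinner:
  assumes V: "bounded_op V" and iso: "\<And>x. norm (V x) = norm x"
  shows "cinner (V x) (V y) = cinner x y"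
proof -
  have "cadjoint V \<circ> V = id"
    by (rule quadratic_form_determines_op)
      (simp_all add: bounded_op_comp bounded_op_cadjoint bounded_op_id V cinner_cadjoint_left
        cinner_self iso)
  then show ?thesis
    using cinner_cadjoint[OF V, of x "V y"] by (simp add: fun_eq_iff)
qed

lemma positive_op_bounded: "positive_op A \<Longrightarrow> bounded_op A"
  unfolding positive_op_def by blast

lemma positive_op_form: "positive_op A \<Longrightarrow> cinner (A x) x = of_real (Re (cinner (A x) x))"
  unfolding positive_op_def by (simp add: complex_is_Real_iff complex_eq_iff)

lemma positive_op_form_nonneg: "positive_op A \<Longrightarrow> 0 \<le> Re (cinner (A x) x)"
  unfolding positive_op_def by blast

lemma positive_op_selfadjoint:
  assumes "positive_op A"
  shows "cinner (A x) y = cinner x (A y)"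
proof -
  have A: "bounded_op A" by (rule positive_op_bounded[OF assms])
  have "cadjoint A = A"
  proof (rule quadratic_form_determines_op)
    show "cinner (cadjoint A x) x = cinner (A x) x" for x
      by (metis A assms cinner_cadjoint_left cinner_commute complex_cnj_complex_of_real positive_op_form)
  qed (simp_all add: A bounded_op_cadjoint)
  then show ?thesis
    using cinner_cadjoint[OF A] by metis
qed

text \<open>Positivity is tested at \<open>x - A x / M\<close>. In operator terms the square of
  \<open>A\<close> is at most \<open>M\<close> times \<open>A\<close>.\<close>

lemma positive_op_norm_square_le:
  assumes A: "positive_op A" and M: "0 < M" "\<And>x. norm (A x) \<le> M * norm x"
  shows "(norm (A x))\<^sup>2 \<le> M * Re (cinner (A x) x)"
proof -
  interpret bounded_linear A
    by (rule bounded_op_linear[OF positive_op_bounded[OF A]])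
  define s where "s = inverse M"
  have *: "cinner (A (A x)) x = of_real ((norm (A x))\<^sup>2)"
    using positive_op_selfadjoint[OF A, of "A x" x] by (simp add: cinner_self)
  have "cmod (cinner (A (A x)) (A x)) \<le> M * (norm (A x))\<^sup>2"
    by (rule order_trans[OF cmod_cinner_le])
      (use mult_right_mono[OF M(2), of "norm (A x)" "A x"] in \<open>simp add: power2_eq_square mult.assoc\<close>)
  then have le: "Re (cinner (A (A x)) (A x)) \<le> M * (norm (A x))\<^sup>2"
    using complex_Re_le_cmod order_trans by blast
  have "cinner (A (x - s *\<^sub>R A x)) (x - s *\<^sub>R A x) =
      cinner (A x) x - of_real (2 * s * (norm (A x))\<^sup>2) + of_real (s\<^sup>2) * cinner (A (A x)) (A x)"
    by (simp add: diff scaleR cinner.diff_left cinner.diff_right cinner_scaleR_left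
        cinner_scaleR_right * cinner_self[of "A x"] power2_eq_square algebra_simps)
  then have "0 \<le> Re (cinner (A x) x) - 2 * s * (norm (A x))\<^sup>2 + s\<^sup>2 * Re (cinner (A (A x)) (A x))"
    using positive_op_form_nonneg[OF A, of "x - s *\<^sub>R A x"] by (simp flip: of_real_power)
  also have "\<dots> \<le> Re (cinner (A x) x) - 2 * s * (norm (A x))\<^sup>2 + s\<^sup>2 * (M * (norm (A x))\<^sup>2)"
    using mult_left_mono[OF le, of "s\<^sup>2"] by simp
  also have "\<dots> = Re (cinner (A x) x) - s * (norm (A x))\<^sup>2"
    using M(1) by (simp add: s_def power2_eq_square)
  finally show ?thesis
    using M(1) by (simp add: s_def field_simps)
qed

section \<open>Regrouping of unconditional sums\<close>

lemma has_sum_fibers: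
  fixes F :: "'a \<Rightarrow> 'b::{topological_comm_monoid_add, t3_space}"
  assumes F: "(F has_sum S) A" and h: "h ` A \<subseteq> X"
    and fin: "\<And>d. d \<in> X \<Longrightarrow> finite {p \<in> A. h p = d}"
  shows "((\<lambda>d. \<Sum>p\<in>{p \<in> A. h p = d}. F p) has_sum S) X"
proof (rule has_sum_SigmaD)
  have "bij_betw snd (Sigma X (\<lambda>d. {p \<in> A. h p = d})) A"
    by (rule bij_betw_byWitness[of _ "\<lambda>p. (h p, p)"]) (use h in auto)
  then show "((\<lambda>z. F (snd z)) has_sum S) (Sigma X (\<lambda>d. {p \<in> A. h p = d}))"
    using F by (simp add: has_sum_reindex_bij_betw)
  show "((\<lambda>y. F (snd (d, y))) has_sum (\<Sum>p\<in>{p \<in> A. h p = d}. F p)) {p \<in> A. h p = d}"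
    if "d \<in> X" for d
    using has_sum_finite[OF fin[OF that], of F] by simp
qed

text \<open>Tonelli for unconditional sums: convergence of the iterated sum suffices because nothing
  can cancel. The interchanges of sums over words below rest on it.\<close>

lemma has_sum_Times_nonneg:
  fixes F :: "'a \<Rightarrow> 'b \<Rightarrow> real"
  assumes "\<And>x. x \<in> A \<Longrightarrow> (F x has_sum g x) B" "(g has_sum S) A"
    and "\<And>x y. x \<in> A \<Longrightarrow> y \<in> B \<Longrightarrow> 0 \<le> F x y"
  shows "((\<lambda>(x, y). F x y) has_sum S) (A \<times> B)"
proof (rule has_sum_SigmaI)
  show "(\<lambda>(x, y). F x y) summable_on A \<times> B"
    using assms by (intro summable_on_SigmaI[where g = g]) (auto intro: has_sum_imp_summable)
qed (use assms in auto)

section \<open>Square roots of positive operators\<close>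

definition sqrt_coeff :: "nat \<Rightarrow> real"
  where "sqrt_coeff p = (-1) ^ p * ((1/2) gchoose p)"

text \<open>Chu-Vandermonde with \<open>1/2 + 1/2 = 1\<close>: the Cauchy square of the series is
  \<open>1 - b\<close>, hence the three cases.\<close>

lemma sqrt_coeff_conv:
  "(\<Sum>i\<le>p. sqrt_coeff i * sqrt_coeff (p - i)) = (if p = 0 then 1 else if p = 1 then -1 else 0)"
proof -
  have "(\<Sum>i\<le>p. sqrt_coeff i * sqrt_coeff (p - i)) =
      (-1) ^ p * (\<Sum>i\<in>{0..p}. ((1/2) gchoose i) * ((1/2::real) gchoose (p - i)))"
    unfolding sum_distrib_left
    by (rule sum.cong) (auto simp: sqrt_coeff_def simp flip: power_add)
  also have "\<dots> = (-1) ^ p * (1 gchoose p)"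
    by (simp add: gbinomial_Vandermonde)
  also have "(1::real) gchoose p = of_nat (1 choose p)"
    by (simp add: binomial_gbinomial)
  finally show ?thesis
    by (cases p rule: nat.exhaust) (auto simp: binomial_eq_0)
qed

text \<open>All coefficients beyond the zeroth are nonpositive, so the partial sum of absolute
  values is 2 minus the plain partial sum, and the latter has a closed form that is nonnegative. The
  series therefore converges absolutely even at norm one.\<close>

lemma sqrt_coeff_abs_summable: "(\<lambda>p. \<bar>sqrt_coeff p\<bar>) summable_on UNIV"
proof -
  have nonpos: "sqrt_coeff (Suc p) \<le> 0" for p
  proof -
    have "sqrt_coeff (Suc p) = (-1/2) * pochhammer (1/2) p / fact (Suc p)"
      unfolding sqrt_coeff_def gbinomial_pochhammer by (simp add: pochhammer_rec flip: power_mult_distrib)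
    then show ?thesis
      using pochhammer_nonneg[of "1/2::real" p] by (simp add: divide_nonpos_nonneg)
  qed
  have bound: "(\<Sum>p\<le>q. \<bar>sqrt_coeff p\<bar>) \<le> 2" for q
  proof -
    have "0 \<le> (-1) ^ q * ((-1/2::real) gchoose q)"
      unfolding gbinomial_pochhammer
      using pochhammer_nonneg[of "1/2::real" q] by (simp flip: power_mult_distrib)
    also have "\<dots> = (\<Sum>p\<le>q. sqrt_coeff p)"
      using gbinomial_sum_lower_neg[of "1/2::real" q] by (simp add: sqrt_coeff_def mult.commute)
    also have "\<dots> = 2 - (\<Sum>p\<le>q. \<bar>sqrt_coeff p\<bar>)"
    proof (induction q)
      case (Suc q)
      then show ?case using nonpos[of q] by simp
    qed (simp add: sqrt_coeff_def)
    finally show ?thesis by simp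
  qed
  have "summable (\<lambda>p. \<bar>sqrt_coeff p\<bar>)"
    by (rule bounded_imp_summable[of _ 2]) (use bound in \<open>auto simp: lessThan_Suc_atMost\<close>)
  then show ?thesis
    by (intro norm_summable_imp_summable_on) simp
qed

text \<open>Binomial series \<open>\<surd>(1 - b) = \<Sum>\<^sub>p (-1)\<^sup>p (1/2 choose p) b\<^sup>p\<close> at a self-adjoint contraction \<open>B\<close>.\<close>

lemma sqrt_of_one_minus_contraction:
  fixes B :: "'a::complex_hilbert_space \<Rightarrow> 'a"
  assumes B: "bounded_op B" and contr: "\<And>x. norm (B x) \<le> norm x"
    and sa: "\<And>x y. cinner (B x) y = cinner x (B y)"
  obtains R where "bounded_op R" "\<And>x y. cinner (R x) y = cinner x (R y)" "\<And>x. R (R x) = x - B x"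
proof -
  define c where "c = sqrt_coeff"
  have powB: "bounded_op (B ^^ p)" for p
    by (induction p) (auto simp: bounded_op_id[unfolded id_def] bounded_op_id
        intro: bounded_op_comp[OF B, unfolded o_def])
  have normB: "norm ((B ^^ p) x) \<le> norm x" for p x
    by (induction p) (auto intro: order_trans[OF contr])
  have saB: "cinner ((B ^^ p) x) y = cinner x ((B ^^ p) y)" for p x y
    by (induction p arbitrary: y) (simp_all add: sa flip: funpow_swap1)
  define s where "s = (\<Sum>\<^sub>\<infinity>p. \<bar>c p\<bar>)"
  have cs: "((\<lambda>p. \<bar>c p\<bar>) has_sum s) UNIV"
    unfolding s_def c_def by (rule has_sum_infsum[OF sqrt_coeff_abs_summable])
  have term_le: "norm (c p *\<^sub>R (B ^^ p) x) \<le> \<bar>c p\<bar> * norm x" for p x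
    by (simp add: mult_left_mono normB)
  have csx: "((\<lambda>p. \<bar>c p\<bar> * norm x) has_sum (s * norm x)) UNIV" for x :: 'a
    by (rule has_sum_cmult_left[OF cs])
  have absum: "(\<lambda>p. norm (c p *\<^sub>R (B ^^ p) x)) summable_on UNIV" for x
    by (rule summable_on_comparison_test[OF has_sum_imp_summable[OF csx[of x]]]) (use term_le in auto)
  define R where "R x = (\<Sum>\<^sub>\<infinity>p. c p *\<^sub>R (B ^^ p) x)" for x
  have R: "((\<lambda>p. c p *\<^sub>R (B ^^ p) x) has_sum R x) UNIV" for x
    unfolding R_def by (rule has_sum_infsum[OF abs_summable_summable[OF absum]])
  have "bounded_op R"
  proof (rule bounded_opI)
    show "R (x + y) = R x + R y" for x y
      by (rule has_sum_unique[OF R])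
        (use has_sum_add[OF R[of x] R[of y]] in
          \<open>simp add: bounded_op_add[OF powB] scaleR_right_distrib\<close>)
    show "R (z *\<^sub>C x) = z *\<^sub>C R x" for z x
      by (rule has_sum_unique[OF R])
        (use has_sum_bounded_linear[OF bounded_linear_scaleC R[of x]] in
          \<open>simp add: bounded_op_scaleC[OF powB] scaleR_scaleC_commute o_def\<close>)
    show "norm (R x) \<le> s * norm x" for x
    proof -
      have "norm (R x) \<le> (\<Sum>\<^sub>\<infinity>p. norm (c p *\<^sub>R (B ^^ p) x))"
        unfolding R_def by (rule norm_infsum_bound[OF absum])
      also have "\<dots> \<le> s * norm x"
        using infsum_mono[OF absum has_sum_imp_summable[OF csx] term_le] csx infsumI by metis
      finally show ?thesis .
    qed
  qed
  moreover have "cinner (R x) y = cinner x (R y)" for x y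
  proof (rule has_sum_unique)
    show "((\<lambda>p. cinner (c p *\<^sub>R (B ^^ p) x) y) has_sum cinner (R x) y) UNIV"
      using has_sum_bounded_linear[OF cinner.bounded_linear_left R] by (simp add: o_def)
    show "((\<lambda>p. cinner (c p *\<^sub>R (B ^^ p) x) y) has_sum cinner x (R y)) UNIV"
      using has_sum_bounded_linear[OF cinner.bounded_linear_right R]
      by (simp add: o_def cinner_scaleR_left cinner_scaleR_right saB)
  qed
  moreover have "R (R x) = x - B x" for x
  proof -
    \<comment> \<open>One absolutely convergent double series is summed in two ways: by rows it is
      \<open>R (R x)\<close>, while along the antidiagonals \<open>p + q = r\<close> only
      \<open>r = 0\<close> and \<open>r = 1\<close> survive.\<close>
    let ?F = "\<lambda>(p, q). (c p * c q) *\<^sub>R (B ^^ (p + q)) x"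
    have "(\<lambda>(p, q). \<bar>c p\<bar> * \<bar>c q\<bar> * norm x) summable_on UNIV \<times> UNIV"
      by (rule has_sum_imp_summable, rule has_sum_Times_nonneg)
        (auto intro!: has_sum_cmult_left has_sum_cmult_right cs)
    then have "(\<lambda>z. norm (?F z)) summable_on UNIV \<times> UNIV"
      by (rule summable_on_comparison_test) (auto simp: abs_mult normB mult_left_mono)
    then have "?F summable_on UNIV \<times> UNIV"
      by (rule abs_summable_summable)
    then obtain S where S: "(?F has_sum S) (UNIV \<times> UNIV)"
      unfolding summable_on_def by blast
    have "((\<lambda>p. c p *\<^sub>R (B ^^ p) (R x)) has_sum S) UNIV"
    proof (rule has_sum_SigmaD[OF S])
      fix p
      have "((\<lambda>q. c p *\<^sub>R (B ^^ p) (c q *\<^sub>R (B ^^ q) x)) has_sum c p *\<^sub>R (B ^^ p) (R x)) UNIV"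
        using has_sum_scaleR[OF has_sum_bounded_linear[OF bounded_op_linear[OF powB[of p]] R[of x]], of "c p"]
        by (simp add: o_def)
      then show "((\<lambda>q. ?F (p, q)) has_sum c p *\<^sub>R (B ^^ p) (R x)) UNIV"
        by (simp add: linear_scale[OF bounded_linear.linear[OF bounded_op_linear[OF powB]]] funpow_add)
    qed
    then have "R (R x) = S"
      using R has_sum_unique by blast
    moreover have "S = x - B x"
    proof (rule has_sum_unique)
      have fib: "{z \<in> UNIV \<times> UNIV. fst z + snd z = r} = (\<lambda>i. (i, r - i)) ` {..r}" for r :: nat
        by (auto simp: image_iff intro: bexI[of _ "fst z" for z])
      show "((\<lambda>r. \<Sum>z\<in>{z \<in> UNIV \<times> UNIV. fst z + snd z = r}. ?F z) has_sum S) UNIV"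
        by (rule has_sum_fibers[OF S]) (simp, simp only: fib finite_imageI finite_atMost)
      have "(\<Sum>z\<in>{z \<in> UNIV \<times> UNIV. fst z + snd z = r}. ?F z) =
          (if r = 0 then 1 else if r = 1 then -1 else 0) *\<^sub>R (B ^^ r) x" for r
      proof -
        have "inj_on (\<lambda>i. (i, r - i)) {..r}"
          by (rule inj_onI) simp
        then have "(\<Sum>z\<in>{z \<in> UNIV \<times> UNIV. fst z + snd z = r}. ?F z) =
            (\<Sum>i\<le>r. (c i * c (r - i)) *\<^sub>R (B ^^ r) x)"
          unfolding fib by (simp add: sum.reindex)
        then show ?thesis
          by (simp only: sqrt_coeff_conv c_def flip: scaleR_left.sum)
      qed
      moreover have "((\<lambda>r. (if r = 0 then 1 else if r = 1 then -1 else 0) *\<^sub>R (B ^^ r) x)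
          has_sum (x - B x)) UNIV"
        by (rule has_sum_finite_neutralI[of "{0, 1}"]) auto
      ultimately show "((\<lambda>r. \<Sum>z\<in>{z \<in> UNIV \<times> UNIV. fst z + snd z = r}. ?F z) has_sum (x - B x)) UNIV"
        by simp
    qed
    ultimately show ?thesis by simp
  qed
  ultimately show ?thesis
    using that by blast
qed

text \<open>With a norm bound \<open>M\<close> of \<open>A\<close>, the operator
  \<open>I - A / M\<close> is a contraction because of \<open>positive_op_norm_square_le\<close>, so
  the binomial series applies to it; the factor \<open>sqrt M\<close> undoes the scaling.\<close>

lemma positive_op_square_root:
  assumes A: "positive_op A"
  obtains R where "bounded_op R" "\<And>x y. cinner (R x) y = cinner x (R y)" "R \<circ> R = A"
proof -
  have bA: "bounded_op A" by (rule positive_op_bounded[OF A])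
  then obtain M where M: "0 < M" "\<And>x. norm (A x) \<le> M * norm x"
    using bounded_op_bound by blast
  interpret bounded_linear A by (rule bounded_op_linear[OF bA])
  define B where "B x = x - inverse M *\<^sub>R A x" for x
  have bB: "bounded_op B"
    unfolding B_def scaleC_of_real[symmetric]
    by (intro bounded_op_diff bounded_op_cmult bA bounded_op_id[unfolded id_def])
  have sa: "cinner (B x) y = cinner x (B y)" for x y
    by (simp add: B_def cinner.diff_left cinner.diff_right cinner_scaleR_left cinner_scaleR_right
        positive_op_selfadjoint[OF A])
  have "norm (B x) \<le> norm x" for x
  proof (rule power2_le_imp_le)
    define r where "r = Re (cinner (A x) x)"
    have "inner x (A x) = r" "inner (A x) x = r"
      by (simp_all add: r_def inner_eq_Re_cinner positive_op_selfadjoint[OF A, of x x])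
    then have "(norm (B x))\<^sup>2 = (norm x)\<^sup>2 - 2 * inverse M * r + (inverse M)\<^sup>2 * (norm (A x))\<^sup>2"
      unfolding power2_norm_eq_inner
      by (simp add: B_def inner_diff_left inner_diff_right power2_eq_square right_diff_distrib)
    also have "\<dots> \<le> (norm x)\<^sup>2 - 2 * inverse M * r + (inverse M)\<^sup>2 * (M * r)"
      using mult_left_mono[OF positive_op_norm_square_le[OF A M, of x], of "(inverse M)\<^sup>2"]
      by (simp add: r_def)
    also have "\<dots> = (norm x)\<^sup>2 - inverse M * r"
      using M(1) by (simp add: power2_eq_square)
    also have "\<dots> \<le> (norm x)\<^sup>2"
      using positive_op_form_nonneg[OF A, of x] M(1) by (simp add: r_def)
    finally show "(norm (B x))\<^sup>2 \<le> (norm x)\<^sup>2" .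
  qed simp
  from sqrt_of_one_minus_contraction[OF bB this sa] obtain R where
    R: "bounded_op R" "\<And>x y. cinner (R x) y = cinner x (R y)" "\<And>x. R (R x) = x - B x" by blast
  define R' where "R' x = of_real (sqrt M) *\<^sub>C R x" for x
  have "bounded_op R'"
    unfolding R'_def by (rule bounded_op_cmult[OF R(1)])
  moreover have "cinner (R' x) y = cinner x (R' y)" for x y
    by (simp add: R'_def cinner_scaleC_left cinner_scaleC_right R(2))
  moreover have "R' (R' x) = A x" for x
  proof -
    have "of_real (sqrt M) * of_real (sqrt M) = complex_of_real M"
      using M(1) by (simp flip: of_real_mult)
    then have "R' (R' x) = complex_of_real M *\<^sub>C (x - B x)"
      by (simp only: R'_def bounded_op_scaleC[OF R(1)] scaleC_scaleC R(3))
    then show ?thesis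
      using M(1) by (simp add: B_def scaleC_of_real)
  qed
  ultimately show ?thesis
    using that[of R'] by (auto simp: fun_eq_iff)
qed

lemma csubspace_range: "bounded_op A \<Longrightarrow> csubspace (range A)"
  using bounded_linear.linear[OF bounded_op_linear, of A]
  by (intro complex_vector.subspaceI)
    (auto simp: image_iff linear_0 simp flip: bounded_op_add bounded_op_scaleC
      intro: exI[of _ 0] dest: linear_0)

text \<open>A vector \<open>w\<close> orthogonal to the range of \<open>R \<circ> R\<close>
  satisfies \<open>cinner w (R (R w)) = 0\<close>, that is \<open>R w = 0\<close>, so it is
  orthogonal to the range of \<open>R\<close>. This identifies the closed ranges of a positive
  defect and of its root.\<close>

lemma closure_range_square:
  assumes R: "bounded_op R" "\<And>x y. cinner (R x) y = cinner x (R y)"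
  shows "closure (range (R \<circ> R)) = closure (range R)"
proof
  show "closure (range (R \<circ> R)) \<subseteq> closure (range R)"
    by (intro closure_mono) auto
  let ?M = "closure (range (R \<circ> R))"
  have "range R \<subseteq> ?M"
  proof clarify
    fix x
    show "R x \<in> ?M"
    proof (rule mem_closed_csubspaceI)
      show "csubspace ?M"
        by (intro csubspace_closure csubspace_range bounded_op_comp R)
      fix w assume w: "\<And>z. z \<in> ?M \<Longrightarrow> cinner w z = 0"
      have "cinner w (R (R w)) = 0"
        using closure_subset by (intro w) fastforce
      then have "R w = 0"
        by (metis R(2) cinner_eq_zero_iff)
      then show "cinner w (R x) = 0"
        by (metis R(2) cinner.zero_left)
    qed simp
  qed
  then show "closure (range R) \<subseteq> ?M"
    by (rule closure_minimal) simp
qed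

section \<open>Convolution on the free monoid\<close>

definition splits :: "'a list \<Rightarrow> ('a list \<times> 'a list) set"
  where "splits \<alpha> = {(\<beta>, \<gamma>). \<beta> @ \<gamma> = \<alpha>}"

text \<open>Coefficients of the product of two formal power series in noncommuting
  indeterminates.\<close>

definition word_conv :: "('a list \<Rightarrow> real) \<Rightarrow> ('a list \<Rightarrow> real) \<Rightarrow> 'a list \<Rightarrow> real"
  where "word_conv f g \<alpha> = (\<Sum>(\<beta>, \<gamma>)\<in>splits \<alpha>. f \<beta> * g \<gamma>)"

lemma splits_Nil: "splits [] = {([], [])}"
  by (auto simp: splits_def)

lemma splits_Cons: "splits (x # \<alpha>) = insert ([], x # \<alpha>) ((\<lambda>(\<beta>, \<gamma>). (x # \<beta>, \<gamma>)) ` splits \<alpha>)"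
  by (auto simp: splits_def Cons_eq_append_conv append_eq_Cons_conv image_iff)

lemma finite_splits [simp]: "finite (splits \<alpha>)"
  by (induction \<alpha>) (auto simp: splits_Nil splits_Cons)

lemma splits_lists: "z \<in> splits \<alpha> \<Longrightarrow> \<alpha> \<in> lists A \<Longrightarrow> fst z \<in> lists A \<and> snd z \<in> lists A"
  by (auto simp: splits_def)

lemma word_conv_Nil: "word_conv f g [] = f [] * g []"
  by (simp add: word_conv_def splits_Nil)

lemma word_conv_Cons: "word_conv f g (x # \<alpha>) = f [] * g (x # \<alpha>) + word_conv (\<lambda>\<beta>. f (x # \<beta>)) g \<alpha>"
proof -
  have "inj_on (\<lambda>(\<beta>, \<gamma>). (x # \<beta>, \<gamma>)) (splits \<alpha>)"
    by (auto simp: inj_on_def)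
  then show ?thesis
    unfolding word_conv_def splits_Cons
    by (subst sum.insert) (auto simp: sum.reindex case_prod_unfold)
qed

lemma word_conv_add_left: "word_conv (\<lambda>\<beta>. f \<beta> + f' \<beta>) g \<alpha> = word_conv f g \<alpha> + word_conv f' g \<alpha>"
  by (simp add: word_conv_def case_prod_unfold distrib_right sum.distrib)

lemma word_conv_cmult_left: "word_conv (\<lambda>\<beta>. c * f \<beta>) g \<alpha> = c * word_conv f g \<alpha>"
  by (simp add: word_conv_def case_prod_unfold mult.assoc sum_distrib_left)

lemma word_conv_cmult_right: "word_conv f (\<lambda>\<gamma>. c * g \<gamma>) \<alpha> = c * word_conv f g \<alpha>"
  by (simp add: word_conv_def case_prod_unfold ac_simps sum_distrib_left)

lemma word_conv_sum_right:
  "word_conv f (\<lambda>\<gamma>. \<Sum>i\<in>I. g i \<gamma>) \<alpha> = (\<Sum>i\<in>I. word_conv f (g i) \<alpha>)"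
  unfolding word_conv_def case_prod_unfold sum_distrib_left by (rule sum.swap)

text \<open>Peeling off the first letter replaces \<open>f\<close> by its left shift, up to a scalar
  term, so the induction has to run over all \<open>f\<close>.\<close>

lemma word_conv_assoc: "word_conv (word_conv f g) h \<alpha> = word_conv f (word_conv g h) \<alpha>"
proof (induction \<alpha> arbitrary: f)
  case (Cons x \<alpha>)
  have "word_conv (word_conv f g) h (x # \<alpha>) =
      f [] * (g [] * h (x # \<alpha>) + word_conv (\<lambda>\<beta>. g (x # \<beta>)) h \<alpha>) +
      word_conv (word_conv (\<lambda>\<beta>. f (x # \<beta>)) g) h \<alpha>"
    unfolding word_conv_Cons word_conv_Nil word_conv_add_left word_conv_cmult_left
    by (simp add: algebra_simps)
  then show ?case
    by (simp only: Cons.IH word_conv_Cons)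
qed (simp add: word_conv_Nil)

lemma word_conv_nonneg:
  "(\<And>\<beta>. \<beta> \<in> lists A \<Longrightarrow> 0 \<le> f \<beta>) \<Longrightarrow> (\<And>\<gamma>. \<gamma> \<in> lists A \<Longrightarrow> 0 \<le> g \<gamma>) \<Longrightarrow> \<alpha> \<in> lists A \<Longrightarrow>
    0 \<le> word_conv f g \<alpha>"
  unfolding word_conv_def case_prod_unfold
  by (intro sum_nonneg mult_nonneg_nonneg) (blast dest: splits_lists)+

lemma word_conv_mono_right:
  "(\<And>\<beta>. \<beta> \<in> lists A \<Longrightarrow> 0 \<le> f \<beta>) \<Longrightarrow> (\<And>\<gamma>. \<gamma> \<in> lists A \<Longrightarrow> g \<gamma> \<le> h \<gamma>) \<Longrightarrow> \<alpha> \<in> lists A \<Longrightarrow>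
    word_conv f g \<alpha> \<le> word_conv f h \<alpha>"
  unfolding word_conv_def case_prod_unfold
  by (intro sum_mono mult_left_mono) (blast dest: splits_lists)+

lemma word_conv_le:
  assumes "\<And>\<beta>. \<beta> \<in> lists A \<Longrightarrow> 0 \<le> f \<beta>" "\<And>\<gamma>. \<gamma> \<in> lists A \<Longrightarrow> 0 \<le> g \<gamma>" "\<beta> @ \<gamma> \<in> lists A"
  shows "f \<beta> * g \<gamma> \<le> word_conv f g (\<beta> @ \<gamma>)"
proof -
  have "0 \<le> (case z of (\<beta>, \<gamma>) \<Rightarrow> f \<beta> * g \<gamma>)" if "z \<in> splits (\<beta> @ \<gamma>)" for z
  proof (cases z)
    case (Pair \<beta>' \<gamma>')
    then have "\<beta>' @ \<gamma>' \<in> lists A"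
      using that assms(3) by (simp add: splits_def)
    then show ?thesis
      using assms(1,2) Pair by simp
  qed
  moreover have "(\<beta>, \<gamma>) \<in> splits (\<beta> @ \<gamma>)"
    by (simp add: splits_def)
  ultimately show ?thesis
    unfolding word_conv_def
    using member_le_sum[of "(\<beta>, \<gamma>)" "splits (\<beta> @ \<gamma>)" "\<lambda>(\<beta>, \<gamma>). f \<beta> * g \<gamma>"] by simp
qed

text \<open>Without a constant term in \<open>f\<close>, the second factor only matters on strictly
  shorter words. The inductions on length rest on this.\<close>

lemma word_conv_cong_shorter:
  assumes "f [] = 0" "\<And>\<gamma>. length \<gamma> < length \<alpha> \<Longrightarrow> g \<gamma> = h \<gamma>"
  shows "word_conv f g \<alpha> = word_conv f h \<alpha>"
  unfolding word_conv_def
proof (rule sum.cong)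
  fix z assume z: "z \<in> splits \<alpha>"
  show "(case z of (\<beta>, \<gamma>) \<Rightarrow> f \<beta> * g \<gamma>) = (case z of (\<beta>, \<gamma>) \<Rightarrow> f \<beta> * h \<gamma>)"
    using assms z by (cases "fst z = []") (auto simp: splits_def)
qed simp

definition word_unit :: "'a list \<Rightarrow> real"
  where "word_unit \<alpha> = (if \<alpha> = [] then 1 else 0)"

lemma word_conv_unit_left: "word_conv word_unit g \<alpha> = g \<alpha>"
proof (cases \<alpha>)
  case (Cons x \<beta>)
  have "word_conv (\<lambda>\<beta>. word_unit (x # \<beta>)) g \<beta> = 0"
    using word_conv_cmult_left[of 0 "\<lambda>_. 0" g \<beta>] by (simp add: word_unit_def)
  then show ?thesis
    by (simp add: Cons word_conv_Cons) (simp add: word_unit_def)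
qed (simp add: word_conv_Nil word_unit_def)

text \<open>In formal series \<open>1 - f\<close> is invertible: the value of a solution at a word
  is determined by its values at shorter words.\<close>

lemma word_conv_fixpoint_unique:
  assumes f: "f [] = 0" and h: "\<And>\<alpha>. h \<alpha> = g \<alpha> + word_conv f h \<alpha>"
    and h': "\<And>\<alpha>. h' \<alpha> = g \<alpha> + word_conv f h' \<alpha>"
  shows "h \<alpha> = h' \<alpha>"
proof (induction \<alpha> rule: measure_induct_rule[of length])
  case (less \<alpha>)
  have "word_conv f h \<alpha> = word_conv f h' \<alpha>"
    by (rule word_conv_cong_shorter[of f]) (use f less.IH in auto)
  then show ?case using h h' by metis
qed

section \<open>Convolution powers and the weights of the model\<close>

primrec word_pow :: "('a list \<Rightarrow> real) \<Rightarrow> nat \<Rightarrow> 'a list \<Rightarrow> real"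
  where "word_pow a 0 = word_unit"
  | "word_pow a (Suc p) = word_conv a (word_pow a p)"

lemma word_pow_nonneg:
  "(\<And>\<beta>. \<beta> \<in> lists A \<Longrightarrow> 0 \<le> a \<beta>) \<Longrightarrow> \<alpha> \<in> lists A \<Longrightarrow> 0 \<le> word_pow a p \<alpha>"
  by (induction p arbitrary: \<alpha>) (simp_all add: word_unit_def word_conv_nonneg[of A] del: in_lists_conv_set)

lemma word_conv_shift_support:
  assumes "a [] = 0" "\<And>\<gamma>. length \<gamma> < p \<Longrightarrow> g \<gamma> = 0" "length \<alpha> < Suc p"
  shows "word_conv a g \<alpha> = 0"
proof -
  have "word_conv a g \<alpha> = word_conv a (\<lambda>_. 0) \<alpha>"
    by (rule word_conv_cong_shorter) (use assms in auto)
  then show ?thesis by (simp add: word_conv_def)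
qed

lemma word_pow_short: "a [] = 0 \<Longrightarrow> length \<alpha> < p \<Longrightarrow> word_pow a p \<alpha> = 0"
proof (induction p arbitrary: \<alpha>)
  case (Suc p)
  then show ?case using word_conv_shift_support[of a p "word_pow a p" \<alpha>] by simp
qed simp

text \<open>Identifies the inner sums of \<open>fock_weight\<close> with convolution powers: the
  first block of a composition is a split of the word, and the rest is a composition of the
  remainder.\<close>

lemma sum_compositions:
  fixes a :: "'a list \<Rightarrow> real"
  assumes a: "a [] = 0"
  defines "C \<equiv> \<lambda>p \<alpha>. {\<gamma>s. length \<gamma>s = p \<and> concat \<gamma>s = \<alpha> \<and> [] \<notin> set \<gamma>s}"
  shows "finite (C p \<alpha>) \<and> (\<Sum>\<gamma>s\<in>C p \<alpha>. prod_list (map a \<gamma>s)) = word_pow a p \<alpha>"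
proof (induction p arbitrary: \<alpha>)
  case 0
  have "C 0 \<alpha> = (if \<alpha> = [] then {[]} else {})"
    by (auto simp: C_def)
  then show ?case by (simp add: word_unit_def)
next
  case (Suc p)
  \<comment> \<open>Blocks are nonempty, whereas \<open>word_conv\<close> also has the split with
    empty first part; that one contributes nothing since \<open>a [] = 0\<close>.\<close>
  define S where "S = {z \<in> splits \<alpha>. fst z \<noteq> []}"
  have fS: "finite S" by (simp add: S_def)
  have C: "C (Suc p) \<alpha> = (\<lambda>(z, \<gamma>s). fst z # \<gamma>s) ` (SIGMA z:S. C p (snd z))"
    by (auto simp: C_def S_def splits_def length_Suc_conv image_iff)
  have inj: "inj_on (\<lambda>(z, \<gamma>s). fst z # \<gamma>s) (SIGMA z:S. C p (snd z))"
    by (auto simp: inj_on_def S_def splits_def)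
  have "(\<Sum>\<gamma>s\<in>C (Suc p) \<alpha>. prod_list (map a \<gamma>s)) =
      (\<Sum>(z, \<gamma>s)\<in>(SIGMA z:S. C p (snd z)). a (fst z) * prod_list (map a \<gamma>s))"
    unfolding C by (subst sum.reindex[OF inj]) (simp add: case_prod_unfold)
  also have "\<dots> = (\<Sum>z\<in>S. a (fst z) * word_pow a p (snd z))"
    using Suc.IH fS by (subst sum.Sigma[symmetric]) (auto simp flip: sum_distrib_left)
  also have "\<dots> = word_conv a (word_pow a p) \<alpha>"
    unfolding word_conv_def case_prod_unfold
    by (rule sum.mono_neutral_left) (auto simp: S_def a)
  finally show ?case
    using Suc.IH fS by (simp add: C)
qed

text \<open>\<open>weight_seq a m\<close> is \<open>(1 - a)\<^sup>-\<^sup>m\<close> for the convolution product.\<close>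

definition weight_seq :: "(nat list \<Rightarrow> real) \<Rightarrow> nat \<Rightarrow> nat list \<Rightarrow> real"
  where "weight_seq a m = (if m = 0 then word_unit else fock_weight a m)"

text \<open>The binomial series of \<open>1 - a\<close> to the exponent \<open>-(m + 1)\<close>, cut
  off where the powers vanish at \<open>\<alpha>\<close>. The bound \<open>L\<close> is left free so
  that words of different lengths can share one range of summation.\<close>

lemma weight_seq_Suc_sum:
  assumes a: "a [] = 0" and L: "length \<alpha> \<le> L"
  shows "weight_seq a (Suc m) \<alpha> = (\<Sum>p\<le>L. real ((p + m) choose m) * word_pow a p \<alpha>)"
proof -
  have "weight_seq a (Suc m) \<alpha> = (\<Sum>p\<le>length \<alpha>. real ((p + m) choose m) * word_pow a p \<alpha>)"
  proof (cases "\<alpha> = []")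
    case False
    have "weight_seq a (Suc m) \<alpha> =
        (\<Sum>p = 1..length \<alpha>. real ((p + m) choose m) * word_pow a p \<alpha>)"
      using False
      by (simp add: weight_seq_def fock_weight_def sum_compositions[of a, OF a, THEN conjunct2] mult.commute
          flip: sum_distrib_right)
    also have "\<dots> = (\<Sum>p\<le>length \<alpha>. real ((p + m) choose m) * word_pow a p \<alpha>)"
    proof (rule sum.mono_neutral_left)
      show "\<forall>p\<in>{..length \<alpha>} - {1..length \<alpha>}. real ((p + m) choose m) * word_pow a p \<alpha> = 0"
      proof
        fix p assume "p \<in> {..length \<alpha>} - {1..length \<alpha>}"
        then have "p = 0" by auto
        then show "real ((p + m) choose m) * word_pow a p \<alpha> = 0"
          using False by (simp add: word_unit_def)
      qed
    qed auto
    finally show ?thesis .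
  qed (simp add: weight_seq_def fock_weight_def word_unit_def)
  also have "\<dots> = (\<Sum>p\<le>L. real ((p + m) choose m) * word_pow a p \<alpha>)"
    by (rule sum.mono_neutral_left) (use L word_pow_short[of a, OF a] in auto)
  finally show ?thesis .
qed

text \<open>Comparing the coefficients of the powers of \<open>a\<close>, this is Pascal's
  rule.\<close>

lemma weight_seq_rec:
  assumes a: "a [] = 0"
  shows "weight_seq a (Suc m) \<alpha> = weight_seq a m \<alpha> + word_conv a (weight_seq a (Suc m)) \<alpha>"
proof -
  define L where "L = length \<alpha>"
  have "word_conv a (weight_seq a (Suc m)) \<alpha> =
      word_conv a (\<lambda>\<gamma>. \<Sum>p\<le>L. real ((p + m) choose m) * word_pow a p \<gamma>) \<alpha>"
    by (rule word_conv_cong_shorter[of a, OF a]) (simp add: weight_seq_Suc_sum[of a, OF a] L_def)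
  also have "\<dots> = (\<Sum>p\<le>L. real ((p + m) choose m) * word_pow a (Suc p) \<alpha>)"
    by (simp add: word_conv_sum_right word_conv_cmult_right)
  finally have 1: "word_conv a (weight_seq a (Suc m)) \<alpha> =
      (\<Sum>p\<le>L. real ((p + m) choose m) * word_pow a (Suc p) \<alpha>)" .
  have 2: "weight_seq a (Suc m) \<alpha> =
      word_pow a 0 \<alpha> + (\<Sum>p\<le>L. real ((Suc p + m) choose m) * word_pow a (Suc p) \<alpha>)"
    by (subst weight_seq_Suc_sum[of a, OF a, where L = "Suc L"]) (simp add: L_def, simp add: sum.atMost_Suc_shift del: sum.atMost_Suc)
  show ?thesis
  proof (cases m)
    \<comment> \<open>Order 0 has to be the unit: with truncated subtraction
      \<open>fock_weight a 0\<close> would agree with order 1.\<close>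
    case 0
    then show ?thesis
      unfolding 1 2 by (simp add: weight_seq_def)
  next
    case (Suc m')
    have "weight_seq a m \<alpha> =
        word_pow a 0 \<alpha> + (\<Sum>p\<le>L. real ((Suc p + m') choose m') * word_pow a (Suc p) \<alpha>)"
      unfolding Suc
      by (subst weight_seq_Suc_sum[of a, OF a, where L = "Suc L"]) (simp add: L_def, simp add: sum.atMost_Suc_shift del: sum.atMost_Suc)
    then show ?thesis
      unfolding 1 2 by (simp add: Suc algebra_simps sum.distrib)
  qed
qed

text \<open>Both sides solve the fixed point equation of \<open>weight_seq_rec\<close>. Splitting
  off exponent 1 on the left lets \<open>id - \<Phi>\<close> be inverted one order at a
  time.\<close>

lemma weight_seq_conv:
  assumes a: "a [] = 0"
  shows "weight_seq a (Suc m) \<alpha> = word_conv (weight_seq a 1) (weight_seq a m) \<alpha>"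
proof (rule word_conv_fixpoint_unique[where f = a and h = "weight_seq a (Suc m)", OF a])
  show "weight_seq a (Suc m) \<alpha> = weight_seq a m \<alpha> + word_conv a (weight_seq a (Suc m)) \<alpha>" for \<alpha>
    by (rule weight_seq_rec[of a, OF a])
  fix \<alpha>
  have "weight_seq a 1 = (\<lambda>\<beta>. word_unit \<beta> + word_conv a (weight_seq a 1) \<beta>)"
    using weight_seq_rec[of a 0, OF a] by (auto simp: weight_seq_def)
  then have "word_conv (weight_seq a 1) (weight_seq a m) \<alpha> =
      word_conv (\<lambda>\<beta>. word_unit \<beta> + word_conv a (weight_seq a 1) \<beta>) (weight_seq a m) \<alpha>"
    by simp
  also have "\<dots> = weight_seq a m \<alpha> + word_conv a (word_conv (weight_seq a 1) (weight_seq a m)) \<alpha>"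
    by (simp add: word_conv_add_left word_conv_unit_left word_conv_assoc)
  finally show "word_conv (weight_seq a 1) (weight_seq a m) \<alpha> =
      weight_seq a m \<alpha> + word_conv a (word_conv (weight_seq a 1) (weight_seq a m)) \<alpha>" .
qed

lemma weight_seq_nonneg:
  assumes "a [] = 0" "\<And>\<beta>. \<beta> \<in> lists A \<Longrightarrow> 0 \<le> a \<beta>" "\<alpha> \<in> lists A"
  shows "0 \<le> weight_seq a m \<alpha>"
proof (cases m)
  case (Suc m')
  show ?thesis
    unfolding Suc weight_seq_Suc_sum[of a, OF assms(1) order_refl]
    by (intro sum_nonneg mult_nonneg_nonneg word_pow_nonneg[of A a]) (use assms in auto)
qed (simp add: weight_seq_def word_unit_def)

text \<open>The split of \<open>j # \<alpha>\<close> into \<open>[j]\<close> and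
  \<open>\<alpha>\<close> is one of the nonnegative terms in the convolution of
  \<open>weight_seq_rec\<close>. Positivity of the weights and boundedness of the creation operators
  both follow.\<close>

lemma fock_weight_Cons_ge:
  assumes f: "positive_regular n a" and m: "1 \<le> m" and \<alpha>: "\<alpha> \<in> lists {1..n}" and j: "j \<in> {1..n}"
  shows "a [j] * fock_weight a m \<alpha> \<le> fock_weight a m (j # \<alpha>)"
proof -
  obtain m' where m': "m = Suc m'" using m by (cases m) auto
  have a: "a [] = 0" "\<And>\<beta>. \<beta> \<in> lists {1..n} \<Longrightarrow> 0 \<le> a \<beta>"
    using f by (auto simp: positive_regular_def)
  have "a [j] * weight_seq a m \<alpha> \<le> word_conv a (weight_seq a m) ([j] @ \<alpha>)"
    by (rule word_conv_le[where A = "{1..n}"]) (use a weight_seq_nonneg[of a "{1..n}", OF a] \<alpha> j in auto)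
  also have "\<dots> \<le> weight_seq a m (j # \<alpha>)"
    unfolding m' using weight_seq_rec[of a m' "j # \<alpha>", OF a(1)] weight_seq_nonneg[of a "{1..n}" "j # \<alpha>" m', OF a] \<alpha> j
    by simp
  finally show ?thesis
    by (simp add: m' weight_seq_def)
qed

lemma fock_weight_pos:
  assumes f: "positive_regular n a" and m: "1 \<le> m" and \<alpha>: "\<alpha> \<in> lists {1..n}"
  shows "0 < fock_weight a m \<alpha>"
  using \<alpha>
proof (induction \<alpha>)
  case (Cons j \<alpha>)
  have "0 < a [j] * fock_weight a m \<alpha>"
    using f Cons by (simp add: positive_regular_def)
  then show ?case
    using fock_weight_Cons_ge[OF f m Cons.hyps(2) Cons.hyps(1)] by simp
qed (simp add: fock_weight_def)

text \<open>The iterated sum over two words is regrouped by their concatenation, whose fibres are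
  the finite sets \<open>splits \<alpha>\<close>. In this way compositions of completely positive
  maps become convolutions of coefficients.\<close>

lemma has_sum_word_conv:
  fixes f g Q :: "'a list \<Rightarrow> real"
  assumes "\<And>\<beta>. \<beta> \<in> lists A \<Longrightarrow> 0 \<le> f \<beta>" "\<And>\<gamma>. \<gamma> \<in> lists A \<Longrightarrow> 0 \<le> g \<gamma>"
    and Q: "\<And>\<alpha>. \<alpha> \<in> lists A \<Longrightarrow> 0 \<le> Q \<alpha>"
    and P: "\<And>\<beta>. \<beta> \<in> lists A \<Longrightarrow> ((\<lambda>\<gamma>. g \<gamma> * Q (\<beta> @ \<gamma>)) has_sum P \<beta>) (lists A)"
    and S: "((\<lambda>\<beta>. f \<beta> * P \<beta>) has_sum S) (lists A)"
  shows "((\<lambda>\<alpha>. word_conv f g \<alpha> * Q \<alpha>) has_sum S) (lists A)"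
proof -
  let ?L = "lists A" and ?F = "\<lambda>(\<beta>, \<gamma>). f \<beta> * (g \<gamma> * Q (\<beta> @ \<gamma>))"
  have "(?F has_sum S) (?L \<times> ?L)"
    by (rule has_sum_Times_nonneg[OF has_sum_cmult_right[OF P] S]) (use assms in auto)
  moreover have fib: "{p \<in> ?L \<times> ?L. (case p of (\<beta>, \<gamma>) \<Rightarrow> \<beta> @ \<gamma>) = \<alpha>} = splits \<alpha>" if "\<alpha> \<in> ?L" for \<alpha>
    using that by (auto simp: splits_def)
  ultimately have "((\<lambda>\<alpha>. \<Sum>p\<in>{p \<in> ?L \<times> ?L. (case p of (\<beta>, \<gamma>) \<Rightarrow> \<beta> @ \<gamma>) = \<alpha>}. ?F p) has_sum S) ?L"
    by (intro has_sum_fibers) auto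
  then show ?thesis
  proof (rule has_sum_cong[THEN iffD1, rotated])
    fix \<alpha> assume "\<alpha> \<in> ?L"
    then show "(\<Sum>p\<in>{p \<in> ?L \<times> ?L. (case p of (\<beta>, \<gamma>) \<Rightarrow> \<beta> @ \<gamma>) = \<alpha>}. ?F p) = word_conv f g \<alpha> * Q \<alpha>"
      unfolding fib[OF \<open>\<alpha> \<in> ?L\<close>] word_conv_def sum_distrib_right
      by (intro sum.cong) (auto simp: splits_def)
  qed
qed

section \<open>Completely positive maps of row tuples\<close>

declare One_nat_def [simp del]

lemma word_op_Nil [simp]: "word_op X [] = id"
  by (simp add: word_op_def)

lemma word_op_Cons [simp]: "word_op X (j # \<alpha>) = X j \<circ> word_op X \<alpha>"
  by (simp add: word_op_def)

lemma word_op_append: "word_op X (\<alpha> @ \<beta>) = word_op X \<alpha> \<circ> word_op X \<beta>"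
  by (induction \<alpha>) (simp_all add: o_assoc)

lemma bounded_word_op:
  "(\<And>j. j \<in> A \<Longrightarrow> bounded_op (X j)) \<Longrightarrow> \<alpha> \<in> lists A \<Longrightarrow> bounded_op (word_op X \<alpha>)"
  by (induction \<alpha>) (auto simp: bounded_op_id intro: bounded_op_comp)

abbreviation qform :: "('a::complex_hilbert_space \<Rightarrow> 'a) \<Rightarrow> 'a \<Rightarrow> real"
  where "qform Y x \<equiv> Re (cinner (Y x) x)"

lemma positive_opI:
  "bounded_op Y \<Longrightarrow> (\<And>x. cinner (Y x) x = of_real (r x)) \<Longrightarrow> (\<And>x. 0 \<le> r x) \<Longrightarrow> positive_op Y"
  unfolding positive_op_def by auto

lemma positive_op_id: "positive_op id"
  by (rule positive_opI[of _ "\<lambda>x. (norm x)\<^sup>2"]) (simp_all add: bounded_op_id cinner_self)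

locale row =
  fixes n :: nat and a :: "nat list \<Rightarrow> real" and X :: "nat \<Rightarrow> 'h \<Rightarrow> 'h::complex_hilbert_space"
  assumes a_nonneg: "\<And>\<alpha>. \<alpha> \<in> lists {1..n} \<Longrightarrow> 0 \<le> a \<alpha>"
    and a_Nil: "a [] = 0"
    and bounded_X: "\<And>j. j \<in> {1..n} \<Longrightarrow> bounded_op (X j)"
    and well_defined: "phi_well_defined n a X"
begin

abbreviation words :: "nat list set"
  where "words \<equiv> lists {1..n}"

abbreviation Xs :: "nat list \<Rightarrow> 'h \<Rightarrow> 'h"
  where "Xs \<alpha> \<equiv> cadjoint (word_op X \<alpha>)"

abbreviation \<Phi> :: "('h \<Rightarrow> 'h) \<Rightarrow> 'h \<Rightarrow> 'h"
  where "\<Phi> \<equiv> phi n a X"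

lemma bounded_word: "\<alpha> \<in> words \<Longrightarrow> bounded_op (word_op X \<alpha>)"
  using bounded_word_op bounded_X by blast

lemma bounded_Xs: "\<alpha> \<in> words \<Longrightarrow> bounded_op (Xs \<alpha>)"
  by (intro bounded_op_cadjoint bounded_word)

lemma Xs_append: "\<alpha> \<in> words \<Longrightarrow> \<beta> \<in> words \<Longrightarrow> Xs (\<alpha> @ \<beta>) x = Xs \<beta> (Xs \<alpha> x)"
  by (simp add: word_op_append cadjoint_comp bounded_word del: in_lists_conv_set)

lemma cinner_phi_term:
  "\<alpha> \<in> words \<Longrightarrow> cinner (phi_term a X Y \<alpha> x) y = of_real (a \<alpha>) * cinner (Y (Xs \<alpha> x)) (Xs \<alpha> y)"
  by (simp add: phi_term_def cinner_scaleR_left cinner_cadjoint[OF bounded_word])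

text \<open>Well-definedness means that the series at the identity sums to a bounded operator
  \<open>P\<close>, whose quadratic form is the Gram series; \<open>M\<close> is a norm bound of
  \<open>P\<close>.\<close>

lemma gram_bound:
  obtains M where "0 < M" "\<And>x. (\<lambda>\<alpha>. a \<alpha> * (norm (Xs \<alpha> x))\<^sup>2) summable_on words"
    "\<And>x. (\<Sum>\<^sub>\<infinity>\<alpha>\<in>words. a \<alpha> * (norm (Xs \<alpha> x))\<^sup>2) \<le> M * (norm x)\<^sup>2"
proof -
  obtain P where P: "bounded_op P"
    "\<And>x y. ((\<lambda>\<alpha>. cinner (phi_term a X id \<alpha> x) y) has_sum cinner (P x) y) words"
    using well_defined unfolding phi_well_defined_def wot_has_sum_def by blast
  obtain M where M: "0 < M" "\<And>x. norm (P x) \<le> M * norm x"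
    using bounded_op_bound[OF P(1)] by blast
  have sum: "((\<lambda>\<alpha>. a \<alpha> * (norm (Xs \<alpha> x))\<^sup>2) has_sum qform P x) words" for x
    by (rule has_sum_cong[THEN iffD1, OF _ has_sum_Re[OF P(2)[of x x]]])
      (simp add: cinner_phi_term cinner_self del: in_lists_conv_set)
  have "qform P x \<le> M * (norm x)\<^sup>2" for x
  proof -
    have "qform P x \<le> norm (P x) * norm x"
      using complex_Re_le_cmod cmod_cinner_le order_trans by blast
    also have "\<dots> \<le> M * (norm x)\<^sup>2"
      using mult_right_mono[OF M(2), of "norm x" x] by (simp add: power2_eq_square mult.assoc)
    finally show ?thesis .
  qed
  then show ?thesis
    by (intro that[OF M(1)] has_sum_imp_summable[OF sum]) (simp add: infsumI[OF sum])
qed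

text \<open>\<open>phi\<close> is a definite description, so its series has to be summed for each
  bounded \<open>Y\<close>: the Gram series dominates the matrix entries, and the limiting form is
  bounded, hence comes from an operator.\<close>

lemma wot_has_sum_phi:
  assumes Y: "bounded_op Y"
  shows "wot_has_sum (phi_term a X Y) words (\<Phi> Y)"
proof -
  obtain C where C: "0 < C" "\<And>x. norm (Y x) \<le> C * norm x"
    using bounded_op_bound[OF Y] by blast
  obtain M where M: "0 < M" "\<And>x. (\<lambda>\<alpha>. a \<alpha> * (norm (Xs \<alpha> x))\<^sup>2) summable_on words"
    "\<And>x. (\<Sum>\<^sub>\<infinity>\<alpha>\<in>words. a \<alpha> * (norm (Xs \<alpha> x))\<^sup>2) \<le> M * (norm x)\<^sup>2"
    using gram_bound by blast
  define t where "t x y \<alpha> = of_real (a \<alpha>) * cinner (Y (Xs \<alpha> x)) (Xs \<alpha> y)" for x y \<alpha>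
  define F where "F x y = infsum (t x y) words" for x y
  \<comment> \<open>Bounding a product of norms by a sum of squares gives a majorant made of the
    Gram series of \<open>x\<close> and of \<open>y\<close>.\<close>
  let ?g = "\<lambda>x y \<alpha>. C * (a \<alpha> * (norm (Xs \<alpha> x))\<^sup>2) + C * (a \<alpha> * (norm (Xs \<alpha> y))\<^sup>2)"
  have t_le: "norm (t x y \<alpha>) \<le> ?g x y \<alpha>" if \<alpha>: "\<alpha> \<in> words" for x y \<alpha>
  proof -
    let ?u = "norm (Xs \<alpha> x)" and ?v = "norm (Xs \<alpha> y)"
    have "cmod (cinner (Y (Xs \<alpha> x)) (Xs \<alpha> y)) \<le> C * ?u * ?v"
      by (rule order_trans[OF cmod_cinner_le]) (intro mult_right_mono C(2) norm_ge_zero)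
    also have "\<dots> \<le> C * (?u\<^sup>2 + ?v\<^sup>2)"
      using sum_squares_bound[of ?u ?v] C(1) zero_le_power2[of ?u] zero_le_power2[of ?v]
      by (simp add: mult.assoc) (smt (verit) norm_ge_zero mult_nonneg_nonneg)
    finally show ?thesis
      using mult_left_mono[OF _ a_nonneg[OF \<alpha>]] a_nonneg[OF \<alpha>]
      by (fastforce simp: t_def norm_mult algebra_simps)
  qed
  have g: "?g x y summable_on words" for x y
    by (intro summable_on_add summable_on_cmult_right M)
  have absum: "(\<lambda>\<alpha>. norm (t x y \<alpha>)) summable_on words" for x y
    by (rule summable_on_comparison_test[OF g t_le]) simp_all
  have t_sum: "(t x y has_sum F x y) words" for x y
    unfolding F_def by (rule has_sum_infsum[OF abs_summable_summable[OF absum]])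
  have F_le: "cmod (F x y) \<le> C * M * ((norm x)\<^sup>2 + (norm y)\<^sup>2)" for x y
  proof -
    have "cmod (F x y) \<le> infsum (?g x y) words"
      using norm_infsum_bound[OF absum] infsum_mono[OF absum g t_le] unfolding F_def by (rule order_trans)
    also have "\<dots> = C * (\<Sum>\<^sub>\<infinity>\<alpha>\<in>words. a \<alpha> * (norm (Xs \<alpha> x))\<^sup>2) + C * (\<Sum>\<^sub>\<infinity>\<alpha>\<in>words. a \<alpha> * (norm (Xs \<alpha> y))\<^sup>2)"
      by (subst infsum_add) (simp_all add: summable_on_cmult_right M(2) infsum_cmult_right')
    also have "\<dots> \<le> C * (M * (norm x)\<^sup>2) + C * (M * (norm y)\<^sup>2)"
      using C(1) M(3) by (intro add_mono mult_left_mono) auto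
    finally show ?thesis by (simp add: algebra_simps)
  qed
  have scale_left: "F (c *\<^sub>C x) y = c * F x y" for c x y
    by (rule has_sum_unique[OF t_sum], rule has_sum_cong[THEN iffD1, OF _ has_sum_cmult_right[OF t_sum]])
      (simp add: t_def bounded_op_scaleC[OF bounded_Xs] bounded_op_scaleC[OF Y] cinner_scaleC_left
        del: in_lists_conv_set)
  have scale_right: "F x (c *\<^sub>C y) = cnj c * F x y" for c x y
    by (rule has_sum_unique[OF t_sum], rule has_sum_cong[THEN iffD1, OF _ has_sum_cmult_right[OF t_sum]])
      (simp add: t_def bounded_op_scaleC[OF bounded_Xs] cinner_scaleC_right del: in_lists_conv_set)
  have "\<exists>Z. bounded_op Z \<and> (\<forall>x y. cinner (Z x) y = F x y)"
  proof (rule bounded_sesquilinear_form_op[of F "2 * C * M"])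
    show "F (x + x') y = F x y + F x' y" for x x' y
      by (rule has_sum_unique[OF t_sum], rule has_sum_cong[THEN iffD1, OF _ has_sum_add[OF t_sum t_sum]])
        (simp add: t_def bounded_op_add[OF bounded_Xs] bounded_op_add[OF Y] cinner_add_left distrib_left
          del: in_lists_conv_set)
    show "F x (y + y') = F x y + F x y'" for x y y'
      by (rule has_sum_unique[OF t_sum], rule has_sum_cong[THEN iffD1, OF _ has_sum_add[OF t_sum t_sum]])
        (simp add: t_def bounded_op_add[OF bounded_Xs] cinner_add_right distrib_left del: in_lists_conv_set)
    show "cmod (F x y) \<le> 2 * C * M * (norm x * norm y)" for x y
    proof (cases "x = 0 \<or> y = 0")
      case True
      then show ?thesis
        using scale_left[of 0 x y] scale_right[of x 0 y] by auto
    next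
      case False
      \<comment> \<open>\<open>F_le\<close> bounds \<open>F\<close> by a sum of squares; on unit
        vectors, homogeneity turns this into a bound by the product of norms.\<close>
      define x' y' where "x' = inverse (norm x) *\<^sub>R x" and "y' = inverse (norm y) *\<^sub>R y"
      have 1: "norm x' = 1" "norm y' = 1"
        using False by (simp_all add: x'_def y'_def)
      have "x = of_real (norm x) *\<^sub>C x'" "y = of_real (norm y) *\<^sub>C y'"
        using False by (simp_all add: x'_def y'_def scaleC_of_real)
      then have "F x y = of_real (norm x) * (of_real (norm y) * F x' y')"
        by (metis scale_left scale_right complex_cnj_complex_of_real)
      then have "cmod (F x y) = norm x * norm y * cmod (F x' y')"
        by (simp add: norm_mult)
      also have "\<dots> \<le> norm x * norm y * (C * M * 2)"
        using F_le[of x' y'] 1 by (intro mult_left_mono) auto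
      finally show ?thesis by (simp add: ac_simps)
    qed
  qed (use scale_left scale_right in blast)+
  then obtain Z where Z: "bounded_op Z" "\<And>x y. cinner (Z x) y = F x y" by blast
  have "((\<lambda>\<alpha>. cinner (phi_term a X Y \<alpha> x) y) has_sum cinner (Z x) y) words" for x y
    unfolding Z(2)
    by (rule has_sum_cong[THEN iffD1, OF _ t_sum]) (simp add: t_def cinner_phi_term del: in_lists_conv_set)
  then have Z_sum: "wot_has_sum (phi_term a X Y) words Z"
    using Z(1) unfolding wot_has_sum_def by blast
  moreover have "Z' = Z" if "wot_has_sum (phi_term a X Y) words Z'" for Z'
  proof
    fix x
    show "Z' x = Z x"
      using that Z_sum has_sum_unique unfolding wot_has_sum_def by (intro cinner_ext[of "Z' x"]) blast
  qed
  ultimately show ?thesis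
    unfolding phi_def by (rule theI)
qed

lemma bounded_phi: "bounded_op Y \<Longrightarrow> bounded_op (\<Phi> Y)"
  using wot_has_sum_phi unfolding wot_has_sum_def by blast

lemma phi_form:
  assumes "bounded_op Y"
  shows "((\<lambda>\<alpha>. of_real (a \<alpha>) * cinner (Y (Xs \<alpha> x)) (Xs \<alpha> y)) has_sum cinner (\<Phi> Y x) y) words"
proof -
  have "((\<lambda>\<alpha>. cinner (phi_term a X Y \<alpha> x) y) has_sum cinner (\<Phi> Y x) y) words"
    using wot_has_sum_phi[OF assms] unfolding wot_has_sum_def by blast
  then show ?thesis
    by (rule has_sum_cong[THEN iffD1, rotated]) (rule cinner_phi_term)
qed

lemma phi_diff:
  assumes "bounded_op Y" "bounded_op Z"
  shows "\<Phi> (\<lambda>x. Y x - Z x) = (\<lambda>x. \<Phi> Y x - \<Phi> Z x)"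
proof
  fix x
  show "\<Phi> (\<lambda>x. Y x - Z x) x = \<Phi> Y x - \<Phi> Z x"
  proof (rule cinner_ext, rule has_sum_unique[OF phi_form[OF bounded_op_diff[OF assms]]])
    fix y
    show "((\<lambda>\<alpha>. of_real (a \<alpha>) * cinner (Y (Xs \<alpha> x) - Z (Xs \<alpha> x)) (Xs \<alpha> y)) has_sum
        cinner (\<Phi> Y x - \<Phi> Z x) y) words"
      using has_sum_add[OF phi_form[OF assms(1)] has_sum_uminusI[OF phi_form[OF assms(2)]]]
      by (simp add: cinner.diff_left right_diff_distrib)
  qed
qed

lemma phi_qform:
  "bounded_op Y \<Longrightarrow> ((\<lambda>\<alpha>. a \<alpha> * qform Y (Xs \<alpha> x)) has_sum qform (\<Phi> Y) x) words"
  using has_sum_Re[OF phi_form[of Y x x]] by simp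

lemma positive_phi:
  assumes Y: "positive_op Y"
  shows "positive_op (\<Phi> Y)"
proof (rule positive_opI)
  note bY = positive_op_bounded[OF Y]
  show "bounded_op (\<Phi> Y)" by (rule bounded_phi[OF bY])
  show "cinner (\<Phi> Y x) x = of_real (qform (\<Phi> Y) x)" for x
  proof (rule has_sum_unique[OF phi_form[OF bY]])
    have "((\<lambda>\<alpha>. of_real (a \<alpha> * qform Y (Xs \<alpha> x)) :: complex) has_sum of_real (qform (\<Phi> Y) x)) words"
      by (rule has_sum_of_real[OF phi_qform[OF bY]])
    then show "((\<lambda>\<alpha>. of_real (a \<alpha>) * cinner (Y (Xs \<alpha> x)) (Xs \<alpha> x)) has_sum of_real (qform (\<Phi> Y) x)) words"
      by (subst positive_op_form[OF Y]) simp
  qed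
  show "0 \<le> qform (\<Phi> Y) x" for x
    by (rule has_sum_nonneg[OF phi_qform[OF bY]]) (use a_nonneg positive_op_form_nonneg[OF Y] in auto)
qed

lemma positive_phi_pow: "positive_op Y \<Longrightarrow> positive_op ((\<Phi> ^^ s) Y)"
  by (induction s) (simp_all add: positive_phi)

lemma bounded_phi_pow: "bounded_op Y \<Longrightarrow> bounded_op ((\<Phi> ^^ s) Y)"
  by (induction s) (simp_all add: bounded_phi)

text \<open>Since \<open>Xs (\<beta> @ \<gamma>)\<close> is \<open>Xs \<beta>\<close> followed by
  \<open>Xs \<gamma>\<close>, nested sums merge along concatenation, and iterates of the map
  correspond to convolution powers of \<open>a\<close>.\<close>

lemma phi_pow_qform:
  assumes Y: "positive_op Y"
  shows "((\<lambda>\<alpha>. word_pow a s \<alpha> * qform Y (Xs \<alpha> x)) has_sum qform ((\<Phi> ^^ s) Y) x) words"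
proof (induction s arbitrary: x)
  case 0
  have "((\<lambda>\<alpha>. word_unit \<alpha> * qform Y (Xs \<alpha> x)) has_sum qform Y x) words"
    by (rule has_sum_finite_neutralI[of "{[]}"]) (auto simp: word_unit_def cadjoint_id[unfolded id_def] cadjoint_id)
  then show ?case by simp
next
  case (Suc s)
  show ?case
    unfolding word_pow.simps
  proof (rule has_sum_word_conv)
    show "((\<lambda>\<gamma>. word_pow a s \<gamma> * qform Y (Xs (\<beta> @ \<gamma>) x)) has_sum qform ((\<Phi> ^^ s) Y) (Xs \<beta> x)) words"
      if "\<beta> \<in> words" for \<beta>
      by (rule has_sum_cong[THEN iffD1, OF _ Suc.IH[of "Xs \<beta> x"]]) (simp only: Xs_append[OF that])
    show "((\<lambda>\<beta>. a \<beta> * qform ((\<Phi> ^^ s) Y) (Xs \<beta> x)) has_sum qform ((\<Phi> ^^ Suc s) Y) x) words"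
      using phi_qform[OF bounded_phi_pow[OF positive_op_bounded[OF Y]]] by simp
    show "0 \<le> word_pow a s \<gamma>" if "\<gamma> \<in> words" for \<gamma>
      by (rule word_pow_nonneg[of "{1..n}"]) (use that a_nonneg in auto)
  qed (use a_nonneg positive_op_form_nonneg[OF Y] in auto)
qed

text \<open>Nonnegative coefficients preserve domination of diagonal values. With
  \<open>W = id\<close>, decay of the iterates at the identity passes to the iterates at any bounded
  operator.\<close>

lemma phi_dominated:
  assumes Z: "bounded_op Z" and W: "bounded_op W"
    and le: "\<And>x. cmod (cinner (Z x) x) \<le> B * qform W x"
  shows "cmod (cinner (\<Phi> Z x) x) \<le> B * qform (\<Phi> W) x"
proof -
  let ?t = "\<lambda>\<alpha>. of_real (a \<alpha>) * cinner (Z (Xs \<alpha> x)) (Xs \<alpha> x)"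
  let ?g = "\<lambda>\<alpha>. B * (a \<alpha> * qform W (Xs \<alpha> x))"
  have g: "(?g has_sum B * qform (\<Phi> W) x) words"
    by (rule has_sum_cmult_right[OF phi_qform[OF W]])
  have t_le: "norm (?t \<alpha>) \<le> ?g \<alpha>" if "\<alpha> \<in> words" for \<alpha>
    using mult_left_mono[OF le[of "Xs \<alpha> x"] a_nonneg[OF that]] a_nonneg[OF that]
    by (simp add: norm_mult ac_simps)
  have absum: "(\<lambda>\<alpha>. norm (?t \<alpha>)) summable_on words"
    by (rule summable_on_comparison_test[OF has_sum_imp_summable[OF g] t_le]) simp_all
  have "cmod (infsum ?t words) \<le> infsum ?g words"
    using norm_infsum_bound[OF absum] infsum_mono[OF absum has_sum_imp_summable[OF g] t_le]
    by (rule order_trans)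
  then show ?thesis
    using infsumI[OF g] infsumI[OF phi_form[OF Z]] by simp
qed

lemma phi_pow_dominated:
  assumes "bounded_op Z" "bounded_op W" "\<And>x. cmod (cinner (Z x) x) \<le> B * qform W x"
  shows "cmod (cinner ((\<Phi> ^^ s) Z x) x) \<le> B * qform ((\<Phi> ^^ s) W) x"
proof (induction s arbitrary: x)
  case (Suc s)
  show ?case
    using phi_dominated[OF bounded_phi_pow[OF assms(1)] bounded_phi_pow[OF assms(2)] Suc.IH] by simp
qed (use assms(3) in simp)

section \<open>Inverting powers of \<open>id - \<Phi>\<close> for a pure row\<close>

abbreviation residual :: "('h \<Rightarrow> 'h) \<Rightarrow> 'h \<Rightarrow> 'h"
  where "residual \<equiv> \<lambda>Y x. Y x - \<Phi> Y x"

lemma bounded_residual_pow: "bounded_op Y \<Longrightarrow> bounded_op ((residual ^^ p) Y)"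
  by (induction p) (simp_all add: bounded_op_diff bounded_phi)

lemma phi_pow_residual:
  assumes Z: "bounded_op Z"
  shows "(\<Phi> ^^ s) (residual Z) = (\<lambda>x. (\<Phi> ^^ s) Z x - (\<Phi> ^^ Suc s) Z x)"
proof (induction s)
  case (Suc s)
  show ?case
    using phi_diff[OF bounded_phi_pow[OF Z, of s] bounded_phi_pow[OF Z, of "Suc s"]] by (simp add: Suc)
qed simp

text \<open>Telescoping: \<open>\<Sum>\<^sub>s \<Phi>\<^sup>s (Z - \<Phi> Z) = Z\<close> when \<open>\<Phi>\<^sup>s I \<rightarrow> 0\<close>.\<close>

lemma residual_inverse:
  assumes pure: "\<And>x. (\<lambda>s. qform ((\<Phi> ^^ s) id) x) \<longlonglongrightarrow> 0"
    and Z: "bounded_op Z" and pos: "positive_op (residual Z)"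
  shows "positive_op Z"
    and "((\<lambda>\<alpha>. weight_seq a 1 \<alpha> * qform (residual Z) (Xs \<alpha> x)) has_sum qform Z x) words"
proof -
  define y where "y s x = qform ((\<Phi> ^^ s) (residual Z)) x" for s x
  have y_nonneg: "0 \<le> y s x" for s x
    unfolding y_def by (rule positive_op_form_nonneg[OF positive_phi_pow[OF pos]])
  obtain C where C: "0 < C" "\<And>x. norm (Z x) \<le> C * norm x"
    using bounded_op_bound[OF Z] by blast
  have "cmod (cinner (Z x) x) \<le> C * qform id x" for x
    by (rule order_trans[OF cmod_cinner_le])
      (use mult_right_mono[OF C(2), of "norm x" x] in \<open>simp add: cinner_self power2_eq_square mult.assoc\<close>)
  then have "cmod (cinner ((\<Phi> ^^ s) Z x) x) \<le> C * qform ((\<Phi> ^^ s) id) x" for s x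
    by (rule phi_pow_dominated[OF Z bounded_op_id])
  moreover have "(\<lambda>s. C * qform ((\<Phi> ^^ s) id) x) \<longlonglongrightarrow> 0" for x
    using tendsto_mult_right_zero[OF pure] .
  ultimately have lim0: "(\<lambda>s. cinner ((\<Phi> ^^ s) Z x) x) \<longlonglongrightarrow> 0" for x
    by (rule Lim_null_comparison[OF always_eventually[OF allI]])
  have partial: "(\<Sum>s<N. complex_of_real (y s x)) = cinner (Z x) x - cinner ((\<Phi> ^^ N) Z x) x" for N x
  proof -
    have "complex_of_real (y s x) = cinner ((\<Phi> ^^ s) Z x) x - cinner ((\<Phi> ^^ Suc s) Z x) x" for s
      unfolding y_def positive_op_form[OF positive_phi_pow[OF pos], symmetric]
      unfolding phi_pow_residual[OF Z] by (simp add: cinner.diff_left)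
    then show ?thesis
      using sum_lessThan_telescope'[of "\<lambda>s. cinner ((\<Phi> ^^ s) Z x) x" N] by (simp only: funpow_0)
  qed
  have sums: "(\<lambda>s. complex_of_real (y s x)) sums cinner (Z x) x" for x
    unfolding sums_def partial using tendsto_diff[OF tendsto_const lim0] by simp
  then have "(\<lambda>s. Re (complex_of_real (y s x))) sums qform Z x" for x
    by (rule sums_Re)
  then have y_sums: "(\<lambda>s. y s x) sums qform Z x" for x
    by simp
  then have y_sum: "((\<lambda>s. y s x) has_sum qform Z x) UNIV" for x
    using y_nonneg by (rule sums_nonneg_imp_has_sum)
  \<comment> \<open>Positivity of \<open>Z\<close> is a conclusion: its diagonal values are sums of
    the nonnegative numbers \<open>y s x\<close>.\<close>
  show "positive_op Z"
  proof (rule positive_opI[OF Z])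
    show "cinner (Z x) x = of_real (qform Z x)" for x
      using sums_of_real[OF y_sums[of x], where 'a = complex] sums[of x] sums_unique2 by blast
    show "0 \<le> qform Z x" for x
      using has_sum_nonneg[OF y_sum] y_nonneg by blast
  qed
  let ?F = "\<lambda>s \<alpha>. word_pow a s \<alpha> * qform (residual Z) (Xs \<alpha> x)"
  have nonneg: "0 \<le> ?F s \<alpha>" if "\<alpha> \<in> words" for s \<alpha>
    by (intro mult_nonneg_nonneg word_pow_nonneg[of "{1..n}"] positive_op_form_nonneg[OF pos] a_nonneg that)
  have "((\<lambda>(s, \<alpha>). ?F s \<alpha>) has_sum qform Z x) (UNIV \<times> words)"
    by (rule has_sum_Times_nonneg[OF phi_pow_qform[OF pos] y_sum[unfolded y_def]]) (use nonneg in auto)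
  \<comment> \<open>After the exchange of sums, only the powers
    \<open>s \<le> length \<alpha>\<close> contribute at a fixed word, and they add up to
    \<open>weight_seq a 1 \<alpha>\<close>.\<close>
  then have "((\<lambda>(\<alpha>, s). ?F s \<alpha>) has_sum qform Z x) (words \<times> UNIV)"
    by (subst has_sum_swap) simp
  then show "((\<lambda>\<alpha>. weight_seq a 1 \<alpha> * qform (residual Z) (Xs \<alpha> x)) has_sum qform Z x) words"
  proof (rule has_sum_SigmaD)
    fix \<alpha>
    have "weight_seq a 1 \<alpha> = (\<Sum>s\<le>length \<alpha>. word_pow a s \<alpha>)"
      using weight_seq_Suc_sum[of a \<alpha> "length \<alpha>" 0] a_Nil by (simp add: One_nat_def)
    then have "((\<lambda>s. ?F s \<alpha>) has_sum weight_seq a 1 \<alpha> * qform (residual Z) (Xs \<alpha> x)) UNIV"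
      by (intro has_sum_finite_neutralI[of "{..length \<alpha>}"])
        (auto simp: sum_distrib_right word_pow_short[of a] a_Nil)
    then show "((\<lambda>s. case (\<alpha>, s) of (\<alpha>, s) \<Rightarrow> ?F s \<alpha>) has_sum
        weight_seq a 1 \<alpha> * qform (residual Z) (Xs \<alpha> x)) UNIV"
      by simp
  qed
qed

text \<open>The case of order \<open>p\<close>, applied to \<open>residual Z\<close>, supplies the
  positivity that the telescoping step asks for; the two weights then combine by
  \<open>weight_seq_conv\<close>.\<close>

lemma residual_pow_inverse:
  assumes pure: "\<And>x. (\<lambda>s. qform ((\<Phi> ^^ s) id) x) \<longlonglongrightarrow> 0"
    and "bounded_op Z" "positive_op ((residual ^^ p) Z)"
  shows "positive_op Z \<and>
    (\<forall>x. ((\<lambda>\<alpha>. weight_seq a p \<alpha> * qform ((residual ^^ p) Z) (Xs \<alpha> x)) has_sum qform Z x) words)"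
  using assms(2,3)
proof (induction p arbitrary: Z)
  case 0
  have "((\<lambda>\<alpha>. word_unit \<alpha> * qform Z (Xs \<alpha> x)) has_sum qform Z x) words" for x
    by (rule has_sum_finite_neutralI[of "{[]}"]) (auto simp: word_unit_def cadjoint_id[unfolded id_def] cadjoint_id)
  with 0 show ?case by (simp add: weight_seq_def)
next
  case (Suc p)
  have Suc_p: "(residual ^^ Suc p) Z = (residual ^^ p) (residual Z)"
    by (simp only: funpow_Suc_right o_apply)
  note pos = Suc.prems(2)[unfolded Suc_p]
  have IH: "positive_op (residual Z)"
    "\<And>x. ((\<lambda>\<alpha>. weight_seq a p \<alpha> * qform ((residual ^^ p) (residual Z)) (Xs \<alpha> x)) has_sum qform (residual Z) x) words"
    using Suc.IH[OF _ pos] Suc.prems(1) by (auto simp: bounded_op_diff bounded_phi)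
  note step = residual_inverse[OF pure Suc.prems(1) IH(1)]
  have wn: "0 \<le> weight_seq a p \<alpha>" if "\<alpha> \<in> words" for p \<alpha>
    by (rule weight_seq_nonneg[of a "{1..n}"]) (use that a_Nil a_nonneg in auto)
  have "((\<lambda>\<alpha>. weight_seq a (Suc p) \<alpha> * qform ((residual ^^ p) (residual Z)) (Xs \<alpha> x)) has_sum qform Z x) words" for x
    unfolding weight_seq_conv[of a, OF a_Nil]
  proof (rule has_sum_word_conv)
    show "((\<lambda>\<gamma>. weight_seq a p \<gamma> * qform ((residual ^^ p) (residual Z)) (Xs (\<beta> @ \<gamma>) x)) has_sum
        qform (residual Z) (Xs \<beta> x)) words" if "\<beta> \<in> words" for \<beta>
      by (rule has_sum_cong[THEN iffD1, OF _ IH(2)[of "Xs \<beta> x"]]) (simp only: Xs_append[OF that])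
    show "((\<lambda>\<beta>. weight_seq a 1 \<beta> * qform (residual Z) (Xs \<beta> x)) has_sum qform Z x) words"
      by (rule step(2))
  qed (use wn positive_op_form_nonneg[OF pos] in auto)
  with step(1) show ?case
    unfolding Suc_p by blast
qed

end

section \<open>The universal model in coordinates\<close>

lemma bounded_linear_Rep_ell2: "bounded_linear (\<lambda>\<xi> :: ('i, 'h::complex_hilbert_space) ell2. Rep_ell2 \<xi> i)"
  by (rule bounded_linear_intro[of _ 1])
    (simp_all add: plus_ell2.rep_eq scaleR_ell2.rep_eq ell2_component_le)

lemma ell2_eqI: "(\<And>i. Rep_ell2 x i = Rep_ell2 y i) \<Longrightarrow> x = y"
  using Rep_ell2_inject by blast

lemma ell2_norm_has_sum: "((\<lambda>i. (norm (Rep_ell2 x i))\<^sup>2) has_sum (norm x)\<^sup>2) UNIV"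
  unfolding ell2_norm_sq by (rule has_sum_infsum[OF ell2_summable])

text \<open>In coordinates the model operators and their adjoints are injective reindexings with
  bounded weights. They are given by \<open>Abs_ell2\<close>, so square-summability must be known
  before a coordinate can be computed.\<close>

lemma ell2_weighted_shift:
  fixes \<xi> :: "('i, 'h::complex_hilbert_space) ell2" and \<sigma> :: "'j \<Rightarrow> 'i"
  assumes inj: "inj_on \<sigma> S" and c: "\<And>\<beta>. \<beta> \<in> S \<Longrightarrow> \<bar>c \<beta>\<bar> \<le> C" and C: "0 \<le> C"
  shows "\<exists>\<eta>. Rep_ell2 \<eta> = (\<lambda>\<beta>. if \<beta> \<in> S then c \<beta> *\<^sub>R Rep_ell2 \<xi> (\<sigma> \<beta>) else 0) \<and>
    norm \<eta> \<le> C * norm \<xi>"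
proof -
  let ?f = "\<lambda>\<beta>. if \<beta> \<in> S then c \<beta> *\<^sub>R Rep_ell2 \<xi> (\<sigma> \<beta>) else 0"
  have "(\<Sum>\<beta>\<in>F. (norm (?f \<beta>))\<^sup>2) \<le> (C * norm \<xi>)\<^sup>2" if F: "finite F" for F
  proof -
    have "(\<Sum>\<beta>\<in>F. (norm (?f \<beta>))\<^sup>2) = (\<Sum>\<beta>\<in>F \<inter> S. (c \<beta>)\<^sup>2 * (norm (Rep_ell2 \<xi> (\<sigma> \<beta>)))\<^sup>2)"
      by (rule sum.mono_neutral_cong_right) (use F in \<open>auto simp: power_mult_distrib\<close>)
    also have "\<dots> \<le> (\<Sum>\<beta>\<in>F \<inter> S. C\<^sup>2 * (norm (Rep_ell2 \<xi> (\<sigma> \<beta>)))\<^sup>2)"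
      by (intro sum_mono mult_right_mono) (use c in \<open>auto simp: abs_le_square_iff[symmetric] C\<close>)
    also have "\<dots> = C\<^sup>2 * (\<Sum>\<beta>\<in>\<sigma> ` (F \<inter> S). (norm (Rep_ell2 \<xi> \<beta>))\<^sup>2)"
      by (subst sum.reindex) (use inj_on_subset[OF inj] in \<open>auto simp: sum_distrib_left\<close>)
    also have "\<dots> \<le> C\<^sup>2 * (norm \<xi>)\<^sup>2"
      by (intro mult_left_mono ell2_finite_le) (use F in auto)
    finally show ?thesis
      by (simp add: power_mult_distrib)
  qed
  then show ?thesis
    by (rule ell2_finite_leI[of ?f "C * norm \<xi>"]) (use C in auto)
qed

text \<open>Linearity relative to a subspace: outside the families supported on proper words the
  weights of \<open>model_W\<close> are not controlled, and \<open>Abs_ell2\<close> may return an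
  arbitrary value.\<close>

definition linear_within :: "'a::complex_hilbert_space set \<Rightarrow> ('a \<Rightarrow> 'a) \<Rightarrow> bool"
  where "linear_within V A \<longleftrightarrow> A ` V \<subseteq> V \<and> (\<forall>x\<in>V. \<forall>y\<in>V. A (x + y) = A x + A y) \<and>
    (\<forall>c. \<forall>x\<in>V. A (c *\<^sub>C x) = c *\<^sub>C A x)"

lemma linear_within_id: "linear_within V id"
  by (simp add: linear_within_def)

lemma linear_within_comp: "linear_within V A \<Longrightarrow> linear_within V B \<Longrightarrow> linear_within V (A \<circ> B)"
  unfolding linear_within_def by (auto simp: image_subset_iff)

lemma linear_within_foldr:
  "(\<And>i. i \<in> set is \<Longrightarrow> linear_within V (A i)) \<Longrightarrow> linear_within V (foldr (\<lambda>i. (\<circ>) (A i)) is id)"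
  by (induction "is") (auto simp: linear_within_id intro: linear_within_comp)

lemma linear_within_sum:
  assumes A: "linear_within V A" and V: "csubspace V" and v: "\<And>i. i \<in> I \<Longrightarrow> v i \<in> V"
  shows "A (\<Sum>i\<in>I. c i *\<^sub>C v i) = (\<Sum>i\<in>I. c i *\<^sub>C A (v i))"
proof -
  have 0: "A 0 = 0"
    using A complex_vector.subspace_0[OF V] unfolding linear_within_def by (metis complex_vector.scale_zero_left)
  have mem: "(\<Sum>i\<in>J. c i *\<^sub>C v i) \<in> V" if "J \<subseteq> I" for J
    using that v by (intro complex_vector.subspace_sum[OF V] complex_vector.subspace_scale[OF V]) auto
  show ?thesis
    using v mem
  proof (induction I rule: infinite_finite_induct)
    case (insert i I)
    have S: "(\<Sum>i\<in>I. c i *\<^sub>C v i) \<in> V" and cv: "c i *\<^sub>C v i \<in> V"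
      using insert.prems(2)[of I] insert.prems(1)[of i] complex_vector.subspace_scale[OF V] by auto
    have "A (\<Sum>i\<in>insert i I. c i *\<^sub>C v i) = A (c i *\<^sub>C v i + (\<Sum>i\<in>I. c i *\<^sub>C v i))"
      using insert.hyps by simp
    also have "\<dots> = A (c i *\<^sub>C v i) + A (\<Sum>i\<in>I. c i *\<^sub>C v i)"
      using A S cv unfolding linear_within_def by blast
    also have "A (c i *\<^sub>C v i) = c i *\<^sub>C A (v i)"
      using A insert.prems(1)[of i] unfolding linear_within_def by blast
    also have "A (\<Sum>i\<in>I. c i *\<^sub>C v i) = (\<Sum>i\<in>I. c i *\<^sub>C A (v i))"
      by (rule insert.IH) (use insert.prems in auto)
    finally show ?case
      using insert.hyps by simp
  qed (simp_all add: 0)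
qed

locale model =
  fixes k :: nat and n m :: "nat \<Rightarrow> nat" and a :: "nat \<Rightarrow> nat list \<Rightarrow> real"
  assumes m_pos: "\<And>i. i \<in> {1..k} \<Longrightarrow> 1 \<le> m i"
    and regular: "\<And>i. i \<in> {1..k} \<Longrightarrow> positive_regular (n i) (a i)"
begin

abbreviation mw :: "(nat \<Rightarrow> nat list) set"
  where "mw \<equiv> multi_words k n"

definition bw :: "(nat \<Rightarrow> nat list) \<Rightarrow> real"
  where "bw \<beta> = (\<Prod>i\<in>{1..k}. fock_weight (a i) (m i) (\<beta> i))"

definition push :: "nat \<Rightarrow> nat \<Rightarrow> (nat \<Rightarrow> nat list) \<Rightarrow> nat \<Rightarrow> nat list"
  where "push i j \<beta> = \<beta>(i := j # \<beta> i)"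

text \<open>Restricted to \<open>{1..k}\<close> so that the result is again extensional, as
  \<open>multi_words\<close> demands.\<close>

definition mapp :: "(nat \<Rightarrow> nat list) \<Rightarrow> (nat \<Rightarrow> nat list) \<Rightarrow> nat \<Rightarrow> nat list"
  where "mapp \<alpha> \<beta> = (\<lambda>i\<in>{1..k}. \<alpha> i @ \<beta> i)"

text \<open>Normalised coordinates, in which \<open>W\<^sub>i\<^sub>,\<^sub>j\<close> and its adjoint are unweighted shifts.\<close>

definition hat :: "(nat \<Rightarrow> nat list, 'h::complex_hilbert_space) ell2 \<Rightarrow> (nat \<Rightarrow> nat list) \<Rightarrow> 'h"
  where "hat \<xi> \<beta> = (1 / sqrt (bw \<beta>)) *\<^sub>R Rep_ell2 \<xi> \<beta>"

definition basis :: "(nat \<Rightarrow> nat list) \<Rightarrow> (nat \<Rightarrow> nat list, complex) ell2"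
  where "basis \<beta> = complex_of_real (1 / sqrt (bw \<beta>)) *\<^sub>C ket \<beta>"

lemma mw_upd: "\<beta> \<in> mw \<Longrightarrow> i \<in> {1..k} \<Longrightarrow> \<gamma> \<in> lists {1..n i} \<Longrightarrow> \<beta>(i := \<gamma>) \<in> mw"
  unfolding multi_words_def by (auto simp: PiE_iff extensional_def)

lemma mw_nth: "\<beta> \<in> mw \<Longrightarrow> i \<in> {1..k} \<Longrightarrow> \<beta> i \<in> lists {1..n i}"
  unfolding multi_words_def by (auto simp: PiE_iff)

lemma mw_push: "\<beta> \<in> mw \<Longrightarrow> i \<in> {1..k} \<Longrightarrow> j \<in> {1..n i} \<Longrightarrow> push i j \<beta> \<in> mw"
  unfolding push_def by (intro mw_upd) (use mw_nth in auto)

lemma mw_mapp: "\<alpha> \<in> mw \<Longrightarrow> \<beta> \<in> mw \<Longrightarrow> mapp \<alpha> \<beta> \<in> mw"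
  unfolding multi_words_def mapp_def by (auto simp: PiE_iff)

lemma mw_outside: "\<beta> \<in> mw \<Longrightarrow> i \<notin> {1..k} \<Longrightarrow> \<beta> i = undefined"
  unfolding multi_words_def by (auto simp: PiE_iff extensional_def)

lemma mapp_empty: "\<beta> \<in> mw \<Longrightarrow> mapp \<beta> (\<lambda>i\<in>{1..k}. []) = \<beta>" "\<beta> \<in> mw \<Longrightarrow> mapp (\<lambda>i\<in>{1..k}. []) \<beta> = \<beta>"
  using mw_outside by (fastforce simp: mapp_def fun_eq_iff)+

lemma mw_empty: "(\<lambda>i\<in>{1..k}. []) \<in> mw"
  by (auto simp: multi_words_def)

lemma push_mapp: "i \<in> {1..k} \<Longrightarrow> push i j (mapp \<alpha> \<beta>) = mapp (push i j \<alpha>) \<beta>"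
  by (auto simp: push_def mapp_def fun_eq_iff)

lemma inj_push: "inj (push i j)"
  by (rule injI) (metis fun_upd_apply fun_upd_triv fun_upd_upd list.inject push_def)

lemma fw_pos: "i \<in> {1..k} \<Longrightarrow> \<gamma> \<in> lists {1..n i} \<Longrightarrow> 0 < fock_weight (a i) (m i) \<gamma>"
  using fock_weight_pos[OF regular m_pos] by blast

lemma bw_pos: "\<beta> \<in> mw \<Longrightarrow> 0 < bw \<beta>"
  unfolding bw_def by (intro prod_pos ballI fw_pos mw_nth)

lemma bw_empty: "bw (\<lambda>i\<in>{1..k}. []) = 1"
  unfolding bw_def by (rule prod.neutral) (simp add: fock_weight_def)

lemma prod_upd:
  assumes "i \<in> {1..k}"
  shows "(\<Prod>l\<in>{1..k}. (\<mu> l ((\<beta>(i := \<gamma>)) l)) :: real) = \<mu> i \<gamma> * (\<Prod>l\<in>{1..k} - {i}. \<mu> l (\<beta> l))"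
  using assms by (subst prod.remove[of _ i]) auto

lemma bw_push_ratio:
  assumes "\<beta> \<in> mw" "i \<in> {1..k}"
  shows "bw \<beta> / bw (push i j \<beta>) = fock_weight (a i) (m i) (\<beta> i) / fock_weight (a i) (m i) (j # \<beta> i)"
proof -
  define P where "P = (\<Prod>l\<in>{1..k} - {i}. fock_weight (a l) (m l) (\<beta> l))"
  have "0 < P"
    unfolding P_def by (intro prod_pos ballI fw_pos mw_nth) (use assms in auto)
  moreover have "bw \<beta> = fock_weight (a i) (m i) (\<beta> i) * P"
    "bw (push i j \<beta>) = fock_weight (a i) (m i) (j # \<beta> i) * P"
    unfolding bw_def push_def P_def
    using prod_upd[OF assms(2), of "\<lambda>l. fock_weight (a l) (m l)" \<beta> "\<beta> i"]
      prod_upd[OF assms(2), of "\<lambda>l. fock_weight (a l) (m l)" \<beta> "j # \<beta> i"] by simp_all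
  ultimately show ?thesis by simp
qed

section \<open>Creation operators and their adjoints in coordinates\<close>

lemma letter_pos: "i \<in> {1..k} \<Longrightarrow> j \<in> {1..n i} \<Longrightarrow> 0 < a i [j]"
  using regular by (auto simp: positive_regular_def)

lemma fw_ratio_le:
  assumes "i \<in> {1..k}" "j \<in> {1..n i}" "\<gamma> \<in> lists {1..n i}"
  shows "\<bar>sqrt (fock_weight (a i) (m i) \<gamma> / fock_weight (a i) (m i) (j # \<gamma>))\<bar> \<le> sqrt (1 / a i [j])"
proof -
  have "0 < a i [j]"
    by (rule letter_pos[OF assms(1,2)])
  moreover have "0 < fock_weight (a i) (m i) (j # \<gamma>)" "0 < fock_weight (a i) (m i) \<gamma>"
    by (intro fw_pos; use assms in auto)+
  ultimately show ?thesis
    using fock_weight_Cons_ge[OF regular[OF assms(1)] m_pos[OF assms(1)] assms(3,2)]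
    by (simp add: field_simps)
qed

text \<open>The adjoint of the creation operator tensored with the identity, written in coordinates
  so that one formula covers scalar families and families with values in any Hilbert space.\<close>

definition wadj :: "nat \<Rightarrow> nat \<Rightarrow> (nat \<Rightarrow> nat list, 'h::complex_hilbert_space) ell2 \<Rightarrow> (nat \<Rightarrow> nat list, 'h) ell2"
  where "wadj i j \<xi> = Abs_ell2 (\<lambda>\<beta>. if \<beta> \<in> mw then sqrt (bw \<beta> / bw (push i j \<beta>)) *\<^sub>R Rep_ell2 \<xi> (push i j \<beta>) else 0)"

context
  fixes i j :: nat
  assumes i: "i \<in> {1..k}" and j: "j \<in> {1..n i}"
begin

lemma
  shows Rep_wadj: "Rep_ell2 (wadj i j \<xi>) =
      (\<lambda>\<beta>. if \<beta> \<in> mw then sqrt (bw \<beta> / bw (push i j \<beta>)) *\<^sub>R Rep_ell2 \<xi> (push i j \<beta>) else 0)"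
    and norm_wadj: "norm (wadj i j \<xi>) \<le> sqrt (1 / a i [j]) * norm \<xi>"
proof -
  have "\<exists>\<eta>. Rep_ell2 \<eta> =
      (\<lambda>\<beta>. if \<beta> \<in> mw then sqrt (bw \<beta> / bw (push i j \<beta>)) *\<^sub>R Rep_ell2 \<xi> (push i j \<beta>) else 0) \<and>
    norm \<eta> \<le> sqrt (1 / a i [j]) * norm \<xi>"
    by (intro ell2_weighted_shift inj_on_subset[OF inj_push])
      (use letter_pos[OF i j] in \<open>auto simp: bw_push_ratio[OF _ i] intro!: fw_ratio_le[OF i j mw_nth[OF _ i]]\<close>)
  then obtain \<eta> where \<eta>: "Rep_ell2 \<eta> =
      (\<lambda>\<beta>. if \<beta> \<in> mw then sqrt (bw \<beta> / bw (push i j \<beta>)) *\<^sub>R Rep_ell2 \<xi> (push i j \<beta>) else 0)"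
    "norm \<eta> \<le> sqrt (1 / a i [j]) * norm \<xi>" by blast
  then have "wadj i j \<xi> = \<eta>"
    unfolding wadj_def by (metis Rep_ell2_inverse)
  with \<eta> show "Rep_ell2 (wadj i j \<xi>) =
      (\<lambda>\<beta>. if \<beta> \<in> mw then sqrt (bw \<beta> / bw (push i j \<beta>)) *\<^sub>R Rep_ell2 \<xi> (push i j \<beta>) else 0)"
    "norm (wadj i j \<xi>) \<le> sqrt (1 / a i [j]) * norm \<xi>"
    by simp_all
qed

lemma bounded_wadj: "bounded_op (wadj i j)"
  by (rule bounded_opI[OF _ _ norm_wadj])
    (rule ell2_eqI, simp add: Rep_wadj plus_ell2.rep_eq scaleC_ell2.rep_eq scaleR_right_distrib
      scaleR_scaleC_commute)+

lemma hat_wadj: "\<beta> \<in> mw \<Longrightarrow> hat (wadj i j \<xi>) \<beta> = hat \<xi> (push i j \<beta>)"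
  using bw_pos[of \<beta>] by (simp add: hat_def Rep_wadj real_sqrt_divide)

lemma Rep_weighted_creation:
  assumes \<xi>: "\<xi> \<in> fock (n i)"
  shows "Rep_ell2 (weighted_creation (a i) (m i) j \<xi>) = (\<lambda>\<beta>. case \<beta> of [] \<Rightarrow> 0 | l # \<gamma> \<Rightarrow>
    if l = j then complex_of_real (sqrt (fock_weight (a i) (m i) \<gamma> / fock_weight (a i) (m i) (j # \<gamma>))) * Rep_ell2 \<xi> \<gamma>
    else 0)" (is "_ = ?f")
proof -
  let ?S = "(#) j ` lists {1..n i}"
  let ?c = "\<lambda>\<beta>. sqrt (fock_weight (a i) (m i) (tl \<beta>) / fock_weight (a i) (m i) (j # tl \<beta>))"
  have "\<exists>\<eta>. Rep_ell2 \<eta> = (\<lambda>\<beta>. if \<beta> \<in> ?S then ?c \<beta> *\<^sub>R Rep_ell2 \<xi> (tl \<beta>) else 0) \<and>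
    norm \<eta> \<le> sqrt (1 / a i [j]) * norm \<xi>"
    by (intro ell2_weighted_shift)
      (use letter_pos[OF i j] in \<open>auto simp: inj_on_def simp del: in_lists_conv_set intro!: fw_ratio_le[OF i j]\<close>)
  then obtain \<eta> where "Rep_ell2 \<eta> = (\<lambda>\<beta>. if \<beta> \<in> ?S then ?c \<beta> *\<^sub>R Rep_ell2 \<xi> (tl \<beta>) else 0)"
    by blast
  also have "\<dots> = ?f"
  proof
    fix \<beta>
    show "(if \<beta> \<in> ?S then ?c \<beta> *\<^sub>R Rep_ell2 \<xi> (tl \<beta>) else 0) = ?f \<beta>"
    proof (cases \<beta>)
      case (Cons l \<gamma>)
      have "Rep_ell2 \<xi> \<gamma> = 0" if "\<gamma> \<notin> lists {1..n i}"
        using \<xi> that unfolding fock_def by blast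
      then show ?thesis
        unfolding Cons by (auto simp: scaleR_conv_of_real image_iff)
    qed auto
  qed
  finally have "Rep_ell2 \<eta> = ?f" .
  then show ?thesis
    unfolding weighted_creation_def by (metis (no_types, lifting) Rep_ell2_inverse)
qed

lemma slice_fock:
  assumes "\<xi> \<in> fock_tensor k n"
  shows "slice i \<beta> \<xi> \<in> fock (n i)"
proof -
  have "Rep_ell2 (slice i \<beta> \<xi>) \<alpha> = 0" if "\<alpha> \<notin> lists {1..n i}" for \<alpha>
  proof -
    have "\<beta>(i := \<alpha>) \<notin> mw"
      using that mw_nth[OF _ i, of "\<beta>(i := \<alpha>)"] by (auto simp del: in_lists_conv_set)
    then show ?thesis
      using assms by (simp add: slice.rep_eq fock_tensor_def)
  qed
  then show ?thesis
    by (simp add: fock_def)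
qed

lemma fock_tensor_not_push:
  assumes "\<xi> \<in> fock_tensor k n" "\<delta> \<notin> push i j ` mw" "\<delta> i = j # \<gamma>"
  shows "Rep_ell2 \<xi> (\<delta>(i := \<gamma>)) = 0"
proof -
  have "\<delta> = push i j (\<delta>(i := \<gamma>))"
    using assms(3) by (auto simp: push_def fun_eq_iff)
  then have "\<delta>(i := \<gamma>) \<notin> mw"
    using assms(2) by blast
  then show ?thesis
    using assms(1) unfolding fock_tensor_def by blast
qed

text \<open>Each slice of a properly supported family is proper, so the one-factor formula applies
  slice by slice. The auxiliary \<open>\<eta>\<close> shows that the outcome is square-summable,
  being a weighted shift along the inverse of \<open>push\<close>.\<close>

lemma Rep_model_W:
  assumes \<xi>: "\<xi> \<in> fock_tensor k n"
  shows "Rep_ell2 (model_W a m i j \<xi>) \<delta> = (case \<delta> i of [] \<Rightarrow> 0 | l # \<gamma> \<Rightarrow>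
    if l = j then complex_of_real (sqrt (fock_weight (a i) (m i) \<gamma> / fock_weight (a i) (m i) (j # \<gamma>))) *
      Rep_ell2 \<xi> (\<delta>(i := \<gamma>)) else 0)" (is "_ = ?f \<delta>")
proof -
  let ?S = "push i j ` mw" and ?\<sigma> = "\<lambda>\<delta>. \<delta>(i := tl (\<delta> i))"
  let ?c = "\<lambda>\<delta>. sqrt (fock_weight (a i) (m i) (tl (\<delta> i)) / fock_weight (a i) (m i) (j # tl (\<delta> i)))"
  have \<sigma>: "?\<sigma> (push i j \<beta>) = \<beta>" for \<beta>
    by (simp add: push_def)
  have "\<exists>\<eta>. Rep_ell2 \<eta> = (\<lambda>\<delta>. if \<delta> \<in> ?S then ?c \<delta> *\<^sub>R Rep_ell2 \<xi> (?\<sigma> \<delta>) else 0) \<and>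
    norm \<eta> \<le> sqrt (1 / a i [j]) * norm \<xi>"
  proof (rule ell2_weighted_shift)
    show "inj_on ?\<sigma> ?S"
      by (rule inj_onI) (auto simp only: \<sigma>)
    show "\<bar>?c \<delta>\<bar> \<le> sqrt (1 / a i [j])" if "\<delta> \<in> ?S" for \<delta>
      using that fw_ratio_le[OF i j mw_nth[OF _ i]] by (auto simp: push_def)
  qed (use letter_pos[OF i j] in simp)
  then obtain \<eta> where "Rep_ell2 \<eta> = (\<lambda>\<delta>. if \<delta> \<in> ?S then ?c \<delta> *\<^sub>R Rep_ell2 \<xi> (?\<sigma> \<delta>) else 0)"
    by blast
  also have "\<dots> = ?f"
  proof
    fix \<delta>
    show "(if \<delta> \<in> ?S then ?c \<delta> *\<^sub>R Rep_ell2 \<xi> (?\<sigma> \<delta>) else 0) = ?f \<delta>"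
    proof (cases "\<delta> \<in> ?S")
      case True
      then obtain \<beta> where "\<delta> = push i j \<beta>" by blast
      then show ?thesis
        using True by (simp add: push_def scaleR_conv_of_real)
    next
      case False
      then show ?thesis
        using fock_tensor_not_push[OF \<xi> False] by (auto split: list.split)
    qed
  qed
  finally have \<eta>: "Rep_ell2 \<eta> = ?f" .
  have "Rep_ell2 (weighted_creation (a i) (m i) j (slice i \<delta> \<xi>)) (\<delta> i) = ?f \<delta>" for \<delta>
    unfolding Rep_weighted_creation[OF slice_fock[OF \<xi>]]
    by (auto simp: slice.rep_eq split: list.split)
  then have "model_W a m i j \<xi> = \<eta>"
    unfolding model_W_def on_factor_def by (simp flip: \<eta> add: Rep_ell2_inverse)
  then show ?thesis
    by (simp add: \<eta>)
qed

lemma Rep_model_W_push: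
  assumes "\<xi> \<in> fock_tensor k n" "\<beta> \<in> mw"
  shows "Rep_ell2 (model_W a m i j \<xi>) (push i j \<beta>) =
    complex_of_real (sqrt (bw \<beta> / bw (push i j \<beta>))) * Rep_ell2 \<xi> \<beta>"
  unfolding Rep_model_W[OF assms(1)] bw_push_ratio[OF assms(2) i] by (simp add: push_def)

lemma Rep_model_W_outside:
  assumes "\<xi> \<in> fock_tensor k n" "\<delta> \<notin> push i j ` mw"
  shows "Rep_ell2 (model_W a m i j \<xi>) \<delta> = 0"
  unfolding Rep_model_W[OF assms(1)] using fock_tensor_not_push[OF assms] by (auto split: list.split)

lemma linear_model_W: "linear_within (fock_tensor k n) (model_W a m i j)"
  unfolding linear_within_def
proof (intro conjI ballI allI)
  show "model_W a m i j ` fock_tensor k n \<subseteq> fock_tensor k n"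
  proof clarify
    fix \<xi> assume \<xi>: "\<xi> \<in> fock_tensor k n"
    have "Rep_ell2 (model_W a m i j \<xi>) \<delta> = 0" if "\<delta> \<notin> mw" for \<delta>
      by (rule Rep_model_W_outside[OF \<xi>]) (use that mw_push[OF _ i j] in blast)
    then show "model_W a m i j \<xi> \<in> fock_tensor k n"
      unfolding fock_tensor_def by blast
  qed
  fix \<xi> \<eta> assume 1: "\<xi> \<in> fock_tensor k n" "\<eta> \<in> fock_tensor k n"
  then have "\<xi> + \<eta> \<in> fock_tensor k n"
    by (simp add: fock_tensor_def plus_ell2.rep_eq)
  from Rep_model_W[OF this] Rep_model_W[OF 1(1)] Rep_model_W[OF 1(2)]
  show "model_W a m i j (\<xi> + \<eta>) = model_W a m i j \<xi> + model_W a m i j \<eta>"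
    by (intro ell2_eqI) (auto simp: plus_ell2.rep_eq distrib_left split: list.split)
next
  fix \<xi> c assume 1: "\<xi> \<in> fock_tensor k n"
  then have "c *\<^sub>C \<xi> \<in> fock_tensor k n"
    by (simp add: fock_tensor_def scaleC_ell2.rep_eq)
  from Rep_model_W[OF this] Rep_model_W[OF 1]
  show "model_W a m i j (c *\<^sub>C \<xi>) = c *\<^sub>C model_W a m i j \<xi>"
    by (intro ell2_eqI) (auto simp: scaleC_ell2.rep_eq scaleC_complex_def split: list.split)
qed

text \<open>Only the image of \<open>push i j\<close> contributes to the right-hand side, and
  reindexing along it moves the real weight to the other argument.\<close>

lemma cinner_wadj:
  assumes "\<eta> \<in> fock_tensor k n"
  shows "cinner (wadj i j \<xi>) \<eta> = cinner \<xi> (model_W a m i j \<eta>)"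
proof -
  have "cinner \<xi> (model_W a m i j \<eta>) =
      (\<Sum>\<^sub>\<infinity>\<delta>\<in>push i j ` mw. cinner (Rep_ell2 \<xi> \<delta>) (Rep_ell2 (model_W a m i j \<eta>) \<delta>))"
    unfolding cinner_ell2.rep_eq
    by (rule infsum_cong_neutral) (auto simp: Rep_model_W_outside[OF assms])
  also have "\<dots> = (\<Sum>\<^sub>\<infinity>\<beta>\<in>mw. cinner (Rep_ell2 \<xi> (push i j \<beta>)) (Rep_ell2 (model_W a m i j \<eta>) (push i j \<beta>)))"
    by (subst infsum_reindex) (auto simp: o_def inj_on_subset[OF inj_push])
  also have "\<dots> = cinner (wadj i j \<xi>) \<eta>"
    unfolding cinner_ell2.rep_eq
    by (rule infsum_cong_neutral)
      (auto simp: Rep_model_W_push[OF assms] Rep_wadj cinner_complex_def scaleR_conv_of_real)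
  finally show ?thesis ..
qed

lemma model_W_basis:
  assumes "\<beta> \<in> mw"
  shows "model_W a m i j (basis \<beta>) = basis (push i j \<beta>)"
proof -
  have "ket \<beta> \<in> fock_tensor k n"
    using assms by (auto simp: fock_tensor_def Rep_ket)
  then have "model_W a m i j (basis \<beta>) = complex_of_real (1 / sqrt (bw \<beta>)) *\<^sub>C model_W a m i j (ket \<beta>)"
    using linear_model_W unfolding basis_def linear_within_def by blast
  also have "\<dots> = complex_of_real (1 / sqrt (bw \<beta>) * sqrt (bw \<beta> / bw (push i j \<beta>))) *\<^sub>C ket (push i j \<beta>)"
    unfolding model_W_ket bw_push_ratio[OF assms i] push_def[symmetric] by (simp only: scaleC_scaleC of_real_mult)
  also have "1 / sqrt (bw \<beta>) * sqrt (bw \<beta> / bw (push i j \<beta>)) = 1 / sqrt (bw (push i j \<beta>))"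
    using bw_pos[OF assms] by (simp add: real_sqrt_divide)
  finally show ?thesis
    by (simp add: basis_def)
qed

end

end

section \<open>The variety part of the model\<close>

context model
begin

lemma csubspace_fock_tensor: "csubspace (fock_tensor k n)"
  by (rule complex_vector.subspaceI)
    (simp_all add: fock_tensor_def zero_ell2.rep_eq plus_ell2.rep_eq scaleC_ell2.rep_eq)

lemma basis_fock_tensor: "\<beta> \<in> mw \<Longrightarrow> basis \<beta> \<in> fock_tensor k n"
  by (auto simp: fock_tensor_def basis_def scaleC_ell2.rep_eq Rep_ket)

lemma cinner_basis: "cinner \<xi> (basis \<beta>) = hat \<xi> \<beta>"
  by (simp add: basis_def cinner_scaleC_right cinner_ket hat_def scaleR_conv_of_real)

lemma word_model_W_basis:
  assumes "i \<in> {1..k}" "\<alpha> \<in> lists {1..n i}" "\<beta> \<in> mw"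
  shows "word_op (model_W a m i) \<alpha> (basis \<beta>) = basis (\<beta>(i := \<alpha> @ \<beta> i))"
  using assms(2)
proof (induction \<alpha>)
  case (Cons j \<alpha>)
  have "\<alpha> @ \<beta> i \<in> lists {1..n i}"
    using Cons.hyps mw_nth[OF assms(3,1)] by simp
  then have "\<beta>(i := \<alpha> @ \<beta> i) \<in> mw"
    by (rule mw_upd[OF assms(3,1)])
  then show ?case
    using Cons model_W_basis[OF assms(1), of j "\<beta>(i := \<alpha> @ \<beta> i)"]
    by (simp only: word_op_Cons o_apply push_def fun_upd_same fun_upd_upd append_Cons)
qed simp

text \<open>Stated for an arbitrary list of rows to allow induction over the fold; distinctness
  keeps a row from acting twice.\<close>

lemma foldr_model_W_basis:
  assumes "\<alpha> \<in> mw" "\<beta> \<in> mw" "distinct is" "set is \<subseteq> {1..k}"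
  shows "foldr (\<lambda>i. (\<circ>) (word_op (model_W a m i) (\<alpha> i))) is id (basis \<beta>) =
    basis (\<lambda>i. if i \<in> set is then \<alpha> i @ \<beta> i else \<beta> i)"
  using assms(3,4)
proof (induction "is")
  case (Cons i "is")
  let ?\<gamma> = "\<lambda>i. if i \<in> set is then \<alpha> i @ \<beta> i else \<beta> i"
  have i: "i \<in> {1..k}" "i \<notin> set is"
    using Cons.prems by auto
  have "?\<gamma> \<in> mw"
    using assms(1,2) Cons.prems unfolding multi_words_def by (auto simp: PiE_iff extensional_def)
  moreover have "?\<gamma>(i := \<alpha> i @ ?\<gamma> i) = (\<lambda>l. if l \<in> set (i # is) then \<alpha> l @ \<beta> l else \<beta> l)"
    using i by (auto simp: fun_eq_iff)
  ultimately show ?case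
    using Cons word_model_W_basis[OF i(1) mw_nth[OF assms(1) i(1)], of ?\<gamma>] by simp
qed simp

lemma multi_word_model_W_basis:
  assumes "\<alpha> \<in> mw" "\<beta> \<in> mw"
  shows "multi_word_op k (model_W a m) \<alpha> (basis \<beta>) = basis (mapp \<alpha> \<beta>)"
proof -
  have "(\<lambda>i. if i \<in> set [1..<Suc k] then \<alpha> i @ \<beta> i else \<beta> i) = mapp \<alpha> \<beta>"
    using mw_outside[OF assms(2)] by (auto simp: mapp_def fun_eq_iff)
  moreover have "set [1..<Suc k] \<subseteq> {1..k}"
    by auto
  ultimately show ?thesis
    using foldr_model_W_basis[OF assms distinct_upt, of 1 "Suc k"] unfolding multi_word_op_def
    by metis
qed

lemma linear_multi_word_model_W:
  assumes "\<alpha> \<in> mw"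
  shows "linear_within (fock_tensor k n) (multi_word_op k (model_W a m) \<alpha>)"
  unfolding multi_word_op_def
proof (rule linear_within_foldr)
  fix i assume "i \<in> set [1..<Suc k]"
  then have i: "i \<in> {1..k}" by auto
  show "linear_within (fock_tensor k n) (word_op (model_W a m i) (\<alpha> i))"
    unfolding word_op_def
    by (rule linear_within_foldr, rule linear_model_W[OF i]) (use mw_nth[OF assms i] in auto)
qed

lemma vacuum_basis: "vacuum k = basis (\<lambda>i\<in>{1..k}. [])"
  by (simp add: vacuum_def basis_def bw_empty)

text \<open>On the normalised basis words act by concatenation, so a generator of
  \<open>M\<^sub>Q\<close> is the polynomial \<open>q\<close> with each monomial framed by
  \<open>\<alpha>'\<close> and \<open>\<beta>\<close>.\<close>

lemma model_generator:
  assumes "\<alpha>' \<in> mw" "\<beta> \<in> mw" "q \<in> nc_polys k n"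
  shows "multi_word_op k (model_W a m) \<alpha>' (poly_op k (model_W a m) q
      (multi_word_op k (model_W a m) \<beta> (c *\<^sub>C vacuum k))) =
    c *\<^sub>C (\<Sum>\<alpha>\<in>Poly_Mapping.keys q. Poly_Mapping.lookup q \<alpha> *\<^sub>C basis (mapp \<alpha>' (mapp \<alpha> \<beta>)))"
proof -
  note lin = linear_multi_word_model_W
  have scale: "multi_word_op k (model_W a m) \<alpha> (d *\<^sub>C \<xi>) = d *\<^sub>C multi_word_op k (model_W a m) \<alpha> \<xi>"
    if "\<alpha> \<in> mw" "\<xi> \<in> fock_tensor k n" for \<alpha> d \<xi>
    using lin[OF that(1)] that(2) unfolding linear_within_def by blast
  have keys: "\<alpha> \<in> mw" if "\<alpha> \<in> Poly_Mapping.keys q" for \<alpha>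
    using assms(3) that unfolding nc_polys_def by blast
  have "multi_word_op k (model_W a m) \<beta> (c *\<^sub>C vacuum k) = c *\<^sub>C basis \<beta>"
    unfolding vacuum_basis scale[OF assms(2) basis_fock_tensor[OF mw_empty]]
      multi_word_model_W_basis[OF assms(2) mw_empty] mapp_empty(1)[OF assms(2)] ..
  then have "poly_op k (model_W a m) q (multi_word_op k (model_W a m) \<beta> (c *\<^sub>C vacuum k)) =
      (\<Sum>\<alpha>\<in>Poly_Mapping.keys q. (c * Poly_Mapping.lookup q \<alpha>) *\<^sub>C basis (mapp \<alpha> \<beta>))"
    unfolding poly_op_def
    by (intro sum.cong) (simp_all add: scale keys assms basis_fock_tensor multi_word_model_W_basis
        scaleC_scaleC mult.commute)
  then have "multi_word_op k (model_W a m) \<alpha>' (poly_op k (model_W a m) q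
      (multi_word_op k (model_W a m) \<beta> (c *\<^sub>C vacuum k))) =
    (\<Sum>\<alpha>\<in>Poly_Mapping.keys q. (c * Poly_Mapping.lookup q \<alpha>) *\<^sub>C
      multi_word_op k (model_W a m) \<alpha>' (basis (mapp \<alpha> \<beta>)))"
    by (simp add: linear_within_sum[OF lin[OF assms(1)] csubspace_fock_tensor] basis_fock_tensor
        mw_mapp keys assms)
  also have "\<dots> = c *\<^sub>C (\<Sum>\<alpha>\<in>Poly_Mapping.keys q. Poly_Mapping.lookup q \<alpha> *\<^sub>C basis (mapp \<alpha>' (mapp \<alpha> \<beta>)))"
    unfolding complex_vector.scale_sum_right
    by (intro sum.cong) (simp_all add: multi_word_model_W_basis assms mw_mapp keys scaleC_scaleC)
  finally show ?thesis .
qed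

text \<open>The pairing of \<open>\<xi>\<close> with the generator \<open>W\<^sub>\<alpha>\<^sub>' q(W) W\<^sub>\<beta> 1\<close> of \<open>M\<^sub>Q\<close>; in this form it also makes
  sense for vector-valued \<open>\<xi>\<close>.\<close>

definition pairing ::
    "nc_poly \<Rightarrow> (nat \<Rightarrow> nat list) \<Rightarrow> (nat \<Rightarrow> nat list) \<Rightarrow> (nat \<Rightarrow> nat list, 'h::complex_hilbert_space) ell2 \<Rightarrow> 'h"
  where "pairing q \<alpha>' \<beta> \<xi> =
    (\<Sum>\<alpha>\<in>Poly_Mapping.keys q. cnj (Poly_Mapping.lookup q \<alpha>) *\<^sub>C hat \<xi> (mapp \<alpha>' (mapp \<alpha> \<beta>)))"

definition variety_space ::
    "nc_poly set \<Rightarrow> 'h set \<Rightarrow> (nat \<Rightarrow> nat list, 'h::complex_hilbert_space) ell2 set"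
  where "variety_space Q D = {\<xi>. (\<forall>\<beta>. \<beta> \<notin> mw \<longrightarrow> Rep_ell2 \<xi> \<beta> = 0) \<and> (\<forall>\<beta>. Rep_ell2 \<xi> \<beta> \<in> D) \<and>
    (\<forall>q\<in>Q. \<forall>\<alpha>'\<in>mw. \<forall>\<beta>\<in>mw. pairing q \<alpha>' \<beta> \<xi> = 0)}"

lemma bounded_linear_hat: "bounded_linear (\<lambda>\<xi>. hat \<xi> \<beta>)"
  unfolding hat_def
  by (rule bounded_linear_compose[OF bounded_linear_scaleR_right bounded_linear_Rep_ell2])

lemma bounded_linear_pairing: "bounded_linear (pairing q \<alpha>' \<beta>)"
  unfolding pairing_def[abs_def]
  by (intro bounded_linear_sum bounded_linear_compose[OF bounded_linear_scaleC bounded_linear_hat])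

lemma hat_scaleC: "hat (c *\<^sub>C \<xi>) \<beta> = c *\<^sub>C hat \<xi> \<beta>"
  by (simp add: hat_def scaleC_ell2.rep_eq scaleR_scaleC_commute)

lemma pairing_scaleC: "pairing q \<alpha>' \<beta> (c *\<^sub>C \<xi>) = c *\<^sub>C pairing q \<alpha>' \<beta> \<xi>"
  by (simp add: pairing_def hat_scaleC complex_vector.scale_sum_right scaleC_scaleC mult.commute)

lemma csubspace_variety_space:
  fixes D :: "'h::complex_hilbert_space set"
  assumes "csubspace D"
  shows "csubspace (variety_space Q D)"
proof (rule complex_vector.subspaceI)
  note lin = bounded_linear.linear[OF bounded_linear_pairing]
  show "0 \<in> variety_space Q D"
    using complex_vector.subspace_0[OF assms] by (auto simp: variety_space_def zero_ell2.rep_eq linear_0[OF lin])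
  show "\<xi> + \<eta> \<in> variety_space Q D" if "\<xi> \<in> variety_space Q D" "\<eta> \<in> variety_space Q D" for \<xi> \<eta>
    using that complex_vector.subspace_add[OF assms]
    by (auto simp: variety_space_def plus_ell2.rep_eq linear_add[OF lin])
  show "c *\<^sub>C \<xi> \<in> variety_space Q D" if "\<xi> \<in> variety_space Q D" for c \<xi>
    using that complex_vector.subspace_scale[OF assms]
    by (auto simp: variety_space_def scaleC_ell2.rep_eq pairing_scaleC)
qed

lemma closed_variety_space:
  fixes D :: "'h::complex_hilbert_space set"
  assumes "closed D"
  shows "closed (variety_space Q D)"
proof -
  have cont: "continuous_on UNIV (\<lambda>\<xi> :: (nat \<Rightarrow> nat list, 'h) ell2. Rep_ell2 \<xi> \<beta>)" for \<beta>
    by (rule bounded_linear.continuous_on[OF bounded_linear_Rep_ell2 continuous_on_id])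
  have cont': "continuous_on UNIV (pairing q \<alpha>' \<beta> :: _ \<Rightarrow> 'h)" for q \<alpha>' \<beta>
    by (rule bounded_linear.continuous_on[OF bounded_linear_pairing continuous_on_id])
  have eq: "variety_space Q D = (\<Inter>\<beta>\<in>-mw. {\<xi>. Rep_ell2 \<xi> \<beta> = 0}) \<inter> (\<Inter>\<beta>. (\<lambda>\<xi>. Rep_ell2 \<xi> \<beta>) -` D) \<inter>
      (\<Inter>q\<in>Q. \<Inter>\<alpha>'\<in>mw. \<Inter>\<beta>\<in>mw. {\<xi>. pairing q \<alpha>' \<beta> \<xi> = 0})"
    by (auto simp: variety_space_def)
  show ?thesis
    unfolding eq
    by (intro closed_Int closed_INT ballI)
      (auto intro!: closed_Collect_eq cont cont' closed_vimage assms)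
qed

text \<open>Orthogonality to a closed span is tested on generators, where the scalar multiple of the
  vacuum may be taken to be the vacuum itself.\<close>

lemma space_N_eq:
  assumes Q: "Q \<subseteq> nc_polys k n"
  shows "space_N k n a m Q = variety_space Q UNIV"
proof -
  let ?gen = "\<lambda>q \<alpha>' \<beta>. \<Sum>\<alpha>\<in>Poly_Mapping.keys q. Poly_Mapping.lookup q \<alpha> *\<^sub>C basis (mapp \<alpha>' (mapp \<alpha> \<beta>))"
  have pair: "cinner \<xi> (?gen q \<alpha>' \<beta>) = pairing q \<alpha>' \<beta> \<xi>" for \<xi> q \<alpha>' \<beta>
    by (simp add: pairing_def cinner.sum_right cinner_scaleC_right cinner_basis scaleC_complex_def)
  let ?S = "{multi_word_op k (model_W a m) \<alpha> (poly_op k (model_W a m) q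
        (multi_word_op k (model_W a m) \<beta> (c *\<^sub>C vacuum k))) | \<alpha> q \<beta> c. \<alpha> \<in> mw \<and> \<beta> \<in> mw \<and> q \<in> Q}"
  have gen: "multi_word_op k (model_W a m) \<alpha>' (poly_op k (model_W a m) q
      (multi_word_op k (model_W a m) \<beta> (c *\<^sub>C vacuum k))) = c *\<^sub>C ?gen q \<alpha>' \<beta>"
    if "q \<in> Q" "\<alpha>' \<in> mw" "\<beta> \<in> mw" for q \<alpha>' \<beta> c
    using that Q by (intro model_generator) auto
  have "(\<forall>\<eta>\<in>space_M k n a m Q. cinner \<xi> \<eta> = 0) \<longleftrightarrow> (\<forall>q\<in>Q. \<forall>\<alpha>'\<in>mw. \<forall>\<beta>\<in>mw. pairing q \<alpha>' \<beta> \<xi> = 0)" for \<xi>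
  proof
    assume *: "\<forall>\<eta>\<in>space_M k n a m Q. cinner \<xi> \<eta> = 0"
    show "\<forall>q\<in>Q. \<forall>\<alpha>'\<in>mw. \<forall>\<beta>\<in>mw. pairing q \<alpha>' \<beta> \<xi> = 0"
    proof (intro ballI)
      fix q \<alpha>' \<beta> assume "q \<in> Q" "\<alpha>' \<in> mw" "\<beta> \<in> mw"
      moreover from this have "?gen q \<alpha>' \<beta> = multi_word_op k (model_W a m) \<alpha>' (poly_op k (model_W a m) q
          (multi_word_op k (model_W a m) \<beta> (1 *\<^sub>C vacuum k)))"
        using gen[of q \<alpha>' \<beta> 1] by simp
      ultimately have "?gen q \<alpha>' \<beta> \<in> ?S"
        by blast
      then have "?gen q \<alpha>' \<beta> \<in> space_M k n a m Q"
        unfolding space_M_def by (rule subsetD[OF closure_subset complex_vector.span_base])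
      with * have "cinner \<xi> (?gen q \<alpha>' \<beta>) = 0"
        by (rule bspec)
      then show "pairing q \<alpha>' \<beta> \<xi> = 0"
        by (simp only: pair)
    qed
  next
    assume *: "\<forall>q\<in>Q. \<forall>\<alpha>'\<in>mw. \<forall>\<beta>\<in>mw. pairing q \<alpha>' \<beta> \<xi> = 0"
    have "space_M k n a m Q \<subseteq> {\<eta>. cinner \<xi> \<eta> = 0}"
      unfolding space_M_def
    proof (rule closure_cspan_subset)
      show "?S \<subseteq> {\<eta>. cinner \<xi> \<eta> = 0}"
        using * by (auto simp: gen cinner_scaleC_right pair)
      show "csubspace {\<eta>. cinner \<xi> \<eta> = 0}"
        by (rule complex_vector.subspaceI) (auto simp: cinner_add_right cinner_scaleC_right)
      show "closed {\<eta>. cinner \<xi> \<eta> = 0}"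
        by (intro closed_Collect_eq continuous_intros cinner.continuous_on)
    qed
    then show "\<forall>\<eta>\<in>space_M k n a m Q. cinner \<xi> \<eta> = 0" by blast
  qed
  then show ?thesis
    unfolding space_N_def variety_space_def fock_tensor_def by auto
qed

lemma hat_tens: "hat (x \<otimes>\<^sub>h d) \<beta> = hat x \<beta> *\<^sub>C d"
  by (simp add: hat_def tens.rep_eq scaleC_scaleC scaleR_conv_of_real flip: scaleC_of_real)

lemma pairing_tens: "pairing q \<alpha>' \<beta> (x \<otimes>\<^sub>h d) = pairing q \<alpha>' \<beta> x *\<^sub>C d"
  by (simp add: pairing_def hat_tens complex_vector.scale_sum_left scaleC_scaleC scaleC_complex_def)

text \<open>For the inclusion from right to left, the residual \<open>r\<close> of a projection onto the tensor product has
  its slices \<open>(\<langle>r\<^sub>\<beta>, d\<rangle>)\<^sub>\<beta>\<close> in \<open>N\<^sub>Q\<close>, so it is orthogonal to these slices tensored with \<open>d\<close>.\<close>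

lemma tensor_space_eq:
  fixes D :: "'h::complex_hilbert_space set"
  assumes D: "closed D" "csubspace D"
  shows "tensor_space (variety_space Q UNIV) D = variety_space Q D"
proof
  show sub: "tensor_space (variety_space Q UNIV) D \<subseteq> variety_space Q D"
    unfolding tensor_space_def
  proof (rule closure_cspan_subset[OF _ csubspace_variety_space[OF D(2)] closed_variety_space[OF D(1)]])
    show "{x \<otimes>\<^sub>h d | x d. x \<in> variety_space Q UNIV \<and> d \<in> D} \<subseteq> variety_space Q D"
      using complex_vector.subspace_scale[OF D(2)]
      by (auto simp: variety_space_def tens.rep_eq pairing_tens)
  qed
  show "variety_space Q D \<subseteq> tensor_space (variety_space Q UNIV) D"
  proof
    fix \<xi> assume \<xi>: "\<xi> \<in> variety_space Q D"
    let ?T = "tensor_space (variety_space Q UNIV) D"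
    have T: "closed ?T" "csubspace ?T"
      by (simp_all add: tensor_space_def csubspace_closure_cspan)
    obtain y where y: "y \<in> ?T" "\<And>z. z \<in> ?T \<Longrightarrow> cinner (\<xi> - y) z = 0"
      using orthogonal_projection_exists[OF T] by blast
    define r where "r = \<xi> - y"
    have r: "r \<in> variety_space Q D"
      unfolding r_def using \<xi> y(1) sub
      by (intro complex_vector.subspace_diff[OF csubspace_variety_space[OF D(2)]]) auto
    have "cinner (Rep_ell2 r \<beta>) d = 0" if d: "d \<in> D" for d \<beta>
    proof -
      \<comment> \<open>Cauchy-Schwarz in each coordinate makes the slice along \<open>d\<close>
        square-summable.\<close>
      have "(\<Sum>\<beta>\<in>F. (norm (cinner (Rep_ell2 r \<beta>) d))\<^sup>2) \<le> (norm d * norm r)\<^sup>2" if "finite F" for F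
      proof -
        have "(\<Sum>\<beta>\<in>F. (norm (cinner (Rep_ell2 r \<beta>) d))\<^sup>2) \<le> (\<Sum>\<beta>\<in>F. (norm d)\<^sup>2 * (norm (Rep_ell2 r \<beta>))\<^sup>2)"
          using power_mono[OF cmod_cinner_le norm_ge_zero, of _ d 2]
          by (intro sum_mono) (simp add: power_mult_distrib mult.commute[of "(norm d)\<^sup>2"])
        also have "\<dots> \<le> (norm d * norm r)\<^sup>2"
          using mult_left_mono[OF ell2_finite_le[OF that, of r], of "(norm d)\<^sup>2"]
          by (simp add: sum_distrib_left power_mult_distrib)
        finally show ?thesis .
      qed
      then obtain s where s: "Rep_ell2 s = (\<lambda>\<beta>. cinner (Rep_ell2 r \<beta>) d)"
        by (rule ell2_finite_leI[of "\<lambda>\<beta>. cinner (Rep_ell2 r \<beta>) d" "norm d * norm r"]) auto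
      have hat_s: "hat s \<beta> = cinner (hat r \<beta>) d" for \<beta>
        by (simp add: hat_def s cinner_scaleR_left scaleR_conv_of_real)
      have "pairing q \<alpha>' \<beta> s = cinner (pairing q \<alpha>' \<beta> r) d" for q \<alpha>' \<beta>
        by (simp add: pairing_def hat_s cinner.sum_left cinner_scaleC_left scaleC_complex_def)
      then have "s \<in> variety_space Q UNIV"
        using r by (simp add: variety_space_def s)
      then have "s \<otimes>\<^sub>h d \<in> ?T"
        unfolding tensor_space_def using d
        by (intro subsetD[OF closure_subset] complex_vector.span_base) blast
      then have "cinner r (s \<otimes>\<^sub>h d) = 0"
        using y(2) by (simp add: r_def)
      moreover have "cinner r (s \<otimes>\<^sub>h d) = cinner s s"
        unfolding cinner_ell2.rep_eq
        by (rule infsum_cong) (simp add: s tens.rep_eq cinner_scaleC_right cinner_complex_def)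
      ultimately have "s = 0" by simp
      then show ?thesis
        using s by (metis zero_ell2.rep_eq)
    qed
    moreover have "Rep_ell2 r \<beta> \<in> D" for \<beta>
      using r by (simp add: variety_space_def)
    ultimately have "Rep_ell2 r \<beta> = 0" for \<beta>
      using cinner_eq_zero_iff by blast
    then have "r = 0"
      by (intro ell2_eqI) (simp add: zero_ell2.rep_eq)
    then show "\<xi> \<in> ?T"
      using y(1) by (simp add: r_def)
  qed
qed

section \<open>Adjoints of the compressed operators\<close>

context
  fixes i j :: nat
  assumes i: "i \<in> {1..k}" and j: "j \<in> {1..n i}"
begin

text \<open>The letter that the adjoint strips off is absorbed into the left word
  \<open>\<alpha>'\<close>. Since all left words occur in the defining equations, the variety space
  is invariant.\<close>

lemma pairing_wadj:
  assumes "q \<in> nc_polys k n" "\<alpha>' \<in> mw" "\<beta> \<in> mw"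
  shows "pairing q \<alpha>' \<beta> (wadj i j \<xi>) = pairing q (push i j \<alpha>') \<beta> \<xi>"
  unfolding pairing_def
proof (rule sum.cong)
  fix \<alpha> assume "\<alpha> \<in> Poly_Mapping.keys q"
  then have "mapp \<alpha>' (mapp \<alpha> \<beta>) \<in> mw"
    using assms unfolding nc_polys_def by (intro mw_mapp) auto
  then show "cnj (Poly_Mapping.lookup q \<alpha>) *\<^sub>C hat (wadj i j \<xi>) (mapp \<alpha>' (mapp \<alpha> \<beta>)) =
      cnj (Poly_Mapping.lookup q \<alpha>) *\<^sub>C hat \<xi> (mapp (push i j \<alpha>') (mapp \<alpha> \<beta>))"
    by (simp add: hat_wadj[OF i j] push_mapp[OF i])
qed simp

lemma wadj_variety_space:
  assumes Q: "Q \<subseteq> nc_polys k n" and D: "csubspace D" and \<xi>: "\<xi> \<in> variety_space Q D"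
  shows "wadj i j \<xi> \<in> variety_space Q D"
proof -
  have "Rep_ell2 (wadj i j \<xi>) \<beta> \<in> D" for \<beta>
    using \<xi> complex_vector.subspace_0[OF D] complex_vector.subspace_scale[OF D]
    by (auto simp: Rep_wadj[OF i j] variety_space_def simp flip: scaleC_of_real)
  moreover have "pairing q \<alpha>' \<beta> (wadj i j \<xi>) = 0" if "q \<in> Q" "\<alpha>' \<in> mw" "\<beta> \<in> mw" for q \<alpha>' \<beta>
    using \<xi> that Q mw_push[OF that(2) i j] by (subst pairing_wadj) (auto simp: variety_space_def)
  ultimately show ?thesis
    by (auto simp: variety_space_def Rep_wadj[OF i j])
qed

text \<open>The candidate lies in \<open>N\<^sub>Q\<close> by invariance, and against vectors of
  \<open>N\<^sub>Q\<close> the projection inside \<open>model_S\<close> has no effect.\<close>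

lemma cadjoint_model_S:
  assumes Q: "Q \<subseteq> nc_polys k n" and \<xi>: "\<xi> \<in> space_N k n a m Q"
  shows "cadjoint_on (space_N k n a m Q) (model_S k n a m Q i j) \<xi> = wadj i j \<xi>"
proof -
  let ?N = "space_N k n a m Q"
  have N: "closed ?N" "csubspace ?N"
    unfolding space_N_eq[OF Q]
    by (simp_all add: closed_variety_space csubspace_variety_space complex_vector.subspace_UNIV)
  have "wadj i j \<xi> \<in> ?N"
    using \<xi> unfolding space_N_eq[OF Q] by (intro wadj_variety_space Q) (simp_all add: complex_vector.subspace_UNIV)
  moreover have "cinner (wadj i j \<xi>) z = cinner \<xi> (model_S k n a m Q i j z)" if "z \<in> ?N" for z
  proof -
    have "z \<in> fock_tensor k n"
      using that by (simp add: space_N_def)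
    then show ?thesis
      unfolding model_S_def by (simp add: cinner_cproj[OF N \<xi>] cinner_wadj[OF i j])
  qed
  moreover have "x = y"
    if "x \<in> ?N" "y \<in> ?N" "\<And>z. z \<in> ?N \<Longrightarrow> cinner x z = cinner y z" for x y
  proof -
    have "x - y \<in> ?N"
      by (rule complex_vector.subspace_diff[OF N(2) that(1,2)])
    then have "cinner (x - y) (x - y) = 0"
      using that(3) by (simp add: cinner.diff_left)
    then show ?thesis by simp
  qed
  ultimately show ?thesis
    unfolding cadjoint_on_def by (intro the_equality) (blast, metis)
qed

lemma wadj_tens: "wadj i j (x \<otimes>\<^sub>h d) = wadj i j x \<otimes>\<^sub>h d"
  by (rule ell2_eqI)
    (simp add: Rep_wadj[OF i j] tens.rep_eq scaleR_conv_of_real scaleC_scaleC flip: scaleC_of_real)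

text \<open>\<open>tensor_id\<close> is a definite description. Existence comes from
  \<open>wadj\<close> cut off outside the tensor product, uniqueness from density of the span of
  elementary tensors.\<close>

lemma model_S_adj_tensor_eq:
  fixes D :: "'h::complex_hilbert_space set"
  assumes Q: "Q \<subseteq> nc_polys k n" and D: "closed D" "csubspace D"
    and \<xi>: "\<xi> \<in> tensor_space (space_N k n a m Q) D"
  shows "model_S_adj_tensor k n a m Q D i j \<xi> = wadj i j \<xi>"
proof -
  let ?N = "space_N k n a m Q" and ?A = "cadjoint_on (space_N k n a m Q) (model_S k n a m Q i j)"
  let ?T = "tensor_space ?N D"
  define R where "R \<xi> = (if \<xi> \<in> ?T then wadj i j \<xi> else 0)" for \<xi> :: "(nat \<Rightarrow> nat list, 'h) ell2"
  let ?gen = "{x \<otimes>\<^sub>h d | x d. x \<in> ?N \<and> d \<in> D}"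
  have T: "csubspace ?T"
    by (simp add: tensor_space_def csubspace_closure_cspan)
  have gen: "x \<otimes>\<^sub>h d \<in> ?T" if "x \<in> ?N" "d \<in> D" for x d
    unfolding tensor_space_def using that
    by (intro subsetD[OF closure_subset] complex_vector.span_base) blast
  obtain B where B: "\<And>\<xi> :: (nat \<Rightarrow> nat list, 'h) ell2. norm (wadj i j \<xi>) \<le> B * norm \<xi>"
    using norm_wadj[OF i j] by blast
  have R_bounded: "bounded_op_on ?T R"
    unfolding bounded_op_on_def
  proof (intro conjI exI ballI allI)
    fix \<xi> \<eta> c assume "\<xi> \<in> ?T"
    then show "R (c *\<^sub>C \<xi>) = c *\<^sub>C R \<xi>" "norm (R \<xi>) \<le> B * norm \<xi>"
      by (simp_all add: R_def complex_vector.subspace_scale[OF T] bounded_op_scaleC[OF bounded_wadj[OF i j]] B)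
    assume "\<eta> \<in> ?T"
    with \<open>\<xi> \<in> ?T\<close> show "R (\<xi> + \<eta>) = R \<xi> + R \<eta>"
      by (simp add: R_def complex_vector.subspace_add[OF T] bounded_op_add[OF bounded_wadj[OF i j]])
  qed
  have R_tens: "R (x \<otimes>\<^sub>h d) = ?A x \<otimes>\<^sub>h d" if "x \<in> ?N" "d \<in> D" for x d
    using that by (simp add: R_def gen cadjoint_model_S[OF Q] wadj_tens)
  have R_unique: "R' = R" if R': "bounded_op_on ?T R'" "\<And>x d. x \<in> ?N \<Longrightarrow> d \<in> D \<Longrightarrow> R' (x \<otimes>\<^sub>h d) = ?A x \<otimes>\<^sub>h d"
    "\<And>\<xi>. \<xi> \<notin> ?T \<Longrightarrow> R' \<xi> = 0" for R'
  proof
    fix \<xi>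
    show "R' \<xi> = R \<xi>"
    proof (cases "\<xi> \<in> ?T")
      case True
      have add: "R' (x + y) = R' x + R' y" and scale: "R' (c *\<^sub>C x) = c *\<^sub>C R' x"
        if "x \<in> ?T" "y \<in> ?T" for x y c
        using R'(1) that unfolding bounded_op_on_def by blast+
      obtain C where C: "\<And>x. x \<in> ?T \<Longrightarrow> norm (R' x) \<le> C * norm x"
        using R'(1) unfolding bounded_op_on_def by blast
      have span: "x \<in> ?T \<and> R' x = wadj i j x" if "x \<in> cspan ?gen" for x
        using that
      proof (induction rule: complex_vector.span_induct_alt)
        case base
        have "R' 0 = 0"
          using scale[of 0 0 0] complex_vector.subspace_0[OF T] by simp
        then show ?case
          using complex_vector.subspace_0[OF T] linear_0[OF bounded_linear.linear[OF
              bounded_op_linear[OF bounded_wadj[OF i j]]]] by metis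
      next
        case (step c x y)
        then obtain u d where ud: "x = u \<otimes>\<^sub>h d" "u \<in> ?N" "d \<in> D" by blast
        then have x: "x \<in> ?T" "R' x = wadj i j x"
          using R'(2) by (simp_all add: gen cadjoint_model_S[OF Q] wadj_tens)
        then show ?case
          using step complex_vector.subspace_scale[OF T x(1), of c]
          by (simp add: complex_vector.subspace_add[OF T] add scale bounded_op_add[OF bounded_wadj[OF i j]]
              bounded_op_scaleC[OF bounded_wadj[OF i j]])
      qed
      obtain f where f: "\<And>p. f p \<in> cspan ?gen" "f \<longlonglongrightarrow> \<xi>"
        using True unfolding tensor_space_def closure_sequential by blast
      \<comment> \<open>\<open>R'\<close> is bounded only on \<open>?T\<close>, so continuity at
        \<open>\<xi>\<close> is argued through the differences \<open>f p - \<xi>\<close>, which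
        stay in \<open>?T\<close>.\<close>
      have "(\<lambda>p. C * norm (f p - \<xi>)) \<longlonglongrightarrow> C * norm (\<xi> - \<xi>)"
        by (intro tendsto_intros f)
      then have lim: "(\<lambda>p. C * norm (f p - \<xi>)) \<longlonglongrightarrow> 0"
        by simp
      have "norm (R' (f p) - R' \<xi>) \<le> C * norm (f p - \<xi>)" for p
      proof -
        have fp: "f p \<in> ?T" using span[OF f(1)] by blast
        have "f p - \<xi> \<in> ?T"
          using complex_vector.subspace_diff[OF T] fp True by blast
        then have "R' (f p - \<xi> + \<xi>) = R' (f p - \<xi>) + R' \<xi>"
          using add True by blast
        then show ?thesis
          using C[OF \<open>f p - \<xi> \<in> ?T\<close>] by simp
      qed
      then have "(\<lambda>p. R' (f p) - R' \<xi>) \<longlonglongrightarrow> 0"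
        by (rule Lim_null_comparison[OF always_eventually[OF allI] lim])
      then have "(\<lambda>p. R' (f p)) \<longlonglongrightarrow> R' \<xi>"
        by (rule LIM_zero_cancel)
      moreover have "(\<lambda>p. R' (f p)) \<longlonglongrightarrow> wadj i j \<xi>"
        using bounded_linear.tendsto[OF bounded_op_linear[OF bounded_wadj[OF i j]] f(2)] span[OF f(1)] by simp
      ultimately show ?thesis
        using True LIMSEQ_unique[of "\<lambda>p. R' (f p)" "R' \<xi>" "wadj i j \<xi>"] by (simp add: R_def)
    qed (simp add: R_def R'(3))
  qed
  have "tensor_id ?N D ?A = R"
    unfolding tensor_id_def
  proof (rule the_equality)
    show "bounded_op_on ?T R \<and> (\<forall>x\<in>?N. \<forall>d\<in>D. R (x \<otimes>\<^sub>h d) = ?A x \<otimes>\<^sub>h d) \<and> (\<forall>\<xi>. \<xi> \<notin> ?T \<longrightarrow> R \<xi> = 0)"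
      using R_bounded R_tens by (simp add: R_def)
  qed (rule R_unique, blast+)
  then show ?thesis
    using \<xi> by (simp add: model_S_adj_tensor_def R_def)
qed

end

end

section \<open>Compressions of the model\<close>

lemma bounded_foldr_op:
  "(\<And>i. i \<in> set is \<Longrightarrow> bounded_op (A i)) \<Longrightarrow> bounded_op (foldr (\<lambda>i. (\<circ>) (A i)) is id)"
  by (induction "is") (auto simp: bounded_op_id intro: bounded_op_comp)

text \<open>Dominated convergence: the family for \<open>s\<close> lives on indices with
  \<open>len x \<ge> s\<close>, and these eventually avoid any finite set carrying all but
  \<open>e\<close> of the majorant.\<close>

lemma has_sum_dominated_null:
  fixes f :: "nat \<Rightarrow> 'a \<Rightarrow> real"
  assumes g: "(g has_sum G) A" and f: "\<And>s. (f s has_sum F s) A"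
    and bound: "\<And>s x. x \<in> A \<Longrightarrow> 0 \<le> f s x \<and> f s x \<le> g x"
    and zero: "\<And>s x. x \<in> A \<Longrightarrow> len x < s \<Longrightarrow> f s x = 0"
  shows "F \<longlonglongrightarrow> 0"
proof (rule LIMSEQ_I)
  fix e :: real assume "0 < e"
  then have "G - e < G" by simp
  then obtain B where B: "finite B" "B \<subseteq> A" "G - e < sum g B"
    using order_tendstoD(1)[OF g[unfolded has_sum_def], of "G - e"]
    unfolding eventually_finite_subsets_at_top by blast
  obtain N where N: "\<And>x. x \<in> B \<Longrightarrow> len x < N"
    using B(1) by (metis Max_ge finite_imageI image_eqI le_imp_less_Suc)
  have "norm (F s - 0) < e" if "s \<ge> N" for s
  proof -
    have "(f s has_sum F s) (A - B)"
      by (rule has_sum_cong_neutral[THEN iffD1, OF _ _ _ f[of s]])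
        (use zero N B(2) that in \<open>fastforce+\<close>)
    moreover have "(g has_sum (G - sum g B)) (A - B)"
      by (rule has_sum_Diff[OF g has_sum_finite[OF B(1)] B(2)])
    ultimately have "F s \<le> G - sum g B"
      by (rule has_sum_mono) (use bound in auto)
    moreover have "0 \<le> F s"
      by (rule has_sum_nonneg[OF f]) (use bound in auto)
    ultimately show ?thesis
      using B(3) by simp
  qed
  then show "\<exists>N. \<forall>s\<ge>N. norm (F s - 0) < e" by blast
qed

locale model_tuple = model k n m a
  for k :: nat and n m :: "nat \<Rightarrow> nat" and a :: "nat \<Rightarrow> nat list \<Rightarrow> real" +
  fixes T :: "nat \<Rightarrow> nat \<Rightarrow> 'h \<Rightarrow> 'h::complex_hilbert_space"
  assumes T: "T \<in> cross_commuting k n"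
    and Phi: "\<And>i. i \<in> {1..k} \<Longrightarrow> phi_well_defined (n i) (a i) (T i)"
begin

lemma bounded_T: "i \<in> {1..k} \<Longrightarrow> j \<in> {1..n i} \<Longrightarrow> bounded_op (T i j)"
  using T unfolding cross_commuting_def by blast

lemma row: "i \<in> {1..k} \<Longrightarrow> row (n i) (a i) (T i)"
  using regular[of i] bounded_T[of i] Phi[of i] unfolding row_def positive_regular_def by blast

abbreviation \<Phi> :: "nat \<Rightarrow> ('h \<Rightarrow> 'h) \<Rightarrow> 'h \<Rightarrow> 'h"
  where "\<Phi> i \<equiv> phi (n i) (a i) (T i)"

abbreviation residual :: "nat \<Rightarrow> ('h \<Rightarrow> 'h) \<Rightarrow> 'h \<Rightarrow> 'h"
  where "residual i \<equiv> \<lambda>Y x. Y x - \<Phi> i Y x"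

abbreviation Ts :: "nat \<Rightarrow> nat list \<Rightarrow> 'h \<Rightarrow> 'h"
  where "Ts i \<alpha> \<equiv> cadjoint (word_op (T i) \<alpha>)"

lemma bounded_word_T: "i \<in> {1..k} \<Longrightarrow> \<alpha> \<in> lists {1..n i} \<Longrightarrow> bounded_op (word_op (T i) \<alpha>)"
  by (rule row.bounded_word[OF row])

lemma bounded_foldr_T:
  "\<alpha> \<in> mw \<Longrightarrow> set is \<subseteq> {1..k} \<Longrightarrow> bounded_op (foldr (\<lambda>i. (\<circ>) (word_op (T i) (\<alpha> i))) is id)"
  by (rule bounded_foldr_op) (use bounded_word_T mw_nth in blast)

lemma bounded_multi_word_T: "\<alpha> \<in> mw \<Longrightarrow> bounded_op (multi_word_op k T \<alpha>)"
  unfolding multi_word_op_def by (rule bounded_foldr_T) auto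

lemma bounded_foldr_defect:
  "set is \<subseteq> {1..k} \<Longrightarrow> bounded_op Y \<Longrightarrow> bounded_op (foldr (\<lambda>i. (\<circ>) (residual i ^^ p i)) is id Y)"
  by (induction "is") (auto simp: row.bounded_residual_pow[OF row])

lemma bounded_defect: "bounded_op (defect k n a T p id)"
  unfolding defect_def by (rule bounded_foldr_defect) (auto simp: bounded_op_id)

lemma defect_space: "closed (defect_space k n a m T)" "csubspace (defect_space k n a m T)"
  unfolding defect_space_def by (simp_all add: csubspace_closure csubspace_range bounded_defect)

end

text \<open>What an intertwining unitary provides, with coefficients in an arbitrary Hilbert space:
  an isometry into the vector-valued \<open>N\<^sub>Q\<close> under which the adjoints of
  \<open>T\<close> become backward shifts.\<close>

locale compression = model_tuple k n m a T
  for k :: nat and n m :: "nat \<Rightarrow> nat" and a :: "nat \<Rightarrow> nat list \<Rightarrow> real"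
    and T :: "nat \<Rightarrow> nat \<Rightarrow> 'h \<Rightarrow> 'h::complex_hilbert_space" +
  fixes V :: "'h \<Rightarrow> (nat \<Rightarrow> nat list, 'g::complex_hilbert_space) ell2" and Q :: "nc_poly set"
  assumes V: "bounded_op V" and norm_V: "\<And>x. norm (V x) = norm x"
    and V_range: "\<And>x. V x \<in> variety_space Q UNIV"
    and intertwine: "\<And>i j x. i \<in> {1..k} \<Longrightarrow> j \<in> {1..n i} \<Longrightarrow> V (cadjoint (T i j) x) = wadj i j (V x)"
    and Q: "Q \<subseteq> nc_polys k n"
begin

text \<open>The adjoint of the first letter acts first on \<open>x\<close>, so its shift is the
  outermost one in the coordinate and the letters reappear in their original order.\<close>

lemma hat_V_word:
  assumes i: "i \<in> {1..k}" and \<alpha>: "\<alpha> \<in> lists {1..n i}" and \<beta>: "\<beta> \<in> mw"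
  shows "hat (V (Ts i \<alpha> x)) \<beta> = hat (V x) (\<beta>(i := \<alpha> @ \<beta> i))"
  using \<alpha>
proof (induction \<alpha> arbitrary: x)
  case (Cons j \<alpha>)
  have "\<alpha> @ \<beta> i \<in> lists {1..n i}"
    using Cons.hyps mw_nth[OF \<beta> i] by simp
  then have mem: "\<beta>(i := \<alpha> @ \<beta> i) \<in> mw"
    by (rule mw_upd[OF \<beta> i])
  have "Ts i (j # \<alpha>) x = Ts i \<alpha> (cadjoint (T i j) x)"
    by (simp add: cadjoint_comp bounded_T[OF i Cons.hyps(1)] bounded_word_T[OF i Cons.hyps(2)])
  then have "hat (V (Ts i (j # \<alpha>) x)) \<beta> = hat (wadj i j (V x)) (\<beta>(i := \<alpha> @ \<beta> i))"
    by (simp only: Cons.IH intertwine[OF i Cons.hyps(1)])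
  also have "\<dots> = hat (V x) (push i j (\<beta>(i := \<alpha> @ \<beta> i)))"
    by (rule hat_wadj[OF i Cons.hyps(1) mem])
  finally show ?case
    by (simp only: push_def fun_upd_same fun_upd_upd append_Cons)
qed (simp add: cadjoint_id)

lemma hat_V_foldr:
  assumes "\<alpha> \<in> mw" "\<beta> \<in> mw" "distinct is" "set is \<subseteq> {1..k}"
  shows "hat (V (cadjoint (foldr (\<lambda>i. (\<circ>) (word_op (T i) (\<alpha> i))) is id) x)) \<beta> =
    hat (V x) (\<lambda>i. if i \<in> set is then \<alpha> i @ \<beta> i else \<beta> i)"
  using assms(3,4)
proof (induction "is" arbitrary: x)
  case (Cons i "is")
  let ?\<gamma> = "\<lambda>i. if i \<in> set is then \<alpha> i @ \<beta> i else \<beta> i"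
  have i: "i \<in> {1..k}" "i \<notin> set is" "set is \<subseteq> {1..k}"
    using Cons.prems by auto
  have \<gamma>: "?\<gamma> \<in> mw"
    using assms(1,2) Cons.prems unfolding multi_words_def by (auto simp: PiE_iff extensional_def)
  have upd: "?\<gamma>(i := \<alpha> i @ ?\<gamma> i) = (\<lambda>l. if l \<in> set (i # is) then \<alpha> l @ \<beta> l else \<beta> l)"
    using i by (auto simp: fun_eq_iff)
  have adj: "cadjoint (foldr (\<lambda>i. (\<circ>) (word_op (T i) (\<alpha> i))) (i # is) id) x =
      cadjoint (foldr (\<lambda>i. (\<circ>) (word_op (T i) (\<alpha> i))) is id) (Ts i (\<alpha> i) x)"
    by (simp add: cadjoint_comp bounded_foldr_T[OF assms(1) i(3)]
        bounded_word_T[OF i(1) mw_nth[OF assms(1) i(1)]] del: in_lists_conv_set)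
  have IH: "hat (V (cadjoint (foldr (\<lambda>i. (\<circ>) (word_op (T i) (\<alpha> i))) is id) (Ts i (\<alpha> i) x))) \<beta> =
      hat (V (Ts i (\<alpha> i) x)) ?\<gamma>"
    by (rule Cons.IH) (use Cons.prems in auto)
  show ?case
    unfolding adj IH hat_V_word[OF i(1) mw_nth[OF assms(1) i(1)] \<gamma>] by (simp only: upd)
qed (simp add: cadjoint_id)

lemma hat_V_multi_word:
  assumes "\<alpha> \<in> mw" "\<beta> \<in> mw"
  shows "hat (V (cadjoint (multi_word_op k T \<alpha>) x)) \<beta> = hat (V x) (mapp \<alpha> \<beta>)"
proof -
  have "(\<lambda>i. if i \<in> set [1..<Suc k] then \<alpha> i @ \<beta> i else \<beta> i) = mapp \<alpha> \<beta>"
    using mw_outside[OF assms(2)] by (auto simp: mapp_def fun_eq_iff)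
  moreover have "set [1..<Suc k] \<subseteq> {1..k}"
    by auto
  ultimately show ?thesis
    using hat_V_foldr[OF assms distinct_upt, of 1 "Suc k" x] unfolding multi_word_op_def
    by metis
qed

lemma eq_zero_if_hat_V:
  assumes "\<And>\<beta>. \<beta> \<in> mw \<Longrightarrow> hat (V z) \<beta> = 0"
  shows "z = 0"
proof -
  have "Rep_ell2 (V z) \<beta> = 0" for \<beta>
    using assms[of \<beta>] bw_pos[of \<beta>] V_range[of z] by (cases "\<beta> \<in> mw") (auto simp: hat_def variety_space_def)
  then have "V z = 0"
    by (intro ell2_eqI) (simp add: zero_ell2.rep_eq)
  then show ?thesis
    using norm_V[of z] by simp
qed

text \<open>The adjoint of \<open>q(T)\<close> sends \<open>y\<close> to a vector \<open>z\<close>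
  such that the coordinates of \<open>V z\<close> are the defining expressions of
  \<open>N\<^sub>Q\<close> at \<open>V y\<close> with empty left word. They vanish, and
  \<open>V\<close> is injective.\<close>

lemma poly_op_eq_zero:
  assumes q: "q \<in> Q"
  shows "poly_op k T q x = 0"
proof (rule cinner_ext)
  fix y
  let ?K = "Poly_Mapping.keys q" and ?c = "Poly_Mapping.lookup q"
  have keys: "\<alpha> \<in> mw" if "\<alpha> \<in> ?K" for \<alpha>
    using q Q that unfolding nc_polys_def by blast
  define z where "z = (\<Sum>\<alpha>\<in>?K. cnj (?c \<alpha>) *\<^sub>C cadjoint (multi_word_op k T \<alpha>) y)"
  have "cinner (poly_op k T q x) y = cinner x z"
    by (simp add: poly_op_def z_def cinner.sum_left cinner.sum_right cinner_scaleC_left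
        cinner_scaleC_right cinner_cadjoint bounded_multi_word_T keys)
  moreover have "z = 0"
  proof (rule eq_zero_if_hat_V)
    fix \<beta> assume \<beta>: "\<beta> \<in> mw"
    interpret hV: bounded_linear "\<lambda>x. hat (V x) \<beta>"
      by (rule bounded_linear_compose[OF bounded_linear_hat bounded_op_linear[OF V]])
    have "hat (V z) \<beta> = (\<Sum>\<alpha>\<in>?K. cnj (?c \<alpha>) *\<^sub>C hat (V (cadjoint (multi_word_op k T \<alpha>) y)) \<beta>)"
      unfolding z_def hV.sum by (simp add: bounded_op_scaleC[OF V] hat_scaleC)
    also have "\<dots> = pairing q (\<lambda>i\<in>{1..k}. []) \<beta> (V y)"
      unfolding pairing_def
      by (intro sum.cong) (simp_all add: hat_V_multi_word keys \<beta> mapp_empty mw_mapp)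
    also have "\<dots> = 0"
      using V_range[of y] q \<beta> mw_empty by (simp add: variety_space_def)
    finally show "hat (V z) \<beta> = 0" .
  qed
  ultimately show "cinner (poly_op k T q x) y = cinner 0 y"
    by simp
qed

section \<open>Completely positive maps on diagonal weights\<close>

text \<open>\<open>Y\<close> is the compression by \<open>V\<close> of the diagonal operator with entries \<open>\<mu>\<^sub>\<beta> / b\<^sub>\<beta>\<close>. On such operators
  \<open>\<Phi>\<^sub>i\<close> acts as convolution by \<open>a\<^sub>i\<close> in the \<open>i\<close>-th word.\<close>

definition represents :: "('h \<Rightarrow> 'h) \<Rightarrow> ((nat \<Rightarrow> nat list) \<Rightarrow> real) \<Rightarrow> bool"
  where "represents Y \<mu> \<longleftrightarrow> bounded_op Y \<and> (\<forall>x. cinner (Y x) x \<in> \<real>) \<and>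
    (\<forall>x. ((\<lambda>\<beta>. \<mu> \<beta> * (norm (hat (V x) \<beta>))\<^sup>2) has_sum qform Y x) mw)"

lemma represents_id: "represents id bw"
proof -
  have "((\<lambda>\<beta>. bw \<beta> * (norm (hat (V x) \<beta>))\<^sup>2) has_sum (norm x)\<^sup>2) mw" for x
  proof (rule has_sum_cong_neutral[THEN iffD1, OF _ _ _ ell2_norm_has_sum[of "V x", unfolded norm_V]])
    fix \<beta> assume "\<beta> \<in> UNIV \<inter> mw"
    then show "(norm (Rep_ell2 (V x) \<beta>))\<^sup>2 = bw \<beta> * (norm (hat (V x) \<beta>))\<^sup>2"
      using bw_pos[of \<beta>] by (simp add: hat_def power_mult_distrib power_divide)
  qed (use V_range[of x] in \<open>auto simp: variety_space_def\<close>)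
  then show ?thesis
    by (simp add: represents_def bounded_op_id cinner_self)
qed

lemma represents_positive:
  assumes "represents Y \<mu>" "\<And>\<beta>. \<beta> \<in> mw \<Longrightarrow> 0 \<le> \<mu> \<beta>"
  shows "positive_op Y"
proof -
  have nonneg: "0 \<le> qform Y x" for x
  proof (rule has_sum_nonneg)
    show "((\<lambda>\<beta>. \<mu> \<beta> * (norm (hat (V x) \<beta>))\<^sup>2) has_sum qform Y x) mw"
      using assms(1) by (simp add: represents_def)
  qed (use assms(2) in simp)
  show ?thesis
    using assms(1) nonneg by (simp add: positive_op_def represents_def)
qed

text \<open>Words of the \<open>i\<close>-th row shift the coordinates of \<open>V x\<close>, so the
  form of \<open>\<Phi> i Y\<close> is a double sum over \<open>(\<alpha>, \<beta>)\<close>;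
  collecting the pairs with the same \<open>\<alpha> @ \<beta> i\<close> produces the convolution.
  Nonnegativity of \<open>\<mu>\<close> licenses the regrouping.\<close>

lemma represents_phi:
  assumes i: "i \<in> {1..k}" and Y: "represents Y \<mu>" and \<mu>: "\<And>\<beta>. \<beta> \<in> mw \<Longrightarrow> 0 \<le> \<mu> \<beta>"
  shows "represents (\<Phi> i Y) (\<lambda>\<delta>. word_conv (a i) (\<lambda>\<gamma>. \<mu> (\<delta>(i := \<gamma>))) (\<delta> i))"
proof -
  interpret r: row "n i" "a i" "T i" by (rule row[OF i])
  let ?L = "lists {1..n i}"
  have pos: "positive_op Y" by (rule represents_positive[OF Y \<mu>])
  have "((\<lambda>\<delta>. word_conv (a i) (\<lambda>\<gamma>. \<mu> (\<delta>(i := \<gamma>))) (\<delta> i) * (norm (hat (V x) \<delta>))\<^sup>2) has_sum qform (\<Phi> i Y) x) mw" for x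
  proof -
    let ?h = "\<lambda>(\<alpha>, \<beta>). \<beta>(i := \<alpha> @ \<beta> i)"
    let ?F = "\<lambda>(\<alpha>, \<beta>). a i \<alpha> * (\<mu> \<beta> * (norm (hat (V x) (\<beta>(i := \<alpha> @ \<beta> i))))\<^sup>2)"
    have "(?F has_sum qform (\<Phi> i Y) x) (?L \<times> mw)"
    proof (rule has_sum_Times_nonneg[OF has_sum_cmult_right])
      show "((\<lambda>\<beta>. \<mu> \<beta> * (norm (hat (V x) (\<beta>(i := \<alpha> @ \<beta> i))))\<^sup>2) has_sum qform Y (Ts i \<alpha> x)) mw"
        if \<alpha>: "\<alpha> \<in> ?L" for \<alpha>
      proof (rule has_sum_cong[THEN iffD1])
        show "((\<lambda>\<beta>. \<mu> \<beta> * (norm (hat (V (Ts i \<alpha> x)) \<beta>))\<^sup>2) has_sum qform Y (Ts i \<alpha> x)) mw"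
          using Y by (simp add: represents_def)
      qed (simp only: hat_V_word[OF i \<alpha>])
      show "((\<lambda>\<alpha>. a i \<alpha> * qform Y (Ts i \<alpha> x)) has_sum qform (\<Phi> i Y) x) ?L"
        by (rule r.phi_qform[OF positive_op_bounded[OF pos]])
    qed (intro mult_nonneg_nonneg r.a_nonneg \<mu> zero_le_power2)
    moreover have "?h ` (?L \<times> mw) \<subseteq> mw"
    proof (rule image_subsetI)
      fix z assume "z \<in> ?L \<times> mw"
      then obtain \<alpha> \<beta> where z: "z = (\<alpha>, \<beta>)" "\<alpha> \<in> ?L" "\<beta> \<in> mw" by blast
      then have "\<alpha> @ \<beta> i \<in> ?L"
        using mw_nth[OF z(3) i] by (simp only: append_in_lists_conv)
      then show "?h z \<in> mw"
        using mw_upd[OF z(3) i] by (simp add: z(1))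
    qed
    \<comment> \<open>A preimage of \<open>\<delta>\<close> amounts to a split of
      \<open>\<delta> i\<close>; the other words stay fixed.\<close>
    moreover have fib: "{p \<in> ?L \<times> mw. ?h p = \<delta>} = (\<lambda>(\<alpha>, \<gamma>). (\<alpha>, \<delta>(i := \<gamma>))) ` splits (\<delta> i)"
      if \<delta>: "\<delta> \<in> mw" for \<delta>
    proof
      show "{p \<in> ?L \<times> mw. ?h p = \<delta>} \<subseteq> (\<lambda>(\<alpha>, \<gamma>). (\<alpha>, \<delta>(i := \<gamma>))) ` splits (\<delta> i)"
      proof clarify
        fix \<alpha> \<beta> assume "\<delta> = \<beta>(i := \<alpha> @ \<beta> i)"
        show "(\<alpha>, \<beta>) \<in> (\<lambda>(\<alpha>', \<gamma>). (\<alpha>', (\<beta>(i := \<alpha> @ \<beta> i))(i := \<gamma>))) ` splits ((\<beta>(i := \<alpha> @ \<beta> i)) i)"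
          by (rule image_eqI[of _ _ "(\<alpha>, \<beta> i)"]) (auto simp: splits_def)
      qed
      show "(\<lambda>(\<alpha>, \<gamma>). (\<alpha>, \<delta>(i := \<gamma>))) ` splits (\<delta> i) \<subseteq> {p \<in> ?L \<times> mw. ?h p = \<delta>}"
      proof clarify
        fix \<alpha> \<gamma> assume "(\<alpha>, \<gamma>) \<in> splits (\<delta> i)"
        moreover from this have "\<alpha> \<in> ?L" "\<gamma> \<in> ?L"
          using splits_lists[OF _ mw_nth[OF \<delta> i]] by fastforce+
        ultimately show "(\<alpha>, \<delta>(i := \<gamma>)) \<in> ?L \<times> mw \<and> (\<delta>(i := \<gamma>))(i := \<alpha> @ (\<delta>(i := \<gamma>)) i) = \<delta>"
          using mw_upd[OF \<delta> i, of \<gamma>] by (simp add: splits_def)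
      qed
    qed
    ultimately have "((\<lambda>\<delta>. \<Sum>p\<in>{p \<in> ?L \<times> mw. ?h p = \<delta>}. ?F p) has_sum qform (\<Phi> i Y) x) mw"
      by (intro has_sum_fibers) auto
    then show ?thesis
    proof (rule has_sum_cong[THEN iffD1, rotated])
      fix \<delta> assume \<delta>: "\<delta> \<in> mw"
      have "inj_on (\<lambda>(\<alpha>, \<gamma>). (\<alpha>, \<delta>(i := \<gamma>))) (splits (\<delta> i))"
        by (auto simp: inj_on_def splits_def dest: fun_upd_eqD)
      then have "(\<Sum>p\<in>{p \<in> ?L \<times> mw. ?h p = \<delta>}. ?F p) =
          (\<Sum>z\<in>splits (\<delta> i). ?F ((\<lambda>(\<alpha>, \<gamma>). (\<alpha>, \<delta>(i := \<gamma>))) z))"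
        unfolding fib[OF \<delta>] by (simp only: sum.reindex o_def)
      also have "\<dots> = word_conv (a i) (\<lambda>\<gamma>. \<mu> (\<delta>(i := \<gamma>))) (\<delta> i) * (norm (hat (V x) \<delta>))\<^sup>2"
        unfolding word_conv_def sum_distrib_right
        by (rule sum.cong) (auto simp: splits_def)
      finally show "(\<Sum>p\<in>{p \<in> ?L \<times> mw. ?h p = \<delta>}. ?F p) =
          word_conv (a i) (\<lambda>\<gamma>. \<mu> (\<delta>(i := \<gamma>))) (\<delta> i) * (norm (hat (V x) \<delta>))\<^sup>2" .
    qed
  qed
  then show ?thesis
    using r.positive_phi[OF pos] by (simp add: represents_def positive_op_def)
qed

text \<open>Product weights form a class stable under the maps \<open>\<Phi> i\<close>, because
  convolution in the \<open>i\<close>-th word changes only the \<open>i\<close>-th factor.\<close>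

definition tensor_weight :: "(nat \<Rightarrow> nat list \<Rightarrow> real) \<Rightarrow> (nat \<Rightarrow> nat list) \<Rightarrow> real"
  where "tensor_weight \<mu> \<beta> = (\<Prod>l\<in>{1..k}. \<mu> l (\<beta> l))"

definition nonneg_weights :: "(nat \<Rightarrow> nat list \<Rightarrow> real) \<Rightarrow> bool"
  where "nonneg_weights \<mu> \<longleftrightarrow> (\<forall>l\<in>{1..k}. \<forall>\<gamma>\<in>lists {1..n l}. 0 \<le> \<mu> l \<gamma>)"

lemma tensor_weight_nonneg: "nonneg_weights \<mu> \<Longrightarrow> \<beta> \<in> mw \<Longrightarrow> 0 \<le> tensor_weight \<mu> \<beta>"
  unfolding tensor_weight_def nonneg_weights_def by (intro prod_nonneg ballI) (use mw_nth in blast)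

lemma tensor_weight_upd:
  assumes "i \<in> {1..k}"
  shows "tensor_weight (\<mu>(i := \<nu>)) \<beta> = \<nu> (\<beta> i) * (\<Prod>l\<in>{1..k} - {i}. \<mu> l (\<beta> l))"
  using assms unfolding tensor_weight_def by (subst prod.remove[of _ i]) auto

lemma tensor_weight_word_upd:
  assumes "i \<in> {1..k}"
  shows "tensor_weight \<mu> (\<beta>(i := \<gamma>)) = (\<Prod>l\<in>{1..k} - {i}. \<mu> l (\<beta> l)) * \<mu> i \<gamma>"
  using prod_upd[OF assms, of \<mu> \<beta> \<gamma>] by (simp add: tensor_weight_def)

lemma represents_phi_tensor:
  assumes i: "i \<in> {1..k}" and Y: "represents Y (tensor_weight \<mu>)" and \<mu>: "nonneg_weights \<mu>"
  shows "represents (\<Phi> i Y) (tensor_weight (\<mu>(i := word_conv (a i) (\<mu> i))))"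
proof -
  have "(\<lambda>\<delta>. word_conv (a i) (\<lambda>\<gamma>. tensor_weight \<mu> (\<delta>(i := \<gamma>))) (\<delta> i)) =
      tensor_weight (\<mu>(i := word_conv (a i) (\<mu> i)))"
    unfolding tensor_weight_upd[OF i] tensor_weight_word_upd[OF i] word_conv_cmult_right
    by (simp add: mult.commute)
  with represents_phi[OF i Y tensor_weight_nonneg[OF \<mu>]] show ?thesis by simp
qed

lemma represents_residual_tensor:
  assumes i: "i \<in> {1..k}" and Y: "represents Y (tensor_weight \<mu>)" and \<mu>: "nonneg_weights \<mu>"
  shows "represents (residual i Y) (tensor_weight (\<mu>(i := \<lambda>\<gamma>. \<mu> i \<gamma> - word_conv (a i) (\<mu> i) \<gamma>)))"
proof -
  note phi = represents_phi_tensor[OF assms]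
  have eq: "tensor_weight (\<mu>(i := \<lambda>\<gamma>. \<mu> i \<gamma> - word_conv (a i) (\<mu> i) \<gamma>)) \<beta> =
      tensor_weight \<mu> \<beta> - tensor_weight (\<mu>(i := word_conv (a i) (\<mu> i))) \<beta>" for \<beta>
    using tensor_weight_upd[OF i, of \<mu> "\<mu> i"] by (simp add: tensor_weight_upd[OF i] left_diff_distrib)
  have "((\<lambda>\<beta>. tensor_weight (\<mu>(i := \<lambda>\<gamma>. \<mu> i \<gamma> - word_conv (a i) (\<mu> i) \<gamma>)) \<beta> * (norm (hat (V x) \<beta>))\<^sup>2)
      has_sum qform (residual i Y) x) mw" for x
  proof -
    have "((\<lambda>\<beta>. tensor_weight \<mu> \<beta> * (norm (hat (V x) \<beta>))\<^sup>2) has_sum qform Y x) mw"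
      using Y by (simp add: represents_def)
    moreover have "((\<lambda>\<beta>. tensor_weight (\<mu>(i := word_conv (a i) (\<mu> i))) \<beta> * (norm (hat (V x) \<beta>))\<^sup>2)
        has_sum qform (\<Phi> i Y) x) mw"
      using phi by (simp add: represents_def)
    ultimately show ?thesis
      using has_sum_add[OF _ has_sum_uminusI]
      by (fastforce simp: eq left_diff_distrib cinner.diff_left)
  qed
  then show ?thesis
    using Y phi by (simp add: represents_def bounded_op_diff cinner.diff_left)
qed

lemma a_props:
  assumes "i \<in> {1..k}"
  shows "a i [] = 0" "\<And>\<alpha>. \<alpha> \<in> lists {1..n i} \<Longrightarrow> 0 \<le> a i \<alpha>"
  using regular[OF assms] by (auto simp: positive_regular_def)

text \<open>By \<open>weight_seq_rec\<close> each application of \<open>residual i\<close> lowers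
  the exponent of the \<open>i\<close>-th weight by one; \<open>p \<le> M\<close> keeps the exponent
  from running out.\<close>

lemma represents_residual_pow:
  assumes i: "i \<in> {1..k}" and Y: "represents Y (tensor_weight \<mu>)" and \<mu>: "nonneg_weights \<mu>"
    and \<mu>i: "\<mu> i = weight_seq (a i) M" and p: "p \<le> M"
  shows "represents ((residual i ^^ p) Y) (tensor_weight (\<mu>(i := weight_seq (a i) (M - p))))"
  using p
proof (induction p)
  case 0
  show ?case using Y by (simp add: fun_upd_idem \<mu>i)
next
  case (Suc p)
  define r where "r = M - Suc p"
  have r: "M - p = Suc r" using Suc.prems by (simp add: r_def)
  let ?\<mu> = "\<mu>(i := weight_seq (a i) (M - p))"
  have "nonneg_weights ?\<mu>"
    using \<mu> weight_seq_nonneg[of "a i" "{1..n i}", OF a_props[OF i]]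
    by (auto simp: nonneg_weights_def simp del: in_lists_conv_set)
  from represents_residual_tensor[OF i Suc.IH this] Suc.prems
  have "represents ((residual i ^^ Suc p) Y)
      (tensor_weight (\<mu>(i := \<lambda>\<gamma>. weight_seq (a i) (Suc r) \<gamma> - word_conv (a i) (weight_seq (a i) (Suc r)) \<gamma>)))"
    by (simp add: r)
  moreover have "(\<lambda>\<gamma>. weight_seq (a i) (Suc r) \<gamma> - word_conv (a i) (weight_seq (a i) (Suc r)) \<gamma>) = weight_seq (a i) r"
    using weight_seq_rec[of "a i" r, OF a_props(1)[OF i]] by (simp add: fun_eq_iff)
  ultimately show ?case
    by (simp only: r_def)
qed

lemma bw_tensor_weight: "bw = tensor_weight (\<lambda>l. weight_seq (a l) (m l))"
proof -
  have "weight_seq (a l) (m l) = fock_weight (a l) (m l)" if "l \<in> {1..k}" for l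
    using m_pos[OF that] by (simp add: weight_seq_def)
  then show ?thesis
    by (simp add: bw_def tensor_weight_def fun_eq_iff)
qed

lemma nonneg_weight_seq: "nonneg_weights (\<lambda>l. weight_seq (a l) (r l))"
  unfolding nonneg_weights_def using weight_seq_nonneg[of "a l" "{1..n l}" for l] a_props by blast

text \<open>The identity starts with exponent \<open>m l\<close> in every factor. Distinctness of
  the list ensures that factor \<open>i\<close> still has exponent \<open>m i\<close> when its
  residuals are applied.\<close>

lemma represents_defect:
  assumes p: "\<And>i. i \<in> {1..k} \<Longrightarrow> p i \<le> m i" and "distinct is" "set is \<subseteq> {1..k}"
  shows "represents (foldr (\<lambda>i. (\<circ>) (residual i ^^ p i)) is id id)
    (tensor_weight (\<lambda>l. weight_seq (a l) (if l \<in> set is then m l - p l else m l)))"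
  using assms(2,3)
proof (induction "is")
  case Nil
  show ?case using represents_id by (simp add: bw_tensor_weight id_def)
next
  case (Cons i "is")
  let ?\<mu> = "\<lambda>l. weight_seq (a l) (if l \<in> set is then m l - p l else m l)"
  have i: "i \<in> {1..k}" "i \<notin> set is" using Cons.prems by auto
  have "represents (foldr (\<lambda>i. (\<circ>) (residual i ^^ p i)) is id id) (tensor_weight ?\<mu>)"
    by (rule Cons.IH) (use Cons.prems in auto)
  then have "represents ((residual i ^^ p i) (foldr (\<lambda>i. (\<circ>) (residual i ^^ p i)) is id id))
      (tensor_weight (?\<mu>(i := weight_seq (a i) (m i - p i))))"
    by (rule represents_residual_pow[OF i(1) _ nonneg_weight_seq _ p[OF i(1)]]) (use i in simp)
  moreover have "?\<mu>(i := weight_seq (a i) (m i - p i)) =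
      (\<lambda>l. weight_seq (a l) (if l \<in> set (i # is) then m l - p l else m l))"
    by (auto simp: fun_eq_iff)
  moreover have "foldr (\<lambda>i. (\<circ>) (residual i ^^ p i)) (i # is) id id =
      (residual i ^^ p i) (foldr (\<lambda>i. (\<circ>) (residual i ^^ p i)) is id id)"
    by simp
  ultimately show ?case
    by (simp only:)
qed

lemma positive_defect:
  assumes "\<And>i. i \<in> {1..k} \<Longrightarrow> p i \<le> m i"
  shows "positive_op (defect k n a T p id)"
  unfolding defect_def
  by (rule represents_positive[OF represents_defect[OF assms]])
    (auto intro!: tensor_weight_nonneg nonneg_weight_seq)

text \<open>The \<open>s\<close>-th iterate at the identity has as \<open>i\<close>-th weight
  \<open>c s\<close>, the original weight convolved \<open>s\<close> times with \<open>a i\<close>.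
  It is dominated by the original weight, by the recursion, and vanishes on words shorter than
  \<open>s\<close>, so dominated convergence applies.\<close>

lemma pure_qform:
  assumes i: "i \<in> {1..k}"
  shows "(\<lambda>s. qform ((\<Phi> i ^^ s) id) x) \<longlonglongrightarrow> 0"
proof (rule has_sum_dominated_null[where len = "\<lambda>\<beta>. length (\<beta> i)"
      and g = "\<lambda>\<beta>. bw \<beta> * (norm (hat (V x) \<beta>))\<^sup>2"])
  let ?b = "\<lambda>l. weight_seq (a l) (m l)"
  define c where "c s = (word_conv (a i) ^^ s) (?b i)" for s
  note ai = a_props[OF i]
  have b_nonneg: "0 \<le> ?b i \<gamma>" if "\<gamma> \<in> lists {1..n i}" for \<gamma>
    by (rule weight_seq_nonneg[of "a i" "{1..n i}", OF ai that])
  obtain m' where m': "m i = Suc m'" using m_pos[OF i] by (cases "m i") auto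
  have b_conv: "word_conv (a i) (?b i) \<gamma> \<le> ?b i \<gamma>" if "\<gamma> \<in> lists {1..n i}" for \<gamma>
    using weight_seq_rec[of "a i" m' \<gamma>, OF ai(1)] weight_seq_nonneg[of "a i" "{1..n i}" \<gamma> m', OF ai that]
    by (simp add: m')
  have c: "0 \<le> c s \<gamma> \<and> c s \<gamma> \<le> ?b i \<gamma>" if "\<gamma> \<in> lists {1..n i}" for s \<gamma>
    using that
  proof (induction s arbitrary: \<gamma>)
    case (Suc s)
    have "0 \<le> word_conv (a i) (c s) \<gamma>"
      by (rule word_conv_nonneg[of "{1..n i}"]) (use ai Suc in blast)+
    moreover have "word_conv (a i) (c s) \<gamma> \<le> word_conv (a i) (?b i) \<gamma>"
      by (rule word_conv_mono_right[of "{1..n i}"]) (use ai Suc in blast)+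
    ultimately show ?case
      using b_conv[OF Suc.prems] by (simp add: c_def)
  qed (simp add: c_def b_nonneg)
  have c_short: "c s \<gamma> = 0" if "length \<gamma> < s" for s \<gamma>
    using that
  proof (induction s arbitrary: \<gamma>)
    case (Suc s)
    have "word_conv (a i) (c s) \<gamma> = 0"
      by (rule word_conv_shift_support[of "a i" s]) (use ai Suc in auto)
    then show ?case by (simp add: c_def)
  qed simp
  have nn: "nonneg_weights (?b(i := c s))" for s
    using nonneg_weight_seq[of m] c by (auto simp: nonneg_weights_def simp del: in_lists_conv_set)
  have "represents ((\<Phi> i ^^ s) id) (tensor_weight (?b(i := c s)))" for s
  proof (induction s)
    case 0
    show ?case
      using represents_id by (simp add: c_def fun_upd_idem bw_tensor_weight id_def)
  next
    case (Suc s)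
    have "c (Suc s) = word_conv (a i) (c s)"
      by (simp add: c_def)
    with represents_phi_tensor[OF i Suc nn] show ?case
      by (simp only: funpow.simps o_apply fun_upd_same fun_upd_upd)
  qed
  then show "((\<lambda>\<beta>. tensor_weight (?b(i := c s)) \<beta> * (norm (hat (V x) \<beta>))\<^sup>2) has_sum qform ((\<Phi> i ^^ s) id) x) mw" for s
    by (simp add: represents_def)
  show "((\<lambda>\<beta>. bw \<beta> * (norm (hat (V x) \<beta>))\<^sup>2) has_sum qform id x) mw"
    using represents_id by (simp add: represents_def)
  have rest: "0 \<le> (\<Prod>l\<in>{1..k} - {i}. ?b l (\<beta> l))" if "\<beta> \<in> mw" for \<beta>
    using nonneg_weight_seq[of m] mw_nth[OF that] by (intro prod_nonneg) (auto simp: nonneg_weights_def)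
  show "0 \<le> tensor_weight (?b(i := c s)) \<beta> * (norm (hat (V x) \<beta>))\<^sup>2 \<and>
      tensor_weight (?b(i := c s)) \<beta> * (norm (hat (V x) \<beta>))\<^sup>2 \<le> bw \<beta> * (norm (hat (V x) \<beta>))\<^sup>2"
    if "\<beta> \<in> mw" for s \<beta>
  proof -
    have "bw \<beta> = ?b i (\<beta> i) * (\<Prod>l\<in>{1..k} - {i}. ?b l (\<beta> l))"
      using tensor_weight_word_upd[OF i, of ?b \<beta> "\<beta> i"] by (simp add: bw_tensor_weight mult.commute)
    moreover have "c s (\<beta> i) * (\<Prod>l\<in>{1..k} - {i}. ?b l (\<beta> l)) \<le> ?b i (\<beta> i) * (\<Prod>l\<in>{1..k} - {i}. ?b l (\<beta> l))"
      using c[OF mw_nth[OF that i]] rest[OF that] by (intro mult_right_mono) auto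
    ultimately have "tensor_weight (?b(i := c s)) \<beta> \<le> bw \<beta>"
      by (simp only: tensor_weight_upd[OF i])
    then show ?thesis
      by (intro conjI mult_nonneg_nonneg mult_right_mono tensor_weight_nonneg[OF nn that] zero_le_power2)
  qed
  show "tensor_weight (?b(i := c s)) \<beta> * (norm (hat (V x) \<beta>))\<^sup>2 = 0" if "\<beta> \<in> mw" "length (\<beta> i) < s" for s \<beta>
    using c_short[OF that(2)] by (simp add: tensor_weight_upd[OF i])
qed

lemma in_variety: "T \<in> variety k n a m Q"
  unfolding variety_def polydomain_def using T Phi positive_defect poly_op_eq_zero by blast

end

text \<open>Polarization reduces weak convergence to convergence of diagonal values.\<close>

lemma (in model_tuple) pure_tupleI:
  assumes "\<And>i x. i \<in> {1..k} \<Longrightarrow> (\<lambda>s. qform ((\<Phi> i ^^ s) id) x) \<longlonglongrightarrow> 0"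
  shows "pure_tuple k n a T"
  unfolding pure_tuple_def
proof (intro ballI allI)
  fix i x y assume i: "i \<in> {1..k}"
  interpret r: row "n i" "a i" "T i" by (rule row[OF i])
  let ?P = "\<lambda>s. (\<Phi> i ^^ s) id"
  have P: "positive_op (?P s)" for s
    by (rule r.positive_phi_pow[OF positive_op_id])
  have lim: "(\<lambda>s. cinner (?P s z) z) \<longlonglongrightarrow> 0" for z
    by (subst positive_op_form[OF P]) (use tendsto_of_real[OF assms[OF i], where 'a = complex] in simp)
  have "(\<lambda>s. cinner (?P s (x + y)) (x + y) - cinner (?P s (x - y)) (x - y)
      + \<i> * cinner (?P s (x + \<i> *\<^sub>C y)) (x + \<i> *\<^sub>C y) - \<i> * cinner (?P s (x - \<i> *\<^sub>C y)) (x - \<i> *\<^sub>C y))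
      \<longlonglongrightarrow> 0 - 0 + \<i> * 0 - \<i> * 0"
    by (intro tendsto_intros lim)
  then have "(\<lambda>s. (1/4) * (4 * cinner (?P s x) y)) \<longlonglongrightarrow> (1/4) * 0"
    unfolding polarization[OF positive_op_bounded[OF P]] by (intro tendsto_intros) simp
  then show "(\<lambda>s. cinner (?P s x) y) \<longlonglongrightarrow> 0"
    by simp
qed

section \<open>The Berezin kernel of a pure tuple\<close>

lemma foldr_comp_Cons: "foldr (\<lambda>i. (\<circ>) (A i)) (i # is) g = A i \<circ> foldr (\<lambda>i. (\<circ>) (A i)) is g"
  by simp

lemma foldr_comp_id: "foldr (\<lambda>i. (\<circ>) (A i)) is g = foldr (\<lambda>i. (\<circ>) (A i)) is id \<circ> g"
  by (induction "is") (simp_all add: o_assoc)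

lemma foldr_comp_commute:
  assumes "\<And>i. i \<in> set is \<Longrightarrow> X \<circ> A i = A i \<circ> X"
  shows "X \<circ> foldr (\<lambda>i. (\<circ>) (A i)) is id = foldr (\<lambda>i. (\<circ>) (A i)) is id \<circ> X"
  using assms
proof (induction "is")
  case (Cons i "is")
  let ?F = "foldr (\<lambda>i. (\<circ>) (A i)) is id"
  have "X \<circ> A i = A i \<circ> X"
    by (rule Cons.prems) simp
  moreover have "X \<circ> ?F = ?F \<circ> X"
    by (rule Cons.IH[OF Cons.prems]) simp
  ultimately have "X \<circ> (A i \<circ> ?F) = A i \<circ> ?F \<circ> X"
    by (metis o_assoc)
  then show ?case
    by (simp only: foldr_comp_Cons)
qed simp

lemma foldr_comp_rev:
  assumes "distinct is" "\<And>i l. i \<in> set is \<Longrightarrow> l \<in> set is \<Longrightarrow> i \<noteq> l \<Longrightarrow> A i \<circ> A l = A l \<circ> A i"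
  shows "foldr (\<lambda>i. (\<circ>) (A i)) (rev is) id = foldr (\<lambda>i. (\<circ>) (A i)) is id"
  using assms
proof (induction "is")
  case (Cons i "is")
  let ?F = "\<lambda>is. foldr (\<lambda>i. (\<circ>) (A i)) is id"
  have "?F (rev (i # is)) = foldr (\<lambda>i. (\<circ>) (A i)) (rev is) (A i)"
    by simp
  also have "\<dots> = ?F (rev is) \<circ> A i"
    by (rule foldr_comp_id)
  also have "?F (rev is) = ?F is"
    by (rule Cons.IH) (use Cons.prems(1) in simp, rule Cons.prems(2), simp_all)
  also have "?F is \<circ> A i = A i \<circ> ?F is"
    by (rule foldr_comp_commute[symmetric], rule Cons.prems(2)) (use Cons.prems(1) in auto)
  finally show ?case
    by (simp only: foldr_comp_Cons)
qed simp

lemma foldr_comp_mult: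
  assumes "distinct is" "\<And>i l. i \<in> set is \<Longrightarrow> l \<in> set is \<Longrightarrow> i \<noteq> l \<Longrightarrow> B i \<circ> A l = A l \<circ> B i"
  shows "foldr (\<lambda>i. (\<circ>) (A i \<circ> B i)) is id =
    foldr (\<lambda>i. (\<circ>) (A i)) is id \<circ> foldr (\<lambda>i. (\<circ>) (B i)) is id"
  using assms
proof (induction "is")
  case (Cons i "is")
  let ?A = "foldr (\<lambda>i. (\<circ>) (A i)) is id" and ?B = "foldr (\<lambda>i. (\<circ>) (B i)) is id"
  have "B i \<circ> ?A = ?A \<circ> B i"
    by (rule foldr_comp_commute, rule Cons.prems(2)) (use Cons.prems(1) in auto)
  then have "(A i \<circ> B i) \<circ> (?A \<circ> ?B) = (A i \<circ> ?A) \<circ> (B i \<circ> ?B)"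
    by (metis o_assoc)
  moreover have "foldr (\<lambda>i. (\<circ>) (A i \<circ> B i)) is id = ?A \<circ> ?B"
    by (rule Cons.IH) (use Cons.prems(1) in simp, rule Cons.prems(2), simp_all)
  ultimately show ?case
    by (simp only: foldr_comp_Cons)
qed simp

lemma closed_range_isometry:
  fixes V :: "'a::complex_hilbert_space \<Rightarrow> 'b::complex_hilbert_space"
  assumes V: "bounded_op V" and iso: "\<And>x. norm (V x) = norm x"
  shows "closed (range V)"
  unfolding closed_sequential_limits
proof (intro allI impI, elim conjE)
  interpret bounded_linear V by (rule bounded_op_linear[OF V])
  fix f y assume "\<forall>p. f p \<in> range V" and lim: "f \<longlonglongrightarrow> y"
  then have "\<forall>p. \<exists>x. f p = V x"
    by blast
  then obtain g where g: "\<And>p. f p = V (g p)"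
    by metis
  have "dist (g p) (g q) = dist (f p) (f q)" for p q
    by (simp add: dist_norm g iso flip: diff)
  then have "Cauchy g"
    using LIMSEQ_imp_Cauchy[OF lim] by (simp add: Cauchy_def)
  then obtain x where "g \<longlonglongrightarrow> x"
    using Cauchy_convergent convergent_def by blast
  then have "f \<longlonglongrightarrow> V x"
    unfolding g[abs_def] by (rule tendsto)
  then show "y \<in> range V"
    using lim LIMSEQ_unique by blast
qed

section \<open>Words in the commuting rows and partial defects\<close>

context model_tuple
begin

lemma word_op_T_commute:
  assumes "i \<in> {1..k}" "l \<in> {1..k}" "i \<noteq> l" "\<alpha> \<in> lists {1..n i}" "\<beta> \<in> lists {1..n l}"
  shows "word_op (T i) \<alpha> \<circ> word_op (T l) \<beta> = word_op (T l) \<beta> \<circ> word_op (T i) \<alpha>"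
proof -
  have T_word: "T l j \<circ> word_op (T i) \<alpha> = word_op (T i) \<alpha> \<circ> T l j" if "j \<in> {1..n l}" for j
    unfolding word_op_def
    by (rule foldr_comp_commute) (use T assms that in \<open>auto simp: cross_commuting_def\<close>)
  show ?thesis
    unfolding word_op_def[of "T l"]
    by (rule foldr_comp_commute) (use T_word assms(5) in auto)
qed

text \<open>Concatenation row by row only reorders letters of different rows, and these
  commute.\<close>

lemma multi_word_T_mapp:
  assumes "\<alpha> \<in> mw" "\<beta> \<in> mw"
  shows "multi_word_op k T (mapp \<alpha> \<beta>) = multi_word_op k T \<alpha> \<circ> multi_word_op k T \<beta>"
proof -
  have "multi_word_op k T (mapp \<alpha> \<beta>) =
      foldr (\<lambda>i. (\<circ>) (word_op (T i) (\<alpha> i) \<circ> word_op (T i) (\<beta> i))) [1..<Suc k] id"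
    unfolding multi_word_op_def
    by (rule foldr_cong) (auto simp: mapp_def word_op_append)
  also have "\<dots> = multi_word_op k T \<alpha> \<circ> multi_word_op k T \<beta>"
    unfolding multi_word_op_def
    by (rule foldr_comp_mult) (use word_op_T_commute mw_nth[OF assms(1)] mw_nth[OF assms(2)] in auto)
  finally show ?thesis .
qed

lemma multi_word_T_push:
  assumes i: "i \<in> {1..k}" and j: "j \<in> {1..n i}" and \<beta>: "\<beta> \<in> mw"
  shows "multi_word_op k T (push i j \<beta>) = T i j \<circ> multi_word_op k T \<beta>"
proof -
  let ?e = "\<lambda>i\<in>{1..k}. []"
  have "push i j \<beta> = mapp (push i j ?e) \<beta>"
    using mapp_empty(2)[OF \<beta>] push_mapp[OF i] by metis
  moreover have "multi_word_op k T (push i j ?e) = T i j"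
  proof -
    have "foldr (\<lambda>l. (\<circ>) (word_op (T l) (push i j ?e l))) is id = (if i \<in> set is then T i j else id)"
      if "distinct is" "set is \<subseteq> {1..k}" for "is"
      using that by (induction "is") (auto simp: push_def)
    from this[of "[1..<Suc k]"] i show ?thesis
      by (simp add: multi_word_op_def less_Suc_eq_le subset_iff del: upt_Suc)
  qed
  ultimately show ?thesis
    using multi_word_T_mapp[OF mw_push[OF mw_empty i j] \<beta>] by metis
qed

text \<open>The rows are composed in reverse, so that the adjoint of the newest row acts first on
  \<open>x\<close>, as the step-by-step inversion of the defect demands. At \<open>t = k\<close>
  cross-commutation restores the usual order.\<close>

definition partial_word :: "nat \<Rightarrow> (nat \<Rightarrow> nat list) \<Rightarrow> 'h \<Rightarrow> 'h"
  where "partial_word t \<alpha> = foldr (\<lambda>i. (\<circ>) (word_op (T i) (\<alpha> i))) (rev [1..<Suc t]) id"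

text \<open>What remains of the full defect once the first \<open>t\<close> factors have been
  inverted: everything at \<open>t = 0\<close>, the identity at \<open>t = k\<close>.\<close>

definition partial_defect :: "nat \<Rightarrow> 'h \<Rightarrow> 'h"
  where "partial_defect t = foldr (\<lambda>i. (\<circ>) (residual i ^^ m i)) [Suc t..<Suc k] id id"

lemma partial_word_k:
  assumes "\<alpha> \<in> mw"
  shows "partial_word k \<alpha> = multi_word_op k T \<alpha>"
  unfolding partial_word_def multi_word_op_def
  by (rule foldr_comp_rev) (use word_op_T_commute mw_nth[OF assms] in auto)

text \<open>This exhibits it as a defect of order at most \<open>m\<close>, so membership in the
  polydomain makes it positive.\<close>

lemma partial_defect_eq:
  assumes "t \<le> k"
  shows "partial_defect t = defect k n a T (\<lambda>i. if t < i then m i else 0) id"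
proof -
  have "[1..<Suc k] = [1..<Suc t] @ [Suc t..<Suc k]"
    using assms upt_add_eq_append[of 1 "Suc t" "k - t"] by simp
  moreover have "foldr (\<lambda>i. (\<circ>) (residual i ^^ (if t < i then m i else 0))) is g = g"
    if "set is \<subseteq> {..t}" for "is" and g :: "('h \<Rightarrow> 'h) \<Rightarrow> 'h \<Rightarrow> 'h"
    using that by (induction "is") auto
  moreover have "foldr (\<lambda>i. (\<circ>) (residual i ^^ (if t < i then m i else 0))) [Suc t..<Suc k] id =
      foldr (\<lambda>i. (\<circ>) (residual i ^^ m i)) [Suc t..<Suc k] id"
    by (rule foldr_cong) auto
  ultimately show ?thesis
    by (simp add: partial_defect_def defect_def atMost_def subset_iff del: upt_Suc)
qed

end

locale pure_variety = model_tuple k n m a T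
  for k :: nat and n m :: "nat \<Rightarrow> nat" and a :: "nat \<Rightarrow> nat list \<Rightarrow> real"
    and T :: "nat \<Rightarrow> nat \<Rightarrow> 'h \<Rightarrow> 'h::complex_hilbert_space" +
  fixes Q :: "nc_poly set"
  assumes in_variety: "T \<in> variety k n a m Q" and pure: "pure_tuple k n a T"
    and Q: "Q \<subseteq> nc_polys k n"
begin

lemma positive_partial_defect: "t \<le> k \<Longrightarrow> positive_op (partial_defect t)"
  using in_variety by (auto simp: partial_defect_eq variety_def polydomain_def)

lemma pure_qform: "i \<in> {1..k} \<Longrightarrow> (\<lambda>s. qform ((\<Phi> i ^^ s) id) x) \<longlonglongrightarrow> 0"
  using pure tendsto_Re[of _ 0 sequentially] unfolding pure_tuple_def by fastforce

text \<open>Inverting the residuals of row \<open>Suc t\<close> expresses the next partial defect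
  through the previous one at \<open>Ts (Suc t) \<gamma> x\<close>; the induction hypothesis expands
  the latter over the first \<open>t\<close> words.\<close>

lemma partial_defect_sum:
  "t \<le> k \<Longrightarrow> ((\<lambda>\<alpha>. (\<Prod>i\<in>{1..t}. fock_weight (a i) (m i) (\<alpha> i)) *
      qform (partial_defect 0) (cadjoint (partial_word t \<alpha>) x)) has_sum qform (partial_defect t) x)
    (\<Pi>\<^sub>E i\<in>{1..t}. lists {1..n i})"
proof (induction t arbitrary: x)
  case 0
  show ?case
    using has_sum_finite[of "{\<lambda>_. undefined}" "\<lambda>_. qform (partial_defect 0) x"]
    by (simp add: partial_word_def cadjoint_id[unfolded id_def] id_def)
next
  case (Suc t)
  let ?i = "Suc t" and ?P = "\<Pi>\<^sub>E i\<in>{1..t}. lists {1..n i}"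
  let ?w = "\<lambda>t \<alpha>. \<Prod>i\<in>{1..t}. fock_weight (a i) (m i) (\<alpha> i)"
  have i: "?i \<in> {1..k}" using Suc.prems by auto
  interpret r: row "n ?i" "a ?i" "T ?i" by (rule row[OF i])
  have split: "partial_defect t = (residual ?i ^^ m ?i) (partial_defect ?i)"
    unfolding partial_defect_def using Suc.prems by (subst upt_conv_Cons) auto
  have "weight_seq (a ?i) (m ?i) = fock_weight (a ?i) (m ?i)"
    using m_pos[OF i] by (simp add: weight_seq_def)
  then have outer: "((\<lambda>\<gamma>. fock_weight (a ?i) (m ?i) \<gamma> * qform (partial_defect t) (Ts ?i \<gamma> x)) has_sum
      qform (partial_defect ?i) x) (lists {1..n ?i})"
    using r.residual_pow_inverse[OF pure_qform[OF i] positive_op_bounded[OF positive_partial_defect[OF Suc.prems]],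
        of "m ?i"] positive_partial_defect[of t] Suc.prems unfolding split by auto
  have w_nonneg: "0 \<le> ?w t \<alpha>" if "\<alpha> \<in> ?P" for \<alpha>
    using that Suc.prems by (intro prod_nonneg ballI less_imp_le fw_pos) (auto simp: PiE_iff simp del: in_lists_conv_set)
  have "((\<lambda>(\<gamma>, \<alpha>). fock_weight (a ?i) (m ?i) \<gamma> * (?w t \<alpha> *
      qform (partial_defect 0) (cadjoint (partial_word t \<alpha>) (Ts ?i \<gamma> x)))) has_sum
      qform (partial_defect ?i) x) (lists {1..n ?i} \<times> ?P)"
    by (rule has_sum_Times_nonneg[OF has_sum_cmult_right[OF Suc.IH] outer])
      (use Suc.prems in \<open>auto intro!: mult_nonneg_nonneg less_imp_le[OF fw_pos[OF i]] w_nonneg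
        positive_op_form_nonneg[OF positive_partial_defect] simp del: in_lists_conv_set\<close>)
  then show ?case
  proof (rule has_sum_reindex_bij_witness[of _ "\<lambda>\<beta>. (\<beta> ?i, \<beta>(?i := undefined))" "\<lambda>(\<gamma>, \<alpha>). \<alpha>(?i := \<gamma>)",
        THEN iffD1, rotated -1])
    fix z assume z: "z \<in> lists {1..n ?i} \<times> ?P"
    then obtain \<gamma> \<alpha> where z_eq: "z = (\<gamma>, \<alpha>)" and \<gamma>: "\<gamma> \<in> lists {1..n ?i}" and \<alpha>: "\<alpha> \<in> ?P" by blast
    \<comment> \<open>Tuples of the extensional product are \<open>undefined\<close> at the new
      index, which makes insertion and removal of the last word mutually inverse.\<close>
    have undef: "\<alpha> ?i = undefined"
      using \<alpha> by (auto simp: PiE_iff extensional_def)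
    show "(\<lambda>\<beta>. (\<beta> ?i, \<beta>(?i := undefined))) ((\<lambda>(\<gamma>, \<alpha>). \<alpha>(?i := \<gamma>)) z) = z"
      unfolding z_eq using undef by (auto simp: fun_eq_iff)
    show "(\<lambda>(\<gamma>, \<alpha>). \<alpha>(?i := \<gamma>)) z \<in> (\<Pi>\<^sub>E i\<in>{1..?i}. lists {1..n i})"
      unfolding z_eq using \<gamma> \<alpha> by (auto simp: PiE_iff extensional_def le_Suc_eq)
    have "word_op (T ?i) \<gamma> \<circ> partial_word t \<alpha> = partial_word ?i (\<alpha>(?i := \<gamma>))"
    proof -
      have "partial_word t \<alpha> = partial_word t (\<alpha>(?i := \<gamma>))"
        unfolding partial_word_def by (rule foldr_cong) auto
      moreover have "rev [1..<Suc ?i] = ?i # rev [1..<Suc t]"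
        by simp
      ultimately show ?thesis
        by (simp only: partial_word_def foldr_comp_Cons fun_upd_same)
    qed
    moreover have "bounded_op (partial_word t \<alpha>)"
      unfolding partial_word_def
      by (rule bounded_foldr_op, rule bounded_word_T)
        (use \<alpha> Suc.prems in \<open>auto simp: PiE_iff simp del: in_lists_conv_set\<close>)
    ultimately have "cadjoint (partial_word ?i (\<alpha>(?i := \<gamma>))) x = cadjoint (partial_word t \<alpha>) (Ts ?i \<gamma> x)"
      using cadjoint_comp[OF bounded_word_T[OF i \<gamma>], of "partial_word t \<alpha>"] by (metis o_apply)
    moreover have "?w ?i (\<alpha>(?i := \<gamma>)) = fock_weight (a ?i) (m ?i) \<gamma> * ?w t \<alpha>"
    proof -
      have "{1..?i} = insert ?i {1..t}" by auto
      then show ?thesis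
        by (auto intro!: prod.cong)
    qed
    ultimately show "?w ?i ((\<lambda>(\<gamma>, \<alpha>). \<alpha>(?i := \<gamma>)) z) *
        qform (partial_defect 0) (cadjoint (partial_word ?i ((\<lambda>(\<gamma>, \<alpha>). \<alpha>(?i := \<gamma>)) z)) x) =
      (case z of (\<gamma>, \<alpha>) \<Rightarrow> fock_weight (a ?i) (m ?i) \<gamma> * (?w t \<alpha> *
        qform (partial_defect 0) (cadjoint (partial_word t \<alpha>) (Ts ?i \<gamma> x))))"
      unfolding z_eq by simp
  next
    fix \<beta> assume "\<beta> \<in> (\<Pi>\<^sub>E i\<in>{1..?i}. lists {1..n i})"
    then show "(\<beta> ?i, \<beta>(?i := undefined)) \<in> lists {1..n ?i} \<times> ?P"
      by (auto simp: PiE_iff extensional_def)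
  qed auto
qed

text \<open>At \<open>t = k\<close> the partial defect is the identity. In terms of the Berezin
  kernel this is the isometry property.\<close>

lemma defect_sum:
  "((\<lambda>\<beta>. bw \<beta> * qform (defect k n a T m id) (cadjoint (multi_word_op k T \<beta>) x)) has_sum (norm x)\<^sup>2) mw"
proof -
  have "partial_defect 0 = defect k n a T m id"
    by (simp add: partial_defect_def defect_def One_nat_def del: upt_Suc)
  moreover have "qform (partial_defect k) x = (norm x)\<^sup>2"
    by (simp add: partial_defect_def cinner_self)
  moreover have "((\<lambda>\<beta>. bw \<beta> * qform (partial_defect 0) (cadjoint (multi_word_op k T \<beta>) x)) has_sum
      qform (partial_defect k) x) mw"
    by (rule has_sum_cong[THEN iffD1, OF _ partial_defect_sum[OF order_refl, of x, folded multi_words_def]])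
      (simp add: partial_word_k bw_def)
  ultimately show ?thesis
    by simp
qed

lemma berezin_kernel:
  obtains K :: "'h \<Rightarrow> (nat \<Rightarrow> nat list, 'h) ell2"
  where "bounded_op K" "\<And>x. norm (K x) = norm x"
    "\<And>x. K x \<in> variety_space Q (defect_space k n a m T)"
    "\<And>i j x. i \<in> {1..k} \<Longrightarrow> j \<in> {1..n i} \<Longrightarrow> K (cadjoint (T i j) x) = wadj i j (K x)"
proof -
  let ?\<Delta> = "defect k n a T m id" and ?C = "\<lambda>\<beta>. cadjoint (multi_word_op k T \<beta>)"
  have pos: "positive_op ?\<Delta>"
    using in_variety unfolding variety_def polydomain_def by auto
  then obtain R where R: "bounded_op R" "\<And>x y. cinner (R x) y = cinner x (R y)" "R \<circ> R = ?\<Delta>"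
    using positive_op_square_root by blast
  interpret R: bounded_linear R by (rule bounded_op_linear[OF R(1)])
  \<comment> \<open>The coordinates of the kernel lie in the range of the root, whose closure is
    also that of the range of the defect.\<close>
  have D: "closure (range R) = defect_space k n a m T"
    unfolding defect_space_def R(3)[symmetric] by (rule closure_range_square[OF R(1,2), symmetric])
  note C_bounded = bounded_op_cadjoint[OF bounded_multi_word_T]
  have norm_R: "qform ?\<Delta> y = (norm (R y))\<^sup>2" for y
    by (simp add: R(3)[symmetric] R(2)[of "R y"] cinner_self)
  define f where "f x \<beta> = (if \<beta> \<in> mw then sqrt (bw \<beta>) *\<^sub>R R (?C \<beta> x) else 0)" for x \<beta>
  define K where "K x = Abs_ell2 (f x)" for x
  have f_sum: "((\<lambda>\<beta>. (norm (f x \<beta>))\<^sup>2) has_sum (norm x)\<^sup>2) UNIV" for x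
  proof (rule has_sum_cong_neutral[THEN iffD1, OF _ _ _ defect_sum[of x]])
    fix \<beta> assume "\<beta> \<in> mw \<inter> UNIV"
    then show "bw \<beta> * qform ?\<Delta> (?C \<beta> x) = (norm (f x \<beta>))\<^sup>2"
      using bw_pos[of \<beta>] by (simp add: f_def norm_R power_mult_distrib)
  qed (auto simp: f_def)
  have Rep_K: "Rep_ell2 (K x) = f x" for x
    unfolding K_def using has_sum_imp_summable[OF f_sum] by (simp add: Abs_ell2_inverse)
  have norm_K: "norm (K x) = norm x" for x
    using ell2_norm_has_sum[of "K x"] f_sum[of x] has_sum_unique by (fastforce simp: Rep_K)
  have hat_K: "hat (K x) \<beta> = R (?C \<beta> x)" if "\<beta> \<in> mw" for x \<beta>
    using that bw_pos[of \<beta>] by (simp add: hat_def Rep_K f_def)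
  have "bounded_op K"
  proof (rule bounded_opI)
    show "K (x + y) = K x + K y" for x y
      by (rule ell2_eqI)
        (simp add: Rep_K plus_ell2.rep_eq f_def bounded_op_add[OF C_bounded] R.add scaleR_right_distrib)
    show "K (c *\<^sub>C x) = c *\<^sub>C K x" for c x
      by (rule ell2_eqI)
        (simp add: Rep_K scaleC_ell2.rep_eq f_def bounded_op_scaleC[OF C_bounded] bounded_op_scaleC[OF R(1)]
          scaleR_scaleC_commute)
    show "norm (K x) \<le> 1 * norm x" for x by (simp add: norm_K)
  qed
  moreover have "K x \<in> variety_space Q (defect_space k n a m T)" for x
    unfolding variety_space_def
  proof (intro CollectI conjI allI impI ballI)
    show "Rep_ell2 (K x) \<beta> = 0" if "\<beta> \<notin> mw" for \<beta>
      using that by (simp add: Rep_K f_def)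
    show "Rep_ell2 (K x) \<beta> \<in> defect_space k n a m T" for \<beta>
    proof -
      have "f x \<beta> = R (if \<beta> \<in> mw then sqrt (bw \<beta>) *\<^sub>R ?C \<beta> x else 0)"
        by (simp add: f_def R.zero R.scaleR)
      then have "f x \<beta> \<in> range R"
        by (rule range_eqI)
      then show ?thesis
        unfolding Rep_K D[symmetric] by (rule subsetD[OF closure_subset])
    qed
    fix q \<alpha>' \<beta> assume q: "q \<in> Q" and mem: "\<alpha>' \<in> mw" "\<beta> \<in> mw"
    let ?keys = "Poly_Mapping.keys q" and ?c = "Poly_Mapping.lookup q"
    have keys: "\<alpha> \<in> mw" if "\<alpha> \<in> ?keys" for \<alpha>
      using q Q that unfolding nc_polys_def by blast
    define y where "y = ?C \<alpha>' x"
    \<comment> \<open>The sum is the adjoint of \<open>q(T)\<close> at \<open>y\<close>, and the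
      pairing of \<open>K x\<close> is its image under \<open>?C \<beta>\<close> followed by
      \<open>R\<close>.\<close>
    have zero: "(\<Sum>\<alpha>\<in>?keys. cnj (?c \<alpha>) *\<^sub>C ?C \<alpha> y) = 0"
    proof (rule cinner_ext_right)
      fix z
      have "cinner z (\<Sum>\<alpha>\<in>?keys. cnj (?c \<alpha>) *\<^sub>C ?C \<alpha> y) = cinner (poly_op k T q z) y"
        by (simp add: poly_op_def cinner.sum_left cinner.sum_right cinner_scaleC_left
            cinner_scaleC_right cinner_cadjoint bounded_multi_word_T keys)
      then show "cinner z (\<Sum>\<alpha>\<in>?keys. cnj (?c \<alpha>) *\<^sub>C ?C \<alpha> y) = cinner z 0"
        using in_variety q by (simp add: variety_def)
    qed
    interpret RC: bounded_linear "\<lambda>y. R (?C \<beta> y)"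
      by (rule bounded_linear_compose[OF R.bounded_linear_axioms bounded_op_linear[OF C_bounded[OF mem(2)]]])
    have "hat (K x) (mapp \<alpha>' (mapp \<alpha> \<beta>)) = R (?C \<beta> (?C \<alpha> y))" if "\<alpha> \<in> ?keys" for \<alpha>
      using keys[OF that] mem
      by (simp add: hat_K mw_mapp multi_word_T_mapp cadjoint_comp bounded_multi_word_T bounded_op_comp y_def)
    then have "pairing q \<alpha>' \<beta> (K x) = (\<Sum>\<alpha>\<in>?keys. R (?C \<beta> (cnj (?c \<alpha>) *\<^sub>C ?C \<alpha> y)))"
      unfolding pairing_def
      by (simp add: bounded_op_scaleC[OF R(1)] bounded_op_scaleC[OF C_bounded[OF mem(2)]])
    also have "\<dots> = 0"
      using RC.sum[of "\<lambda>\<alpha>. cnj (?c \<alpha>) *\<^sub>C ?C \<alpha> y" ?keys] by (simp add: zero RC.zero)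
    finally show "pairing q \<alpha>' \<beta> (K x) = 0" .
  qed
  moreover have "K (cadjoint (T i j) x) = wadj i j (K x)" if i: "i \<in> {1..k}" and j: "j \<in> {1..n i}" for i j x
  proof (rule ell2_eqI)
    fix \<beta>
    show "Rep_ell2 (K (cadjoint (T i j) x)) \<beta> = Rep_ell2 (wadj i j (K x)) \<beta>"
    proof (cases "\<beta> \<in> mw")
      case True
      note push = mw_push[OF True i j]
      have "?C (push i j \<beta>) x = ?C \<beta> (cadjoint (T i j) x)"
        unfolding multi_word_T_push[OF i j True]
        by (simp only: cadjoint_comp[OF bounded_T[OF i j] bounded_multi_word_T[OF True]] o_apply)
      then show ?thesis
        using True push bw_pos[OF True] bw_pos[OF push]
        by (simp add: Rep_K Rep_wadj[OF i j] f_def real_sqrt_divide)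
    qed (simp add: Rep_K Rep_wadj[OF i j] f_def)
  qed
  ultimately show ?thesis
    using that norm_K by blast
qed

end

theorem corollary3p7:
  fixes k :: nat
    and n m :: "nat \<Rightarrow> nat"
    and a :: "nat \<Rightarrow> nat list \<Rightarrow> real"
    and Q :: "nc_poly set"
    and T :: "nat \<Rightarrow> nat \<Rightarrow> 'h \<Rightarrow> 'h::complex_hilbert_space"
  assumes k: "1 \<le> k"
    and nm: "\<And>i. i \<in> {1..k} \<Longrightarrow> 1 \<le> n i \<and> 1 \<le> m i"
    and f: "\<And>i. i \<in> {1..k} \<Longrightarrow> positive_regular (n i) (a i)"
    and separable: "separable_space (euclidean :: 'h topology)"
    and Q: "Q \<subseteq> nc_polys k n"
    and N: "space_N k n a m Q \<noteq> {0}"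
    and T: "T \<in> cross_commuting k n"
    and Phi: "\<And>i. i \<in> {1..k} \<Longrightarrow> phi_well_defined (n i) (a i) (T i)"
  shows "(T \<in> variety k n a m Q \<and> pure_tuple k n a T \<longleftrightarrow>
      (\<exists>G U. closed G \<and> csubspace G \<and>
        G \<subseteq> tensor_space (space_N k n a m Q) (defect_space k n a m T) \<and>
        (\<forall>i\<in>{1..k}. \<forall>j\<in>{1..n i}.
          model_S_adj_tensor k n a m Q (defect_space k n a m T) i j ` G \<subseteq> G) \<and>
        unitary_onto G U \<and>
        (\<forall>i\<in>{1..k}. \<forall>j\<in>{1..n i}.
          cadjoint (T i j) =
            cadjoint U \<circ> model_S_adj_tensor k n a m Q (defect_space k n a m T) i j \<circ> U))) \<and>
    (positive_op (defect k n a T m id) \<longrightarrow>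
      (\<forall>R. positive_op R \<and> R \<circ> R = defect k n a T m id \<longrightarrow>
        defect_space k n a m T = closure (range R)))"
    (is "(?L \<longleftrightarrow> (\<exists>G U. ?P G U)) \<and> ?R")
proof -
  interpret model_tuple k n m a T
    using nm f T Phi by unfold_locales auto
  let ?D = "defect_space k n a m T" and ?S = "model_S_adj_tensor k n a m Q (defect_space k n a m T)"
  have tensor: "tensor_space (space_N k n a m Q) ?D = variety_space Q ?D"
    unfolding space_N_eq[OF Q] by (rule tensor_space_eq[OF defect_space])
  have S: "?S i j \<xi> = wadj i j \<xi>" if "i \<in> {1..k}" "j \<in> {1..n i}" "\<xi> \<in> variety_space Q ?D" for i j \<xi>
    using model_S_adj_tensor_eq[OF that(1,2) Q defect_space] that(3) unfolding tensor by blast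
  have forward: "\<exists>G U. ?P G U" if L: ?L
  proof -
    interpret pure_variety k n m a T Q
      using L Q by unfold_locales auto
    obtain K :: "'h \<Rightarrow> (nat \<Rightarrow> nat list, 'h) ell2" where K: "bounded_op K" "\<And>x. norm (K x) = norm x"
      "\<And>x. K x \<in> variety_space Q ?D"
      "\<And>i j x. i \<in> {1..k} \<Longrightarrow> j \<in> {1..n i} \<Longrightarrow> K (cadjoint (T i j) x) = wadj i j (K x)"
      using berezin_kernel by blast
    have SK: "?S i j (K x) = K (cadjoint (T i j) x)" if "i \<in> {1..k}" "j \<in> {1..n i}" for i j x
      using S[OF that K(3)] K(4)[OF that] by simp
    have iso: "cinner (K x) (K y) = cinner x y" for x y
      by (rule isometry_cinner[OF K(1,2)])
    have KK: "cadjoint K (K x) = x" for x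
      by (rule cinner_ext) (simp add: cinner_cadjoint_left[OF K(1)] iso)
    \<comment> \<open>The range of an isometry is closed, and the intertwining relation makes it
      invariant, so it can serve as \<open>G\<close>.\<close>
    have "?P (range K) K"
    proof (intro conjI ballI)
      show "closed (range K)" by (rule closed_range_isometry[OF K(1,2)])
      show "csubspace (range K)" by (rule csubspace_range[OF K(1)])
      show "range K \<subseteq> tensor_space (space_N k n a m Q) ?D"
        unfolding tensor using K(3) by blast
      show "unitary_onto (range K) K"
        using K(1) iso by (simp add: unitary_onto_def)
      fix i j assume ij: "i \<in> {1..k}" "j \<in> {1..n i}"
      show "?S i j ` range K \<subseteq> range K"
        using SK[OF ij] by auto
      show "cadjoint (T i j) = cadjoint K \<circ> ?S i j \<circ> K"
        using SK[OF ij] KK by (auto simp: fun_eq_iff)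
    qed
    then show ?thesis by blast
  qed
  have backward: ?L if "?P G U" for G U
  proof -
    have U: "bounded_op U" "\<And>x y. cinner (U x) (U y) = cinner x y" "range U = G"
      using that by (auto simp: unitary_onto_def)
    have norm_U: "norm (U x) = norm x" for x
      using U(2)[of x x] by (simp add: cinner_self power2_eq_iff_nonneg flip: of_real_power)
    have UU: "cadjoint U (U x) = x" for x
      by (rule cinner_ext) (simp add: cinner_cadjoint_left[OF U(1)] U(2))
    have range_U: "U x \<in> variety_space Q ?D" for x
      using that U(3) unfolding tensor by blast
    have "U (cadjoint (T i j) x) = wadj i j (U x)" if ij: "i \<in> {1..k}" "j \<in> {1..n i}" for i j x
    proof -
      \<comment> \<open>The hypothesis describes only a compression. Invariance of \<open>G\<close>
        keeps this vector in the range of \<open>U\<close>, where \<open>cadjoint U\<close> followed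
        by \<open>U\<close> is the identity, so the compression becomes an intertwining.\<close>
      have "?S i j (U x) \<in> range U"
        using \<open>?P G U\<close> ij U(3) by blast
      then obtain z where z: "?S i j (U x) = U z" by blast
      have "cadjoint (T i j) x = cadjoint U (?S i j (U x))"
        using \<open>?P G U\<close> ij by (metis o_apply)
      then show ?thesis
        using S[OF ij range_U[of x]] by (simp add: z UU)
    qed
    moreover have "U x \<in> variety_space Q UNIV" for x
      using range_U[of x] by (auto simp: variety_space_def)
    ultimately interpret compression k n m a T U Q
      using U(1) norm_U Q by unfold_locales auto
    show ?L
      using in_variety pure_tupleI[OF pure_qform] by blast
  qed
  have "?L \<longleftrightarrow> (\<exists>G U. ?P G U)"
    by (rule iffI, erule forward, elim exE, erule backward)
  moreover have ?R
  proof (intro impI allI)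
    fix R assume "positive_op R \<and> R \<circ> R = defect k n a T m id"
    then show "?D = closure (range R)"
      using closure_range_square[of R] positive_op_bounded[of R] positive_op_selfadjoint[of R]
      unfolding defect_space_def by simp
  qed
  ultimately show ?thesis
    by (rule conjI)
qed

end
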